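(* Let $L$ be a logical system of dimension $d_L$ and $A=A_1\otimes\cdots\otimes A_n$ a physical system with $\dim A_i=d_i<\infty$. Let $V:L\to A$ be an isometry with encoding $\mathcal{E}(\cdot)=V(\cdot)V^\dagger$ that is $SU(d_L)$-covariant with a transversal action: there are continuous unitary representations $U\mapsto U_i(U)$ of $SU(d_L)$ on $A_i$ such that, with $U_A(U)=U_1(U)\otimes\cdots\otimes U_n(U)$, $\mathcal{E}(U(\cdot)U^\dagger)=U_A(U)\mathcal{E}(\cdot)U_A(U)^\dagger$ for all $U\in SU(d_L)$. Let $\mathcal{N}$ be the single-erasure noise $\mathcal{N}(\cdot)=\sum_{i=1}^n\frac1n|i\rangle\langle i|_C\otimes|\phi_i\rangle\langle\phi_i|_{A_i}\otimes\operatorname{tr}_{A_i}(\cdot)$ and write $\epsilon_{\mathrm{worst}}=\epsilon_{\mathrm{worst}}(\mathcal{N}\circ\mathcal{E})$. Then $$\epsilon_{\mathrm{worst}}\geq\frac{1}{2n}\frac{1}{\max_i\ln d_i}+O\!\left(\frac{1}{n\,d_L}\right),$$ and moreover $$\max_i\ln d_i\geq\frac{\ln(d_L-1)}{2n\epsilon_{\mathrm{worst}}}-\frac{\ln\left(1+(2n\epsilon_{\mathrm{worst}})^{-1}\right)}{2n\epsilon_{\mathrm{worst}}},\qquad \max_i\ln d_i\geq(d_L-1)\ln\!\left(\frac{1}{2\epsilon_{\mathrm{worst}}\,n\,d_L}\right).$$ The first and third bounds also hold with $\epsilon_{\mathrm{worst}}$ replaced by $d_L\epsilon_{\mathrm 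e}(\mathcal{N}\circ\mathcal{E})/2$.
   Context: Fidelity $F(\rho,\sigma)=\|\sqrt\rho\sqrt\sigma\|_1$; for channels $\mathcal{K},\mathcal{K}'$ with input $L$ and pure $|\phi\rangle_{LR}$, $F_{|\phi\rangle}(\mathcal{K},\mathcal{K}')=F((\mathcal{K}\otimes\mathrm{id}_R)(\phi),(\mathcal{K}'\otimes\mathrm{id}_R)(\phi))$. Let $|\hat\phi\rangle=\sum_k|k\rangle|k\rangle/\sqrt{d_L}$. For a channel $\mathcal{M}$ from $L$ to $B$: $f_{\mathrm e}(\mathcal{M})=\max_{\mathcal{R}}F_{|\hat\phi\rangle}(\mathcal{R}\circ\mathcal{M},\mathrm{id}_L)$ and $f_{\mathrm{worst}}(\mathcal{M})=\max_{\mathcal{R}}\min_{|\phi\rangle}F_{|\phi\rangle}(\mathcal{R}\circ\mathcal{M},\mathrm{id}_L)$, $\mathcal{R}$ over channels $B\to L$; $\epsilon_{\mathrm e}=\sqrt{1-f_{\mathrm e}^2}$, $\epsilon_{\mathrm{worst}}=\sqrt{1-f_{\mathrm{worst}}^2}$. *)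

theory Defs
  imports Complex_Main "Jordan_Normal_Form.Determinant"
begin

definition adj :: "complex mat \<Rightarrow> complex mat" where
  "adj A = mat (dim_col A) (dim_row A) (\<lambda>(i,j). cnj (A $$ (j,i)))"

definition mtrace :: "complex mat \<Rightarrow> complex" where
  "mtrace A = (\<Sum>i<dim_row A. A $$ (i,i))"

definition msum :: "nat \<Rightarrow> nat \<Rightarrow> 'i set \<Rightarrow> ('i \<Rightarrow> complex mat) \<Rightarrow> complex mat" where
  "msum r c I f = mat r c (\<lambda>(i,j). \<Sum>x\<in>I. f x $$ (i,j))"

definition psd :: "nat \<Rightarrow> complex mat \<Rightarrow> bool" where
  "psd n A \<longleftrightarrow> A \<in> carrier_mat n n \<and> adj A = A \<and>
     (\<forall>v \<in> carrier_vec n. 0 \<le> Re (\<Sum>i<n. cnj (v $ i) * (A *\<^sub>v v) $ i))"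

definition msqrt :: "complex mat \<Rightarrow> complex mat" where
  "msqrt A = (THE B. psd (dim_row A) B \<and> B * B = A)"

definition trace_norm :: "complex mat \<Rightarrow> real" where
  "trace_norm X = Re (mtrace (msqrt (adj X * X)))"

definition fidelity :: "complex mat \<Rightarrow> complex mat \<Rightarrow> real" where
  "fidelity \<rho> \<sigma> = trace_norm (msqrt \<rho> * msqrt \<sigma>)"

text \<open>Kronecker (tensor) product; the first factor is the most significant index.\<close>
definition kron :: "complex mat \<Rightarrow> complex mat \<Rightarrow> complex mat" where
  "kron A B = mat (dim_row A * dim_row B) (dim_col A * dim_col B)
     (\<lambda>(i,j). A $$ (i div dim_row B, j div dim_col B) * B $$ (i mod dim_row B, j mod dim_col B))"

definition kron_all :: "nat \<Rightarrow> (nat \<Rightarrow> complex mat) \<Rightarrow> complex mat" where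
  "kron_all n M = foldr (\<lambda>i acc. kron (M i) acc) [0..<n] (1\<^sub>m 1)"

definition ket_bra :: "nat \<Rightarrow> nat \<Rightarrow> nat \<Rightarrow> complex mat" where
  "ket_bra d a b = mat d d (\<lambda>(r,s). if r = a \<and> s = b then 1 else 0)"

definition proj :: "complex vec \<Rightarrow> complex mat" where
  "proj v = mat (dim_vec v) (dim_vec v) (\<lambda>(i,j). v $ i * cnj (v $ j))"

definition unit_vec_in :: "nat \<Rightarrow> complex vec \<Rightarrow> bool" where
  "unit_vec_in d v \<longleftrightarrow> v \<in> carrier_vec d \<and> (\<Sum>i<d. (cmod (v $ i))\<^sup>2) = 1"

text \<open>A quantum channel (CPTP map) from a system of dimension din to one of dimension dout,
  given in Kraus form (Kraus representation theorem).\<close>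
definition is_channel :: "nat \<Rightarrow> nat \<Rightarrow> (complex mat \<Rightarrow> complex mat) \<Rightarrow> bool" where
  "is_channel din dout \<Phi> \<longleftrightarrow> (\<exists>K :: nat \<Rightarrow> complex mat. \<exists>m.
      (\<forall>k<m. K k \<in> carrier_mat dout din) \<and>
      msum din din {..<m} (\<lambda>k. adj (K k) * K k) = 1\<^sub>m din \<and>
      (\<forall>X \<in> carrier_mat din din. \<Phi> X = msum dout dout {..<m} (\<lambda>k. K k * X * adj (K k))))"

text \<open>\<open>(\<Phi> \<otimes> id\<^sub>R)(X)\<close> for X on \<open>L \<otimes> R\<close> (L first), \<open>\<Phi>\<close> with output dimension dout.\<close>
definition ext_R :: "nat \<Rightarrow> nat \<Rightarrow> nat \<Rightarrow> (complex mat \<Rightarrow> complex mat) \<Rightarrow> complex mat \<Rightarrow> complex mat" where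
  "ext_R dL dR dout \<Phi> X = msum (dout * dR) (dout * dR) ({..<dR} \<times> {..<dR})
     (\<lambda>(a,b). kron (\<Phi> (mat dL dL (\<lambda>(l,l'). X $$ (l * dR + a, l' * dR + b)))) (ket_bra dR a b))"

definition F_phi :: "nat \<Rightarrow> nat \<Rightarrow> nat \<Rightarrow> complex vec \<Rightarrow>
    (complex mat \<Rightarrow> complex mat) \<Rightarrow> (complex mat \<Rightarrow> complex mat) \<Rightarrow> real" where
  "F_phi dL dR dout \<phi> K K' = fidelity (ext_R dL dR dout K (proj \<phi>)) (ext_R dL dR dout K' (proj \<phi>))"

definition max_ent :: "nat \<Rightarrow> complex vec" where
  "max_ent dL = vec (dL * dL) (\<lambda>i. if i div dL = i mod dL then complex_of_real (1 / sqrt (real dL)) else 0)"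

definition f_e :: "nat \<Rightarrow> nat \<Rightarrow> (complex mat \<Rightarrow> complex mat) \<Rightarrow> real" where
  "f_e dL dB M = Sup {F_phi dL dL dL (max_ent dL) (R \<circ> M) id | R. is_channel dB dL R}"

definition f_worst :: "nat \<Rightarrow> nat \<Rightarrow> (complex mat \<Rightarrow> complex mat) \<Rightarrow> real" where
  "f_worst dL dB M = Sup {Inf {F_phi dL dR dL \<phi> (R \<circ> M) id | dR \<phi>. 0 < dR \<and> unit_vec_in (dL * dR) \<phi>}
                          | R. is_channel dB dL R}"

definition eps_e :: "nat \<Rightarrow> nat \<Rightarrow> (complex mat \<Rightarrow> complex mat) \<Rightarrow> real" where
  "eps_e dL dB M = sqrt (1 - (f_e dL dB M)\<^sup>2)"

definition eps_worst :: "nat \<Rightarrow> nat \<Rightarrow> (complex mat \<Rightarrow> complex mat) \<Rightarrow> real" where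
  "eps_worst dL dB M = sqrt (1 - (f_worst dL dB M)\<^sup>2)"

definition dimA :: "nat \<Rightarrow> (nat \<Rightarrow> nat) \<Rightarrow> nat" where
  "dimA n d = (\<Prod>i<n. d i)"

text \<open>Weight of the i-th tensor factor in the mixed-radix index of A.\<close>
definition wt :: "nat \<Rightarrow> (nat \<Rightarrow> nat) \<Rightarrow> nat \<Rightarrow> nat" where
  "wt n d i = (\<Prod>j\<in>{Suc i..<n}. d j)"

definition digit :: "nat \<Rightarrow> (nat \<Rightarrow> nat) \<Rightarrow> nat \<Rightarrow> nat \<Rightarrow> nat" where
  "digit n d i a = (a div wt n d i) mod d i"

definition set_digit :: "nat \<Rightarrow> (nat \<Rightarrow> nat) \<Rightarrow> nat \<Rightarrow> nat \<Rightarrow> nat \<Rightarrow> nat" where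
  "set_digit n d i a k = a - digit n d i a * wt n d i + k * wt n d i"

text \<open>\<open>|\<phi>\<^sub>i\<rangle>\<langle>\<phi>\<^sub>i|\<^sub>A\<^sub>i \<otimes> tr\<^sub>A\<^sub>i(X)\<close> (with \<open>A\<^sub>i\<close> kept in its slot).\<close>
definition replace_factor :: "nat \<Rightarrow> (nat \<Rightarrow> nat) \<Rightarrow> complex vec \<Rightarrow> nat \<Rightarrow> complex mat \<Rightarrow> complex mat" where
  "replace_factor n d \<psi> i X = mat (dimA n d) (dimA n d) (\<lambda>(a,b).
      \<psi> $ digit n d i a * cnj (\<psi> $ digit n d i b) *
      (\<Sum>k<d i. X $$ (set_digit n d i a k, set_digit n d i b k)))"

definition erasure_noise :: "nat \<Rightarrow> (nat \<Rightarrow> nat) \<Rightarrow> (nat \<Rightarrow> complex vec) \<Rightarrow> complex mat \<Rightarrow> complex mat" where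
  "erasure_noise n d \<phi> X = msum (n * dimA n d) (n * dimA n d) {..<n}
      (\<lambda>i. (complex_of_real (1 / real n)) \<cdot>\<^sub>m kron (ket_bra n i i) (replace_factor n d (\<phi> i) i X))"

definition encoding :: "complex mat \<Rightarrow> complex mat \<Rightarrow> complex mat" where
  "encoding V X = V * X * adj V"

definition SU :: "nat \<Rightarrow> complex mat set" where
  "SU m = {U \<in> carrier_mat m m. adj U * U = 1\<^sub>m m \<and> det U = 1}"

definition cont_unitary_rep :: "nat \<Rightarrow> nat \<Rightarrow> (complex mat \<Rightarrow> complex mat) \<Rightarrow> bool" where
  "cont_unitary_rep dL k \<rho> \<longleftrightarrow>
     (\<forall>U \<in> SU dL. \<rho> U \<in> carrier_mat k k \<and> adj (\<rho> U) * \<rho> U = 1\<^sub>m k) \<and>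
     (\<forall>U \<in> SU dL. \<forall>W \<in> SU dL. \<rho> (U * W) = \<rho> U * \<rho> W) \<and>
     (\<forall>U \<in> SU dL. \<forall>e>0. \<exists>\<delta>>0. \<forall>W \<in> SU dL.
        (\<forall>j<dL. \<forall>l<dL. cmod (W $$ (j,l) - U $$ (j,l)) < \<delta>) \<longrightarrow>
        (\<forall>j<k. \<forall>l<k. cmod (\<rho> W $$ (j,l) - \<rho> U $$ (j,l)) < e))"

definition transversal_covariant_code ::
  "nat \<Rightarrow> (nat \<Rightarrow> nat) \<Rightarrow> nat \<Rightarrow> complex mat \<Rightarrow> (nat \<Rightarrow> complex mat \<Rightarrow> complex mat) \<Rightarrow> bool" where
  "transversal_covariant_code n d dL V Ur \<longleftrightarrow>
     V \<in> carrier_mat (dimA n d) dL \<and> adj V * V = 1\<^sub>m dL \<and>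
     (\<forall>i<n. cont_unitary_rep dL (d i) (Ur i)) \<and>
     (\<forall>U \<in> SU dL. \<forall>X \<in> carrier_mat dL dL.
        encoding V (U * X * adj U) =
        kron_all n (\<lambda>i. Ur i U) * encoding V X * adj (kron_all n (\<lambda>i. Ur i U)))"

definition maxlog :: "nat \<Rightarrow> (nat \<Rightarrow> nat) \<Rightarrow> real" where
  "maxlog n d = Max ((\<lambda>i. ln (real (d i))) ` {..<n})"

definition setting ::
  "nat \<Rightarrow> (nat \<Rightarrow> nat) \<Rightarrow> nat \<Rightarrow> complex mat \<Rightarrow> (nat \<Rightarrow> complex mat \<Rightarrow> complex mat) \<Rightarrow> (nat \<Rightarrow> complex vec) \<Rightarrow> bool" where
  "setting n d dL V Ur \<phi> \<longleftrightarrow> 0 < n \<and> 2 \<le> dL \<and> (\<forall>i<n. 0 < d i) \<and>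
     transversal_covariant_code n d dL V Ur \<and> (\<forall>i<n. unit_vec_in (d i) (\<phi> i))"

definition noisy_code :: "nat \<Rightarrow> (nat \<Rightarrow> nat) \<Rightarrow> complex mat \<Rightarrow> (nat \<Rightarrow> complex vec) \<Rightarrow> complex mat \<Rightarrow> complex mat" where
  "noisy_code n d V \<phi> = erasure_noise n d \<phi> \<circ> encoding V"

end

theory Submission
  imports Defs "HOL-Computational_Algebra.Fundamental_Theorem_Algebra"
begin

text \<open>By transversality, the logical charge with eigenvalues \<open>1\<close> on \<open>|0\<rangle>\<close> and \<open>-1\<close> on \<open>|d\<^sub>L - 1\<rangle>\<close> is,
  up to a constant, encoded as a sum \<open>\<Sum>\<^sub>i T\<^sub>i\<close> of local charges. The environment, which receives a random
  subsystem, can measure \<open>n T\<^sub>i\<close> and thereby distinguishes two logical charges. If the recovery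
  has a small error then the environment is almost decoupled from the logical system, which gives
  \<open>1 \<le> 2 n m \<epsilon>\<close> whenever \<open>m\<close> bounds the norms of all \<open>T\<^sub>i\<close>. The weights of a representation of
  \<open>SU(d\<^sub>L)\<close> are closed under permutations and root strings; if \<open>m\<close> is the norm of some \<open>T\<^sub>i\<close>, then there are
  at least \<open>(d\<^sub>L - 1 + m) choose m\<close> of them, whence \<open>ln ((d\<^sub>L - 1 + m) choose m) \<le> max\<^sub>i ln d\<^sub>i\<close>.
  Eliminating \<open>m\<close> gives all the bounds.\<close>

section \<open>Commuting normal matrices\<close>

text \<open>Covariance is an identity between channels, so it fixes the action of the symmetry on
  the code only up to a phase depending on \<open>t\<close>. Hence only the difference of two
  codeword charges is known; it equals 2, and both probe states give the same weight q to |0> and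
  |dL - 1>. The observable detecting it has norm at most n m and expectation 2 q, while an
  infidelity eps shifts expectations by at most 2 n m eps. This gives q <= n m eps: the worst-case
  parameter uses q = 1/2, the maximally entangled input has q = 1/dL, which is where dL eps_e / 2
  comes from.

  A representation is only assumed continuous; neither derivatives nor a Lie algebra action are
  given. So the torus is diagonalised by elementary means, rotations are written as conjugates of
  torus elements, and relations between weights come from differentiating group identities at 0.

  The binomial is the dimension of the m-th symmetric power of the defining representation, where
  all weights are simple and the gap m occurs, so the count of weights is sharp.\<close>

lemma mat_mult_entry:
  "A \<in> carrier_mat n m \<Longrightarrow> B \<in> carrier_mat m l \<Longrightarrow> i < n \<Longrightarrow> j < l \<Longrightarrow>
   (A * B) $$ (i,j) = (\<Sum>k<m. A $$ (i,k) * B $$ (k,j))"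
  by (auto simp: scalar_prod_def atLeast0LessThan intro!: sum.cong)

lemma mat_vec_entry:
  "A \<in> carrier_mat n m \<Longrightarrow> v \<in> carrier_vec m \<Longrightarrow> i < n \<Longrightarrow>
   (A *\<^sub>v v) $ i = (\<Sum>k<m. A $$ (i,k) * v $ k)"
  by (auto simp: scalar_prod_def atLeast0LessThan intro!: sum.cong)

lemma adj_carrier [simp]: "A \<in> carrier_mat n m \<Longrightarrow> adj A \<in> carrier_mat m n"
  by (auto simp: adj_def)

lemma adj_entry: "A \<in> carrier_mat n m \<Longrightarrow> i < m \<Longrightarrow> j < n \<Longrightarrow> adj A $$ (i,j) = cnj (A $$ (j,i))"
  by (auto simp: adj_def)

lemma adj_adj [simp]: "adj (adj A) = A"
  by (rule eq_matI) (auto simp: adj_def)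

lemma adj_one [simp]: "adj (1\<^sub>m n) = 1\<^sub>m n"
  by (rule eq_matI) (auto simp: adj_def)

lemma adj_mult:
  assumes "A \<in> carrier_mat n m" "B \<in> carrier_mat m l"
  shows "adj (A * B) = adj B * adj A"
proof (rule eq_matI)
  fix i j assume "i < dim_row (adj B * adj A)" "j < dim_col (adj B * adj A)"
  then have ij: "i < l" "j < n" using assms by (auto simp: adj_def)
  show "adj (A * B) $$ (i,j) = (adj B * adj A) $$ (i,j)"
    using ij assms
    by (simp del: index_mult_mat add: adj_entry[OF mult_carrier_mat[OF assms]] mat_mult_entry[OF assms]
        mat_mult_entry[OF adj_carrier[OF assms(2)] adj_carrier[OF assms(1)]]
        adj_entry[OF assms(1)] adj_entry[OF assms(2)] mult.commute)
qed (use assms in \<open>auto simp: adj_def\<close>)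

definition cdiag :: "nat \<Rightarrow> (nat \<Rightarrow> complex) \<Rightarrow> complex mat" where
  "cdiag n a = mat n n (\<lambda>(i,j). if i = j then a i else 0)"

lemma cdiag_carrier [simp]: "cdiag n a \<in> carrier_mat n n"
  by (simp add: cdiag_def)

lemma cdiag_one: "cdiag n (\<lambda>_. 1) = 1\<^sub>m n"
  by (rule eq_matI) (auto simp: cdiag_def)

lemma cdiag_mult_entry:
  "A \<in> carrier_mat n m \<Longrightarrow> i < n \<Longrightarrow> j < m \<Longrightarrow> (cdiag n a * A) $$ (i,j) = a i * A $$ (i,j)"
proof -
  assume A: "A \<in> carrier_mat n m" and ij: "i < n" "j < m"
  have "(cdiag n a * A) $$ (i,j) = (\<Sum>k<n. (if k = i then a i * A $$ (k,j) else 0))"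
    unfolding mat_mult_entry[OF cdiag_carrier A ij] using ij by (intro sum.cong) (auto simp: cdiag_def)
  then show ?thesis using ij by simp
qed

lemma mult_cdiag_entry:
  "A \<in> carrier_mat m n \<Longrightarrow> i < m \<Longrightarrow> j < n \<Longrightarrow> (A * cdiag n a) $$ (i,j) = A $$ (i,j) * a j"
proof -
  assume A: "A \<in> carrier_mat m n" and ij: "i < m" "j < n"
  have "(A * cdiag n a) $$ (i,j) = (\<Sum>k<n. (if k = j then A $$ (i,k) * a j else 0))"
    unfolding mat_mult_entry[OF A cdiag_carrier ij] using ij by (intro sum.cong) (auto simp: cdiag_def)
  then show ?thesis using ij by simp
qed

lemma cdiag_mult: "cdiag n a * cdiag n b = cdiag n (\<lambda>i. a i * b i)"
proof (rule eq_matI)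
  fix i j assume "i < dim_row (cdiag n (\<lambda>i. a i * b i))" "j < dim_col (cdiag n (\<lambda>i. a i * b i))"
  then have ij: "i < n" "j < n" by (auto simp: cdiag_def)
  show "(cdiag n a * cdiag n b) $$ (i,j) = cdiag n (\<lambda>i. a i * b i) $$ (i,j)"
    unfolding cdiag_mult_entry[OF cdiag_carrier ij] using ij by (simp add: cdiag_def)
qed (auto simp: cdiag_def)

lemma adj_cdiag: "adj (cdiag n a) = cdiag n (\<lambda>i. cnj (a i))"
  by (rule eq_matI) (auto simp: cdiag_def adj_def)

text \<open>More unknowns than equations: padding with zero rows gives a square matrix whose row
  \<open>j\<close> vanishes, so its transpose kills \<open>unit_vec k j\<close> and the determinant
  is zero.\<close>

lemma homogeneous_solution:
  fixes f :: "nat \<Rightarrow> nat \<Rightarrow> complex"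
  assumes "j < k"
  shows "\<exists>v \<in> carrier_vec k. v \<noteq> 0\<^sub>v k \<and> (\<forall>i<j. (\<Sum>s<k. f i s * v $ s) = 0)"
proof -
  define M where "M = mat k k (\<lambda>(i,s). if i < j then f i s else 0)"
  have M: "M \<in> carrier_mat k k" by (simp add: M_def)
  have "transpose_mat M *\<^sub>v unit_vec k j = 0\<^sub>v k"
    using assms by (auto simp: M_def scalar_prod_def intro!: eq_vecI sum.neutral)
  then have "det (transpose_mat M) = 0"
    using assms by (subst det_0_iff_vec_prod_zero[of _ k]) (use M in \<open>auto intro!: exI[of _ "unit_vec k j"]\<close>)
  then have "det M = 0" using det_transpose[OF M] by simp
  then obtain v where v: "v \<in> carrier_vec k" "v \<noteq> 0\<^sub>v k" "M *\<^sub>v v = 0\<^sub>v k"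
    using det_0_iff_vec_prod_zero[OF M] by auto
  have "(\<Sum>s<k. f i s * v $ s) = 0" if "i < j" for i
  proof -
    have "(M *\<^sub>v v) $ i = (\<Sum>s<k. f i s * v $ s)"
      using that assms mat_vec_entry[OF M v(1), of i] by (simp add: M_def)
    then show ?thesis using v that assms by simp
  qed
  then show ?thesis using v by blast
qed

lemma eq_smult_vecI:
  "A \<in> carrier_mat k k \<Longrightarrow> w \<in> carrier_vec k \<Longrightarrow>
   (\<And>i. i < k \<Longrightarrow> (\<Sum>s<k. A $$ (i,s) * w $ s) = c * w $ i) \<Longrightarrow> A *\<^sub>v w = c \<cdot>\<^sub>v (w :: complex vec)"
  by (rule eq_vecI) (simp_all add: mat_vec_entry del: index_mult_mat_vec)

text \<open>An eigenvector of \<open>A\<close> is found among the vectors \<open>p(A) v\<close>, so that every common eigenvector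
  property of \<open>v\<close> for matrices commuting with \<open>A\<close> is inherited.\<close>
lemma krylov_eigenvector:
  fixes A :: "complex mat"
  assumes A: "A \<in> carrier_mat k k" and v: "v \<in> carrier_vec k" "v \<noteq> 0\<^sub>v k"
  shows "\<exists>c. \<exists>w \<in> carrier_vec k. w \<noteq> 0\<^sub>v k \<and> A *\<^sub>v w = c \<cdot>\<^sub>v w \<and>
    (\<forall>B \<in> carrier_mat k k. \<forall>b. A * B = B * A \<longrightarrow> B *\<^sub>v v = b \<cdot>\<^sub>v v \<longrightarrow> B *\<^sub>v w = b \<cdot>\<^sub>v w)"
proof -
  define X where "X i = ((\<lambda>x. A *\<^sub>v x) ^^ i) v" for i
  have X: "X i \<in> carrier_vec k" for i
    by (induction i) (use A v in \<open>auto simp: X_def\<close>)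
  have XS: "(\<Sum>s<k. A $$ (r,s) * X i $ s) = X (Suc i) $ r" if "r < k" for r i
    using mat_vec_entry[OF A X that, of i] by (simp add: X_def)
  \<comment> \<open>\<open>pv p\<close> lists the coordinates of p(A) v; \<open>pv_step\<close>
    below is the effect of one more linear factor.\<close>
  define pv where "pv p r = (\<Sum>i\<le>degree p. coeff p i * X i $ r)" for p r
  have pv_N: "pv p r = (\<Sum>i\<le>N. coeff p i * X i $ r)" if "degree p \<le> N" for p r N
    unfolding pv_def using that by (intro sum.mono_neutral_left) (auto simp: coeff_eq_0)
  have A_pv: "(\<Sum>s<k. A $$ (r,s) * pv q s) = (\<Sum>i\<le>degree q. coeff q i * X (Suc i) $ r)" if "r < k" for q r
  proof -
    have "(\<Sum>s<k. A $$ (r,s) * pv q s) = (\<Sum>i\<le>degree q. coeff q i * (\<Sum>s<k. A $$ (r,s) * X i $ s))"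
      unfolding pv_def sum_distrib_left by (subst sum.swap) (simp add: mult_ac)
    then show ?thesis using XS[OF that] by simp
  qed
  have pv_step: "pv ([:-c, 1:] * q) r = (\<Sum>s<k. A $$ (r,s) * pv q s) - c * pv q r" if "r < k" for c q r
  proof -
    let ?N = "degree q"
    have eq: "[:-c, 1:] * q = pCons 0 q - smult c q" by simp
    have "degree ([:-c, 1:] * q) \<le> Suc ?N"
      using degree_mult_le[of "[:-c, 1:]" q] by simp
    then have "pv ([:-c, 1:] * q) r = (\<Sum>i\<le>Suc ?N. coeff ([:-c, 1:] * q) i * X i $ r)"
      by (rule pv_N)
    also have "\<dots> = (\<Sum>i\<le>Suc ?N. coeff (pCons 0 q) i * X i $ r) - c * (\<Sum>i\<le>Suc ?N. coeff q i * X i $ r)"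
      unfolding eq by (simp only: coeff_diff coeff_smult left_diff_distrib sum_subtractf sum_distrib_left mult.assoc)
    also have "(\<Sum>i\<le>Suc ?N. coeff q i * X i $ r) = pv q r"
      by (rule pv_N[symmetric]) simp
    also have "(\<Sum>i\<le>Suc ?N. coeff (pCons 0 q) i * X i $ r) = (\<Sum>i\<le>?N. coeff q i * X (Suc i) $ r)"
      by (subst sum.atMost_Suc_shift) simp
    finally show ?thesis using A_pv[OF that] by simp
  qed
  \<comment> \<open>The k + 1 vectors v, A v, ..., A^k v in dimension k are dependent, which gives a
    nonzero polynomial \<open>p\<close> with p(A) v = 0.\<close>
  obtain y where y: "y \<in> carrier_vec (Suc k)" "y \<noteq> 0\<^sub>v (Suc k)"
      "\<And>i. i < k \<Longrightarrow> (\<Sum>s<Suc k. X s $ i * y $ s) = 0"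
    using homogeneous_solution[of k "Suc k" "\<lambda>i s. X s $ i"] by auto
  define p where "p = (\<Sum>j\<le>k. monom (y $ j) j)"
  have cp: "coeff p i = (if i \<le> k then y $ i else 0)" for i
    by (auto simp: p_def coeff_sum)
  have p0: "p \<noteq> 0"
  proof
    assume "p = 0"
    then have "y $ i = 0" if "i < Suc k" for i using cp[of i] that by simp
    then have "y = 0\<^sub>v (Suc k)" using y(1) by (intro eq_vecI) auto
    then show False using y by simp
  qed
  have dp: "degree p \<le> k" by (rule degree_le) (simp add: cp)
  have pvp: "pv p r = 0" if "r < k" for r
    unfolding pv_N[OF dp] using y(3)[OF that] by (simp add: cp lessThan_Suc_atMost mult.commute)
  have v_ne: "\<exists>r<k. v $ r \<noteq> 0"
  proof (rule ccontr)
    assume "\<not> ?thesis"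
    then have "v = 0\<^sub>v k" using v(1) by (intro eq_vecI) auto
    then show False using v(2) by simp
  qed
  \<comment> \<open>Linear factors are split off \<open>p\<close> until the remaining
    \<open>q\<close> no longer kills \<open>v\<close>; then q(A) v is an eigenvector for the last
    root removed.\<close>
  have "\<exists>c q. (\<forall>r<k. pv ([:-c, 1:] * q) r = 0) \<and> (\<exists>r<k. pv q r \<noteq> 0)"
    using p0 pvp
  proof (induction "degree p" arbitrary: p)
    case 0
    then have "pv p r = coeff p 0 * v $ r" for r by (simp add: pv_def X_def)
    moreover have "coeff p 0 \<noteq> 0" using 0 by (metis degree_0_id leading_coeff_0_iff)
    ultimately show ?case using v_ne 0 by auto
  next
    case (Suc n)
    then have "\<not> constant (poly p)" by (simp add: constant_degree)
    then obtain c where "poly p c = 0" using fundamental_theorem_of_algebra by blast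
    then obtain q where q: "p = [:-c, 1:] * q" using poly_eq_0_iff_dvd by blast
    then have q0: "q \<noteq> 0" using Suc by auto
    have dq: "n = degree q" using Suc(2) q0 unfolding q by (subst (asm) degree_mult_eq) auto
    show ?case
    proof (cases "\<exists>r<k. pv q r \<noteq> 0")
      case True
      then show ?thesis using Suc q by blast
    next
      case False
      then show ?thesis using Suc(1)[OF dq q0] by blast
    qed
  qed
  then obtain c q where q: "\<And>r. r < k \<Longrightarrow> pv ([:-c, 1:] * q) r = 0" and ne: "\<exists>r<k. pv q r \<noteq> 0"
    by blast
  define w where "w = vec k (pv q)"
  have w: "w \<in> carrier_vec k" by (simp add: w_def)
  have "w \<noteq> 0\<^sub>v k"
  proof
    assume "w = 0\<^sub>v k"
    then have "w $ r = 0" if "r < k" for r using that by simp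
    then show False using ne by (auto simp: w_def)
  qed
  moreover have "A *\<^sub>v w = c \<cdot>\<^sub>v w"
  proof (rule eq_smult_vecI[OF A w])
    fix i assume i: "i < k"
    then show "(\<Sum>s<k. A $$ (i,s) * w $ s) = c * w $ i"
      using q[OF i] pv_step[OF i, of c q] by (simp add: w_def)
  qed
  moreover have "B *\<^sub>v w = b \<cdot>\<^sub>v w"
    if B: "B \<in> carrier_mat k k" and comm: "A * B = B * A" and Bv: "B *\<^sub>v v = b \<cdot>\<^sub>v v" for B b
  proof (rule eq_smult_vecI[OF B w])
    have BX: "B *\<^sub>v X i = b \<cdot>\<^sub>v X i" for i
    proof (induction i)
      case 0
      then show ?case using Bv by (simp add: X_def)
    next
      case (Suc i)
      have "B *\<^sub>v X (Suc i) = B *\<^sub>v (A *\<^sub>v X i)" by (simp add: X_def)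
      also have "\<dots> = A *\<^sub>v (B *\<^sub>v X i)"
        using assoc_mult_mat_vec[OF A B X] assoc_mult_mat_vec[OF B A X] comm by simp
      also have "\<dots> = b \<cdot>\<^sub>v X (Suc i)"
        unfolding Suc using mult_mat_vec[OF A X] by (simp add: X_def)
      finally show ?case .
    qed
    fix r assume r: "r < k"
    have BXr: "(\<Sum>s<k. B $$ (r,s) * X i $ s) = b * X i $ r" for i
      using mat_vec_entry[OF B X r, of i] BX[of i] r X[of i] by (simp del: index_mult_mat_vec)
    have "(\<Sum>s<k. B $$ (r,s) * w $ s) = (\<Sum>s<k. \<Sum>i\<le>degree q. B $$ (r,s) * (coeff q i * X i $ s))"
      by (simp add: w_def pv_def sum_distrib_left)
    also have "\<dots> = (\<Sum>i\<le>degree q. coeff q i * (\<Sum>s<k. B $$ (r,s) * X i $ s))"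
      unfolding sum_distrib_left by (subst sum.swap) (simp add: mult_ac)
    also have "\<dots> = b * w $ r"
      unfolding BXr using r by (simp add: w_def pv_def sum_distrib_left mult_ac)
    finally show "(\<Sum>s<k. B $$ (r,s) * w $ s) = b * w $ r" .
  qed
  ultimately show ?thesis using w by blast
qed

text \<open>A common eigenvector of the tail of the list serves as start vector for the head, and
  commutation preserves its old eigenvalues. The clause on \<open>B\<close> carries linear
  conditions on \<open>v\<close> over to \<open>w\<close>; it is later applied to projections onto
  eigenvectors already found.\<close>

lemma common_eigenvector:
  fixes As :: "complex mat list"
  assumes "\<forall>A\<in>set As. A \<in> carrier_mat k k" "\<forall>A\<in>set As. \<forall>B\<in>set As. A * B = B * A"
    and v: "v \<in> carrier_vec k" "v \<noteq> 0\<^sub>v k"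
  shows "\<exists>w \<in> carrier_vec k. w \<noteq> 0\<^sub>v k \<and> (\<forall>A\<in>set As. \<exists>c. A *\<^sub>v w = c \<cdot>\<^sub>v w) \<and>
    (\<forall>B \<in> carrier_mat k k. \<forall>b. (\<forall>A\<in>set As. A * B = B * A) \<longrightarrow> B *\<^sub>v v = b \<cdot>\<^sub>v v \<longrightarrow> B *\<^sub>v w = b \<cdot>\<^sub>v w)"
  using assms(1,2)
proof (induction As)
  case Nil
  then show ?case using v by (intro bexI[of _ v]) simp_all
next
  case (Cons A As)
  have pre: "\<forall>A\<in>set As. A \<in> carrier_mat k k" "\<forall>A\<in>set As. \<forall>B\<in>set As. A * B = B * A"
    using Cons.prems by auto
  from Cons.IH[OF pre] obtain u where u: "u \<in> carrier_vec k" "u \<noteq> 0\<^sub>v k" "\<forall>A\<in>set As. \<exists>c. A *\<^sub>v u = c \<cdot>\<^sub>v u"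
    "\<forall>B \<in> carrier_mat k k. \<forall>b. (\<forall>A\<in>set As. A * B = B * A) \<longrightarrow> B *\<^sub>v v = b \<cdot>\<^sub>v v \<longrightarrow> B *\<^sub>v u = b \<cdot>\<^sub>v u"
    by (elim bexE conjE)
  have A: "A \<in> carrier_mat k k" using Cons.prems(1) by simp
  from krylov_eigenvector[OF A u(1,2)] obtain c w where w: "w \<in> carrier_vec k" "w \<noteq> 0\<^sub>v k" "A *\<^sub>v w = c \<cdot>\<^sub>v w"
    "\<forall>B \<in> carrier_mat k k. \<forall>b. A * B = B * A \<longrightarrow> B *\<^sub>v u = b \<cdot>\<^sub>v u \<longrightarrow> B *\<^sub>v w = b \<cdot>\<^sub>v w"
    by (elim exE bexE conjE)
  have "\<exists>c. A' *\<^sub>v w = c \<cdot>\<^sub>v w" if A': "A' \<in> set (A # As)" for A'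
  proof (cases "A' = A")
    case True
    then show ?thesis using w(3) by blast
  next
    case False
    then have "A' \<in> set As" using A' by simp
    then obtain c' where "A' *\<^sub>v u = c' \<cdot>\<^sub>v u" using u(3) by blast
    moreover have "A' \<in> carrier_mat k k" using A' Cons.prems(1) by blast
    moreover have "A * A' = A' * A" using A' Cons.prems(2) by (meson list.set_intros(1))
    ultimately have "A' *\<^sub>v w = c' \<cdot>\<^sub>v w" using w(4)[rule_format] by presburger
    then show ?thesis by blast
  qed
  moreover have "B *\<^sub>v w = b \<cdot>\<^sub>v w" if "B \<in> carrier_mat k k" "\<forall>A\<in>set (A # As). A * B = B * A" "B *\<^sub>v v = b \<cdot>\<^sub>v v" for B b
  proof -
    have "B *\<^sub>v u = b \<cdot>\<^sub>v u" using u(4) that by (meson list.set_intros(2))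
    then show ?thesis using w(4) that by (meson list.set_intros(1))
  qed
  ultimately show ?case using w(1,2) by (intro bexI[of _ w] conjI) blast+
qed

lemma mult_cnj_cmod: "z * cnj z = complex_of_real ((cmod z)\<^sup>2)"
  using complex_norm_square[of z] by simp

text \<open>Closure under adjoints makes the projection onto a common eigenvector commute with the
  family. A start vector orthogonal to the earlier eigenvectors is killed by these projections, and
  so is the common eigenvector obtained from it.\<close>

lemma orthonormal_eigenvectors:
  fixes As :: "complex mat list"
  assumes cA: "\<forall>A\<in>set As. A \<in> carrier_mat k k" and comm: "\<forall>A\<in>set As. \<forall>B\<in>set As. A * B = B * A"
    and adj: "\<forall>A\<in>set As. adj A \<in> set As" and "j \<le> k"
  shows "\<exists>q. (\<forall>i<j. q i \<in> carrier_vec k \<and> (\<forall>A\<in>set As. \<exists>c. A *\<^sub>v q i = c \<cdot>\<^sub>v q i)) \<and>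
    (\<forall>i<j. \<forall>i'<j. (\<Sum>s<k. cnj (q i $ s) * q i' $ s) = (if i = i' then 1 else 0))"
  using \<open>j \<le> k\<close>
proof (induction j)
  case 0
  then show ?case by simp
next
  case (Suc j)
  have "j \<le> k" using Suc.prems by simp
  from Suc.IH[OF this] obtain q where
    q0: "\<forall>i<j. q i \<in> carrier_vec k \<and> (\<forall>A\<in>set As. \<exists>c. A *\<^sub>v q i = c \<cdot>\<^sub>v q i)"
    and on0: "\<forall>i<j. \<forall>i'<j. (\<Sum>s<k. cnj (q i $ s) * q i' $ s) = (if i = i' then 1 else 0)"
    by (elim exE conjE)
  have q: "\<And>i. i < j \<Longrightarrow> q i \<in> carrier_vec k" "\<And>i A. i < j \<Longrightarrow> A \<in> set As \<Longrightarrow> \<exists>c. A *\<^sub>v q i = c \<cdot>\<^sub>v q i"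
    and on: "\<And>i i'. i < j \<Longrightarrow> i' < j \<Longrightarrow> (\<Sum>s<k. cnj (q i $ s) * q i' $ s) = (if i = i' then 1 else 0)"
    using q0 on0 by blast+
  obtain v where v: "v \<in> carrier_vec k" "v \<noteq> 0\<^sub>v k" and vq: "\<And>i. i < j \<Longrightarrow> (\<Sum>s<k. cnj (q i $ s) * v $ s) = 0"
    using homogeneous_solution[of j k "\<lambda>i s. cnj (q i $ s)"] Suc.prems by auto
  from common_eigenvector[OF cA comm v] obtain w where
    w: "w \<in> carrier_vec k" "w \<noteq> 0\<^sub>v k" "\<forall>A\<in>set As. \<exists>c. A *\<^sub>v w = c \<cdot>\<^sub>v w" and
    wB: "\<forall>B \<in> carrier_mat k k. \<forall>b. (\<forall>A\<in>set As. A * B = B * A) \<longrightarrow> B *\<^sub>v v = b \<cdot>\<^sub>v v \<longrightarrow> B *\<^sub>v w = b \<cdot>\<^sub>v w"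
    by (elim bexE conjE)
  have wq: "(\<Sum>s<k. cnj (q i $ s) * w $ s) = 0" if i: "i < j" for i
  proof -
    define B where "B = mat k k (\<lambda>(r,s). q i $ r * cnj (q i $ s))"
    have B: "B \<in> carrier_mat k k" by (simp add: B_def)
    have Bx: "(\<Sum>s<k. B $$ (r,s) * x $ s) = q i $ r * (\<Sum>s<k. cnj (q i $ s) * x $ s)" if "r < k" for r x
      using that by (simp add: B_def sum_distrib_left mult.assoc)
    have "A * B = B * A" if A: "A \<in> set As" for A
    proof -
      have cA': "A \<in> carrier_mat k k" "adj A \<in> carrier_mat k k" using cA A adj by auto
      obtain c where c: "A *\<^sub>v q i = c \<cdot>\<^sub>v q i" using q(2)[OF i A] by blast
      obtain c' where c': "adj A *\<^sub>v q i = c' \<cdot>\<^sub>v q i" using q(2)[OF i] adj A by blast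
      have ce: "(\<Sum>s<k. A $$ (r,s) * q i $ s) = c * q i $ r" if "r < k" for r
        using mat_vec_entry[OF cA'(1) q(1)[OF i] that] c that q(1)[OF i] by (simp del: index_mult_mat_vec)
      have ce': "(\<Sum>s<k. cnj (A $$ (s,r)) * q i $ s) = c' * q i $ r" if "r < k" for r
        using mat_vec_entry[OF cA'(2) q(1)[OF i] that] c' that q(1)[OF i] adj_entry[OF cA'(1) that]
        by (simp del: index_mult_mat_vec)
      have ce'': "(\<Sum>s<k. cnj (q i $ s) * A $$ (s,r)) = cnj c' * cnj (q i $ r)" if "r < k" for r
        using arg_cong[OF ce'[OF that], of cnj] by (simp add: mult.commute)
      \<comment> \<open>Evaluating the form of \<open>A\<close> at \<open>q i\<close> in two ways
        shows that its eigenvalue is the conjugate of that of \<open>adj A\<close>; this is what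
        makes \<open>B\<close> commute with \<open>A\<close>.\<close>
      have "c = (\<Sum>r<k. cnj (q i $ r) * (\<Sum>s<k. A $$ (r,s) * q i $ s))"
        using on[OF i i] by (simp add: ce mult.left_commute flip: sum_distrib_left)
      also have "\<dots> = (\<Sum>s<k. (\<Sum>r<k. cnj (q i $ r) * A $$ (r,s)) * q i $ s)"
        unfolding sum_distrib_left sum_distrib_right by (subst sum.swap) (simp add: mult.assoc)
      also have "\<dots> = cnj c'"
        using on[OF i i] by (simp add: ce'' mult.assoc flip: sum_distrib_left)
      finally have cc: "c = cnj c'" .
      show ?thesis
      proof (rule eq_matI)
        fix r s assume "r < dim_row (B * A)" "s < dim_col (B * A)"
        then have rs: "r < k" "s < k" using cA' B by auto
        have "(A * B) $$ (r,s) = (\<Sum>t<k. A $$ (r,t) * q i $ t) * cnj (q i $ s)"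
          using mat_mult_entry[OF cA'(1) B rs] rs
          by (simp add: B_def sum_distrib_right mult.assoc del: index_mult_mat)
        also have "\<dots> = q i $ r * (\<Sum>t<k. cnj (q i $ t) * A $$ (t,s))"
          using rs by (simp add: ce ce'' cc)
        also have "\<dots> = (B * A) $$ (r,s)"
          using mat_mult_entry[OF B cA'(1) rs] rs
          by (simp add: B_def sum_distrib_left mult.assoc del: index_mult_mat)
        finally show "(A * B) $$ (r,s) = (B * A) $$ (r,s)" .
      qed (use cA' B in auto)
    qed
    moreover have "B *\<^sub>v v = 0 \<cdot>\<^sub>v v"
      by (rule eq_smult_vecI[OF B v(1)]) (simp add: Bx vq[OF i])
    ultimately have Bw: "B *\<^sub>v w = 0 \<cdot>\<^sub>v w" using wB B by blast
    have "q i $ r * (\<Sum>s<k. cnj (q i $ s) * w $ s) = 0" if "r < k" for r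
      using mat_vec_entry[OF B w(1) that] Bw that w(1) Bx[OF that, of w] by (simp del: index_mult_mat_vec)
    moreover have "\<exists>r<k. q i $ r \<noteq> 0"
    proof (rule ccontr)
      assume "\<not> ?thesis"
      then show False using on[OF i i] by simp
    qed
    ultimately show ?thesis by auto
  qed
  define n where "n = (\<Sum>s<k. (cmod (w $ s))\<^sup>2)"
  have "\<exists>s<k. w $ s \<noteq> 0"
  proof (rule ccontr)
    assume "\<not> ?thesis"
    then have "w = 0\<^sub>v k" using w(1) by (intro eq_vecI) auto
    then show False using w(2) by simp
  qed
  then obtain s0 where "s0 < k" "w $ s0 \<noteq> 0" by blast
  then have n: "n > 0" unfolding n_def by (intro sum_pos2[of _ s0]) auto
  define e where "e = 1 / sqrt n"
  have e: "e\<^sup>2 * n = 1" using n by (simp add: e_def power_divide)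
  define u where "u = complex_of_real e \<cdot>\<^sub>v w"
  have u: "u \<in> carrier_vec k" using w(1) by (simp add: u_def)
  have us: "u $ s = complex_of_real e * w $ s" if "s < k" for s
    using that w(1) by (simp add: u_def)
  have "(\<Sum>s<k. cnj (u $ s) * u $ s) = (\<Sum>s<k. complex_of_real (e\<^sup>2 * (cmod (w $ s))\<^sup>2))"
    using mult_cnj_cmod by (intro sum.cong) (auto simp: us power2_eq_square mult_ac)
  also have "\<dots> = complex_of_real (e\<^sup>2 * n)" unfolding n_def sum_distrib_left by simp
  also have "\<dots> = 1" using e by simp
  finally have uu: "(\<Sum>s<k. cnj (u $ s) * u $ s) = 1" .
  have uq: "(\<Sum>s<k. cnj (q i $ s) * u $ s) = 0" if "i < j" for i
  proof -
    have "(\<Sum>s<k. cnj (q i $ s) * u $ s) = complex_of_real e * (\<Sum>s<k. cnj (q i $ s) * w $ s)"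
      unfolding sum_distrib_left by (intro sum.cong) (auto simp: us)
    then show ?thesis using wq[OF that] by simp
  qed
  have qu: "(\<Sum>s<k. cnj (u $ s) * q i $ s) = 0" if "i < j" for i
    using arg_cong[OF uq[OF that], of cnj] by (simp add: mult.commute)
  have eu: "\<exists>c. A *\<^sub>v u = c \<cdot>\<^sub>v u" if A: "A \<in> set As" for A
  proof -
    obtain c where c: "A *\<^sub>v w = c \<cdot>\<^sub>v w" using w(3) A by blast
    have cA': "A \<in> carrier_mat k k" using cA A by blast
    have "A *\<^sub>v u = complex_of_real e \<cdot>\<^sub>v (c \<cdot>\<^sub>v w)"
      unfolding u_def using mult_mat_vec[OF cA' w(1)] c by simp
    also have "\<dots> = c \<cdot>\<^sub>v u" unfolding u_def by (simp add: smult_smult_assoc mult.commute)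
    finally show ?thesis by blast
  qed
  define q' where "q' = q(j := u)"
  have less: "i < Suc j \<longleftrightarrow> i < j \<or> i = j" for i by auto
  show ?case
    by (rule exI[of _ q']) (auto simp: q'_def less q u on uu uq qu eu)
qed

lemma conj_cdiag_of_eigenvectors:
  assumes A: "A \<in> carrier_mat k k" and Q: "Q \<in> carrier_mat k k" "Q * adj Q = 1\<^sub>m k"
    and eig: "\<And>l. l < k \<Longrightarrow> A *\<^sub>v col Q l = a l \<cdot>\<^sub>v col Q l"
  shows "A = Q * cdiag k a * adj Q"
proof -
  have "A * Q = Q * cdiag k a"
  proof (rule eq_matI)
    fix r i assume "r < dim_row (Q * cdiag k a)" "i < dim_col (Q * cdiag k a)"
    then have ri: "r < k" "i < k" using Q by (auto simp: cdiag_def)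
    have c: "col Q i \<in> carrier_vec k" using Q(1) ri(2) by auto
    have "(A * Q) $$ (r,i) = (A *\<^sub>v col Q i) $ r"
      unfolding mat_mult_entry[OF A Q(1) ri] mat_vec_entry[OF A c ri(1)]
      by (intro sum.cong) (use ri Q in auto)
    also have "\<dots> = Q $$ (r,i) * a i" using eig[OF ri(2)] ri Q(1) by (simp del: index_mult_mat_vec)
    also have "\<dots> = (Q * cdiag k a) $$ (r,i)" unfolding mult_cdiag_entry[OF Q(1) ri] ..
    finally show "(A * Q) $$ (r,i) = (Q * cdiag k a) $$ (r,i)" .
  qed (use A Q in \<open>auto simp: cdiag_def\<close>)
  then have "Q * cdiag k a * adj Q = A * (Q * adj Q)"
    using assoc_mult_mat[OF A Q(1) adj_carrier[OF Q(1)]] by simp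
  then show ?thesis using Q(2) A by (metis right_mult_one_mat)
qed

theorem simultaneous_diagonalization:
  fixes As :: "complex mat list"
  assumes "\<forall>A\<in>set As. A \<in> carrier_mat k k" "\<forall>A\<in>set As. \<forall>B\<in>set As. A * B = B * A"
    and "\<forall>A\<in>set As. adj A \<in> set As"
  shows "\<exists>Q \<in> carrier_mat k k. adj Q * Q = 1\<^sub>m k \<and> Q * adj Q = 1\<^sub>m k \<and>
    (\<forall>A\<in>set As. \<exists>a. A = Q * cdiag k a * adj Q)"
proof -
  from orthonormal_eigenvectors[OF assms order_refl] obtain q where
    q0: "\<forall>i<k. q i \<in> carrier_vec k \<and> (\<forall>A\<in>set As. \<exists>c. A *\<^sub>v q i = c \<cdot>\<^sub>v q i)"
    and on0: "\<forall>i<k. \<forall>i'<k. (\<Sum>s<k. cnj (q i $ s) * q i' $ s) = (if i = i' then 1 else 0)"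
    by (elim exE conjE)
  have q: "\<And>i. i < k \<Longrightarrow> q i \<in> carrier_vec k" "\<And>i A. i < k \<Longrightarrow> A \<in> set As \<Longrightarrow> \<exists>c. A *\<^sub>v q i = c \<cdot>\<^sub>v q i"
    and on: "\<And>i i'. i < k \<Longrightarrow> i' < k \<Longrightarrow> (\<Sum>s<k. cnj (q i $ s) * q i' $ s) = (if i = i' then 1 else 0)"
    using q0 on0 by blast+
  define Q where "Q = mat k k (\<lambda>(r,i). q i $ r)"
  have Q: "Q \<in> carrier_mat k k" by (simp add: Q_def)
  have Qe: "Q $$ (s,i) = q i $ s" if "s < k" "i < k" for s i using that by (simp add: Q_def)
  have QQ: "adj Q * Q = 1\<^sub>m k"
  proof (rule eq_matI)
    fix i j assume "i < dim_row (1\<^sub>m k)" "j < dim_col (1\<^sub>m k)"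
    then have ij: "i < k" "j < k" by auto
    have "(adj Q * Q) $$ (i,j) = (\<Sum>s<k. cnj (q i $ s) * q j $ s)"
      unfolding mat_mult_entry[OF adj_carrier[OF Q] Q ij]
      by (intro sum.cong) (use ij in \<open>auto simp: adj_entry[OF Q] Qe\<close>)
    then show "(adj Q * Q) $$ (i,j) = 1\<^sub>m k $$ (i,j)" using ij on by simp
  qed (use Q in \<open>auto simp: adj_def\<close>)
  then have QQ': "Q * adj Q = 1\<^sub>m k" by (intro mat_mult_left_right_inverse[OF _ Q]) (use Q in auto)
  have "\<exists>a. A = Q * cdiag k a * adj Q" if A: "A \<in> set As" for A
  proof -
    have cA: "A \<in> carrier_mat k k" using A assms by blast
    have "\<forall>i. \<exists>c. i < k \<longrightarrow> A *\<^sub>v q i = c \<cdot>\<^sub>v q i" using q(2) A by blast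
    then obtain a where a: "\<And>i. i < k \<Longrightarrow> A *\<^sub>v q i = a i \<cdot>\<^sub>v q i" by metis
    have "col Q i = q i" if "i < k" for i
      using that q(1)[OF that] by (intro eq_vecI) (auto simp: Q_def)
    then have "A = Q * cdiag k a * adj Q" using a by (intro conj_cdiag_of_eigenvectors[OF cA Q QQ']) simp
    then show ?thesis by blast
  qed
  then show ?thesis using Q QQ QQ' by blast
qed

section \<open>Fidelity with a pure state\<close>

lemma mult_cancel_mid:
  assumes "Q \<in> carrier_mat k k" "Q' * Q = 1\<^sub>m k" "Q' \<in> carrier_mat k k"
    "D \<in> carrier_mat k k" "E \<in> carrier_mat k k"
  shows "(Q * D * Q') * (Q * E * Q') = Q * (D * E) * (Q' :: complex mat)"
proof -
  have "(Q * D * Q') * (Q * E * Q') = Q * D * (Q' * Q) * E * Q'"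
    using assms(1,3-5) by (simp add: assoc_mult_mat[of _ k k _ k _ k])
  then show ?thesis using assms by (simp add: assoc_mult_mat[of _ k k _ k _ k])
qed

lemma unitary_conj_cancel:
  assumes "Q \<in> carrier_mat k k" "Q' \<in> carrier_mat k k" "Q' * Q = 1\<^sub>m k" "E \<in> carrier_mat k k"
  shows "Q' * (Q * E * Q') * Q = (E :: complex mat)"
proof -
  have "Q' * (Q * E * Q') * Q = (Q' * Q) * E * (Q' * Q)"
    using assms(1,2,4) by (simp add: assoc_mult_mat[of _ k k _ k _ k])
  then show ?thesis using assms by simp
qed

lemma adj_conj_cdiag:
  assumes Q: "Q \<in> carrier_mat k k"
  shows "adj (Q * cdiag k a * adj Q) = Q * cdiag k (\<lambda>i. cnj (a i)) * adj Q"
proof -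
  have QD: "Q * cdiag k a \<in> carrier_mat k k" using Q by simp
  have "adj (Q * cdiag k a * adj Q) = Q * (adj (cdiag k a) * adj Q)"
    by (simp only: adj_mult[OF QD adj_carrier[OF Q]] adj_mult[OF Q cdiag_carrier] adj_adj)
  then show ?thesis using assoc_mult_mat[OF Q cdiag_carrier adj_carrier[OF Q]] by (simp add: adj_cdiag)
qed

lemma conj_cdiag_entry:
  assumes Q: "Q \<in> carrier_mat k k" and ij: "i < k" "j < k"
  shows "(Q * cdiag k a * adj Q) $$ (i,j) = (\<Sum>l<k. Q $$ (i,l) * a l * cnj (Q $$ (j,l)))"
proof -
  have QD: "Q * cdiag k a \<in> carrier_mat k k" using Q by simp
  show ?thesis
    unfolding mat_mult_entry[OF QD adj_carrier[OF Q] ij]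
    by (intro sum.cong refl) (use ij in \<open>simp add: mult_cdiag_entry[OF Q] adj_entry[OF Q] del: index_mult_mat\<close>)
qed

lemma conj_cdiag_vec:
  assumes Q: "Q \<in> carrier_mat k k" and v: "v \<in> carrier_vec k" and i: "i < k"
  shows "((Q * cdiag k a * adj Q) *\<^sub>v v) $ i = (\<Sum>l<k. Q $$ (i,l) * a l * (\<Sum>j<k. cnj (Q $$ (j,l)) * v $ j))"
proof -
  have A: "Q * cdiag k a * adj Q \<in> carrier_mat k k" using Q by (intro mult_carrier_mat[of _ k k _ k]) auto
  have "((Q * cdiag k a * adj Q) *\<^sub>v v) $ i
      = (\<Sum>j<k. \<Sum>l<k. Q $$ (i,l) * a l * (cnj (Q $$ (j,l)) * v $ j))"
    unfolding mat_vec_entry[OF A v i]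
    by (intro sum.cong refl) (simp add: conj_cdiag_entry[OF Q i] sum_distrib_right mult.assoc)
  then show ?thesis by (subst (asm) sum.swap) (simp add: sum_distrib_left)
qed

section \<open>Positive semidefinite matrices and their square roots\<close>

lemma psd_conj_cdiag:
  assumes Q: "Q \<in> carrier_mat k k" and a: "\<And>i. i < k \<Longrightarrow> 0 \<le> a i"
  shows "psd k (Q * cdiag k (\<lambda>i. complex_of_real (a i)) * adj Q)"
proof -
  let ?A = "Q * cdiag k (\<lambda>i. complex_of_real (a i)) * adj Q"
  have A: "?A \<in> carrier_mat k k" using Q by (intro mult_carrier_mat[of _ k k _ k]) auto
  moreover have "adj ?A = ?A" using adj_conj_cdiag[OF Q] by simp
  moreover have "0 \<le> Re (\<Sum>i<k. cnj (v $ i) * (?A *\<^sub>v v) $ i)" if v: "v \<in> carrier_vec k" for v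
  proof -
    define b where "b l = (\<Sum>j<k. cnj (Q $$ (j,l)) * v $ j)" for l
    have cb: "cnj (b l) = (\<Sum>i<k. cnj (v $ i) * Q $$ (i,l))" for l by (simp add: b_def mult.commute)
    have "(\<Sum>i<k. cnj (v $ i) * (?A *\<^sub>v v) $ i)
        = (\<Sum>i<k. \<Sum>l<k. complex_of_real (a l) * b l * (cnj (v $ i) * Q $$ (i,l)))"
    proof (intro sum.cong refl)
      fix i assume "i \<in> {..<k}"
      then have "(?A *\<^sub>v v) $ i = (\<Sum>l<k. Q $$ (i,l) * complex_of_real (a l) * b l)"
        unfolding b_def by (intro conj_cdiag_vec[OF Q v]) simp
      then show "cnj (v $ i) * (?A *\<^sub>v v) $ i = (\<Sum>l<k. complex_of_real (a l) * b l * (cnj (v $ i) * Q $$ (i,l)))"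
        by (simp only: sum_distrib_left mult_ac)
    qed
    also have "\<dots> = (\<Sum>l<k. complex_of_real (a l) * (b l * cnj (b l)))"
      by (subst sum.swap) (simp only: cb sum_distrib_left mult.assoc)
    also have "\<dots> = complex_of_real (\<Sum>l<k. a l * (cmod (b l))\<^sup>2)"
      unfolding mult_cnj_cmod by simp
    finally have "Re (\<Sum>i<k. cnj (v $ i) * (?A *\<^sub>v v) $ i) = (\<Sum>l<k. a l * (cmod (b l))\<^sup>2)"
      by (simp only: Re_complex_of_real)
    moreover have "0 \<le> (\<Sum>l<k. a l * (cmod (b l))\<^sup>2)" using a by (intro sum_nonneg) simp
    ultimately show ?thesis by (simp only:)
  qed
  ultimately show ?thesis unfolding psd_def by blast
qed

lemma isometry_cols:
  assumes V: "V \<in> carrier_mat m k" "adj V * V = 1\<^sub>m k" and ij: "i < k" "j < k"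
  shows "(\<Sum>s<m. cnj (V $$ (s,i)) * V $$ (s,j)) = (if i = j then 1 else 0)"
proof -
  have "(adj V * V) $$ (i,j) = (\<Sum>s<m. cnj (V $$ (s,i)) * V $$ (s,j))"
    unfolding mat_mult_entry[OF adj_carrier[OF V(1)] V(1) ij]
    by (intro sum.cong refl) (use ij in \<open>simp add: adj_entry[OF V(1)]\<close>)
  then show ?thesis using ij by (simp add: V(2))
qed

lemma conj_cdiag_eigenvector:
  assumes Q: "Q \<in> carrier_mat k k" "adj Q * Q = 1\<^sub>m k" and il: "i < k" "l < k"
  shows "((Q * cdiag k a * adj Q) *\<^sub>v col Q l) $ i = a l * Q $$ (i,l)"
proof -
  have v: "col Q l \<in> carrier_vec k" using Q il by auto
  have "(\<Sum>j<k. cnj (Q $$ (j,m)) * col Q l $ j) = (if m = l then 1 else 0)" if "m < k" for m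
    using isometry_cols[OF Q that il(2)] Q il by simp
  then have "((Q * cdiag k a * adj Q) *\<^sub>v col Q l) $ i = (\<Sum>m<k. if m = l then Q $$ (i,m) * a m else 0)"
    unfolding conj_cdiag_vec[OF Q(1) v il(1)] by (intro sum.cong refl) simp
  then show ?thesis using il by (simp add: mult.commute)
qed

lemma psd_diagonal_nonneg:
  assumes A: "psd k (Q * cdiag k a * adj Q)" and Q: "Q \<in> carrier_mat k k" "adj Q * Q = 1\<^sub>m k"
    and l: "l < k"
  shows "a l = complex_of_real (Re (a l))" "0 \<le> Re (a l)"
proof -
  have v: "col Q l \<in> carrier_vec k" using Q l by auto
  have quad: "(\<Sum>i<k. cnj (col Q l $ i) * ((Q * cdiag k b * adj Q) *\<^sub>v col Q l) $ i) = b l" for b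
  proof -
    have "(\<Sum>i<k. cnj (col Q l $ i) * ((Q * cdiag k b * adj Q) *\<^sub>v col Q l) $ i)
       = (\<Sum>i<k. b l * (cnj (Q $$ (i,l)) * Q $$ (i,l)))"
      by (intro sum.cong refl) (use l Q in \<open>simp add: conj_cdiag_eigenvector[OF Q] mult_ac del: index_mult_mat_vec\<close>)
    then show ?thesis using isometry_cols[OF Q l l] by (simp flip: sum_distrib_left)
  qed
  show "0 \<le> Re (a l)" using A v quad[of a] unfolding psd_def by metis
  have "Q * cdiag k a * adj Q = Q * cdiag k (\<lambda>i. cnj (a i)) * adj Q"
    using A adj_conj_cdiag[OF Q(1), of a] by (simp add: psd_def)
  then have "a l = cnj (a l)" using quad[of a] quad[of "\<lambda>i. cnj (a i)"] by simp
  then show "a l = complex_of_real (Re (a l))" by (metis Reals_cnj_iff of_real_Re)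
qed

lemma psd_spectral:
  assumes "psd k A"
  obtains Q a where "Q \<in> carrier_mat k k" "adj Q * Q = 1\<^sub>m k" "Q * adj Q = 1\<^sub>m k"
    "A = Q * cdiag k (\<lambda>i. complex_of_real (a i)) * adj Q" "\<And>i. i < k \<Longrightarrow> 0 \<le> a i"
proof -
  have "A \<in> carrier_mat k k" "adj A = A" using assms by (auto simp: psd_def)
  then obtain Q c where Q: "Q \<in> carrier_mat k k" "adj Q * Q = 1\<^sub>m k" "Q * adj Q = 1\<^sub>m k"
    and A: "A = Q * cdiag k c * adj Q"
    using simultaneous_diagonalization[of "[A]" k] by auto
  note c = psd_diagonal_nonneg[OF assms[unfolded A] Q(1,2)]
  have "cdiag k c = cdiag k (\<lambda>i. complex_of_real (Re (c i)))"
    using c(1) by (intro eq_matI) (auto simp: cdiag_def)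
  then show thesis using that[of Q "\<lambda>i. Re (c i)"] Q A c(2) by simp
qed

text \<open>This gives the definite description in \<open>msqrt\<close> its value. In an eigenbasis
  of \<open>B\<close>, the matrix of \<open>C\<close> commutes with its own square, which is
  diagonal with the squares of the \<open>b i\<close> as entries. Nonnegative numbers with equal
  squares are equal, so \<open>C\<close> commutes with \<open>B\<close>, and a common eigenbasis
  reduces the claim to numbers.\<close>

lemma psd_sqrt_unique:
  assumes B: "psd k B" and C: "psd k C" and BC: "B * B = C * C"
  shows "B = C"
proof -
  obtain Q b where Q: "Q \<in> carrier_mat k k" "adj Q * Q = 1\<^sub>m k" "Q * adj Q = 1\<^sub>m k"
    and Bd: "B = Q * cdiag k (\<lambda>i. complex_of_real (b i)) * adj Q" and b: "\<And>i. i < k \<Longrightarrow> 0 \<le> b i"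
    using psd_spectral[OF B] by metis
  have cBC: "B \<in> carrier_mat k k" "C \<in> carrier_mat k k" using B C by (auto simp: psd_def)
  have aQ: "adj Q \<in> carrier_mat k k" using Q by simp
  let ?D = "cdiag k (\<lambda>i. complex_of_real (b i))"
  define C' where "C' = adj Q * C * Q"
  have C': "C' \<in> carrier_mat k k" using Q cBC by (auto simp: C'_def intro!: mult_carrier_mat[of _ k k _ k])
  have C_eq: "C = Q * C' * adj Q"
    using unitary_conj_cancel[OF aQ Q(1) Q(3) cBC(2)] by (simp add: C'_def)
  have "C' * C' = adj Q * (C * C) * Q"
    unfolding C'_def by (rule mult_cancel_mid[OF aQ Q(3,1) cBC(2,2)])
  also have "C * C = Q * (?D * ?D) * adj Q"
    using mult_cancel_mid[OF Q(1,2) aQ cdiag_carrier cdiag_carrier] by (simp add: Bd flip: BC)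
  also have "adj Q * \<dots> * Q = ?D * ?D"
    by (rule unitary_conj_cancel[OF Q(1) aQ Q(2)]) (simp add: mult_carrier_mat[of _ k k _ k])
  finally have sq: "C' * C' = ?D * ?D" .
  have "(C' * C') * C' = C' * (C' * C')" by (rule assoc_mult_mat[OF C' C' C'])
  then have comm2: "(?D * ?D) * C' = C' * (?D * ?D)" by (simp add: sq)
  have "?D * C' = C' * ?D"
  proof (rule eq_matI)
    fix i j assume "i < dim_row (C' * ?D)" "j < dim_col (C' * ?D)"
    then have ij: "i < k" "j < k" using C' by (auto simp: cdiag_def)
    have "complex_of_real (b i * b i) * C' $$ (i,j) = C' $$ (i,j) * complex_of_real (b j * b j)"
      using arg_cong[OF comm2, of "\<lambda>M. M $$ (i,j)"] cdiag_mult_entry[OF C' ij] mult_cdiag_entry[OF C' ij]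
      by (simp add: cdiag_mult del: index_mult_mat)
    then have "C' $$ (i,j) = 0 \<or> b i * b i = b j * b j"
      by (simp add: mult.commute flip: of_real_mult)
    then have "C' $$ (i,j) = 0 \<or> b i = b j"
      using b ij by (simp flip: power2_eq_square)
    then show "(?D * C') $$ (i,j) = (C' * ?D) $$ (i,j)"
      unfolding cdiag_mult_entry[OF C' ij] mult_cdiag_entry[OF C' ij] by auto
  qed (use C' in \<open>auto simp: cdiag_def\<close>)
  then have comm: "B * C = C * B"
    using mult_cancel_mid[OF Q(1,2) aQ cdiag_carrier C'] mult_cancel_mid[OF Q(1,2) aQ C' cdiag_carrier]
    unfolding C_eq Bd by metis
  have "\<forall>A\<in>set [B,C]. A \<in> carrier_mat k k" "\<forall>A\<in>set [B,C]. \<forall>A'\<in>set [B,C]. A * A' = A' * A"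
    "\<forall>A\<in>set [B,C]. adj A \<in> set [B,C]"
    using cBC comm B C by (auto simp: psd_def)
  from simultaneous_diagonalization[OF this] obtain R \<beta> \<gamma> where
    R: "R \<in> carrier_mat k k" "adj R * R = 1\<^sub>m k" "R * adj R = 1\<^sub>m k" and
    BR: "B = R * cdiag k \<beta> * adj R" and CR: "C = R * cdiag k \<gamma> * adj R"
    by auto
  have aR: "adj R \<in> carrier_mat k k" using R by simp
  have "cdiag k \<beta> * cdiag k \<beta> = adj R * (B * B) * R"
    unfolding BR mult_cancel_mid[OF R(1,2) aR cdiag_carrier cdiag_carrier]
    by (rule unitary_conj_cancel[OF R(1) aR R(2), symmetric]) (simp add: mult_carrier_mat[of _ k k _ k])
  also have "\<dots> = cdiag k \<gamma> * cdiag k \<gamma>"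
    unfolding BC CR mult_cancel_mid[OF R(1,2) aR cdiag_carrier cdiag_carrier]
    by (rule unitary_conj_cancel[OF R(1) aR R(2)]) (simp add: mult_carrier_mat[of _ k k _ k])
  finally have sq': "cdiag k \<beta> * cdiag k \<beta> = cdiag k \<gamma> * cdiag k \<gamma>" .
  have "\<beta> i = \<gamma> i" if i: "i < k" for i
  proof -
    have "\<beta> i * \<beta> i = \<gamma> i * \<gamma> i"
      using arg_cong[OF sq', of "\<lambda>M. M $$ (i,i)"] i by (simp add: cdiag_mult) (simp add: cdiag_def)
    moreover note \<beta> = psd_diagonal_nonneg[OF B[unfolded BR] R(1,2) i]
      and \<gamma> = psd_diagonal_nonneg[OF C[unfolded CR] R(1,2) i]
    ultimately have "(Re (\<beta> i))\<^sup>2 = (Re (\<gamma> i))\<^sup>2"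
      by (metis Re_complex_of_real of_real_mult power2_eq_square)
    then show ?thesis using \<beta> \<gamma> by (metis power2_eq_iff_nonneg)
  qed
  then have "cdiag k \<beta> = cdiag k \<gamma>" by (intro eq_matI) (auto simp: cdiag_def)
  then show ?thesis using BR CR by simp
qed

lemma msqrt_eqI:
  assumes "psd k B" "B * B = A"
  shows "msqrt A = B"
proof -
  have "dim_row A = k" using assms by (auto simp: psd_def)
  then show ?thesis
    unfolding msqrt_def using assms psd_sqrt_unique by (intro the_equality) auto
qed

lemma psd_msqrt:
  assumes A: "psd k A"
  shows "psd k (msqrt A)" "msqrt A * msqrt A = A"
proof -
  obtain Q a where Q: "Q \<in> carrier_mat k k" "adj Q * Q = 1\<^sub>m k" "Q * adj Q = 1\<^sub>m k"
    and Ad: "A = Q * cdiag k (\<lambda>i. complex_of_real (a i)) * adj Q" and a: "\<And>i. i < k \<Longrightarrow> 0 \<le> a i"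
    using psd_spectral[OF A] by metis
  let ?B = "Q * cdiag k (\<lambda>i. complex_of_real (sqrt (a i))) * adj Q"
  have B: "psd k ?B" using Q a by (intro psd_conj_cdiag) auto
  have "cdiag k (\<lambda>i. complex_of_real (sqrt (a i))) * cdiag k (\<lambda>i. complex_of_real (sqrt (a i)))
      = cdiag k (\<lambda>i. complex_of_real (a i))"
    unfolding cdiag_mult using a by (intro eq_matI) (auto simp: cdiag_def simp flip: of_real_mult)
  then have BB: "?B * ?B = A"
    unfolding Ad using mult_cancel_mid[OF Q(1,2) adj_carrier[OF Q(1)] cdiag_carrier cdiag_carrier] by simp
  then show "psd k (msqrt A)" "msqrt A * msqrt A = A" using msqrt_eqI[OF B BB] B by auto
qed

text \<open>A sum of rank-one terms |g_x><g_x|, the form in which a Kraus map returns a pure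
  state.\<close>

lemma psd_gram:
  "psd n (mat n n (\<lambda>(p,q). \<Sum>x\<in>I. g x p * cnj (g x q)))" (is "psd n ?A")
proof -
  have A: "?A \<in> carrier_mat n n" by simp
  moreover have "adj ?A = ?A" by (rule eq_matI) (auto simp: adj_def mult.commute)
  moreover have "0 \<le> Re (\<Sum>p<n. cnj (v $ p) * (?A *\<^sub>v v) $ p)" if v: "v \<in> carrier_vec n" for v
  proof -
    define b where "b x = (\<Sum>q<n. cnj (g x q) * v $ q)" for x
    have cb: "cnj (b x) = (\<Sum>p<n. cnj (v $ p) * g x p)" for x by (simp add: b_def mult.commute)
    have Av: "(?A *\<^sub>v v) $ p = (\<Sum>x\<in>I. g x p * b x)" if p: "p < n" for p
    proof -
      have "(?A *\<^sub>v v) $ p = (\<Sum>q<n. \<Sum>x\<in>I. g x p * (cnj (g x q) * v $ q))"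
        unfolding mat_vec_entry[OF A v p]
        by (intro sum.cong refl) (use p in \<open>simp add: sum_distrib_right mult.assoc\<close>)
      then show ?thesis unfolding b_def sum_distrib_left by (subst (asm) sum.swap)
    qed
    have "(\<Sum>p<n. cnj (v $ p) * (?A *\<^sub>v v) $ p) = (\<Sum>p<n. \<Sum>x\<in>I. b x * (cnj (v $ p) * g x p))"
      by (intro sum.cong refl) (simp add: Av sum_distrib_left mult_ac del: index_mult_mat_vec)
    also have "\<dots> = (\<Sum>x\<in>I. b x * cnj (b x))"
      by (subst sum.swap) (simp only: cb sum_distrib_left)
    also have "\<dots> = complex_of_real (\<Sum>x\<in>I. (cmod (b x))\<^sup>2)" unfolding mult_cnj_cmod by simp
    finally have "Re (\<Sum>p<n. cnj (v $ p) * (?A *\<^sub>v v) $ p) = (\<Sum>x\<in>I. (cmod (b x))\<^sup>2)"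
      by (simp only: Re_complex_of_real)
    then show ?thesis by (simp only: sum_nonneg zero_le_power2)
  qed
  ultimately show ?thesis unfolding psd_def by blast
qed

section \<open>Pure states and the fidelity with them\<close>

lemma proj_carrier: "\<phi> \<in> carrier_vec n \<Longrightarrow> proj \<phi> \<in> carrier_mat n n"
  by (auto simp: proj_def)

lemma unit_vec_in_sum:
  assumes "unit_vec_in n \<phi>"
  shows "(\<Sum>i<n. cnj (\<phi> $ i) * \<phi> $ i) = 1"
proof -
  have "(\<Sum>i<n. cnj (\<phi> $ i) * \<phi> $ i) = complex_of_real (\<Sum>i<n. (cmod (\<phi> $ i))\<^sup>2)"
    unfolding mult.commute[of "cnj _"] mult_cnj_cmod by simp
  also have "\<dots> = 1" using assms unfolding unit_vec_in_def by (simp only: of_real_1)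
  finally show ?thesis .
qed

lemma scaled_proj_mult:
  assumes "unit_vec_in n \<phi>"
  shows "mat n n (\<lambda>(i,j). a * \<phi> $ i * cnj (\<phi> $ j)) * mat n n (\<lambda>(i,j). b * \<phi> $ i * cnj (\<phi> $ j))
    = mat n n (\<lambda>(i,j). (a * b) * \<phi> $ i * cnj (\<phi> $ j))" (is "?A * ?B = ?C")
proof (rule eq_matI)
  fix i j assume "i < dim_row ?C" "j < dim_col ?C"
  then have ij: "i < n" "j < n" by auto
  have "(?A * ?B) $$ (i,j) = (\<Sum>k<n. (a * b) * \<phi> $ i * cnj (\<phi> $ j) * (cnj (\<phi> $ k) * \<phi> $ k))"
    using ij by (subst mat_mult_entry[of _ n n _ n]) (auto intro!: sum.cong)
  then show "(?A * ?B) $$ (i,j) = ?C $$ (i,j)"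
    using ij unit_vec_in_sum[OF assms] by (simp flip: sum_distrib_left)
qed auto

lemma psd_scaled_proj:
  assumes "0 \<le> a"
  shows "psd n (mat n n (\<lambda>(i,j). complex_of_real a * \<phi> $ i * cnj (\<phi> $ j)))"
proof -
  have "mat n n (\<lambda>(i,j). complex_of_real a * \<phi> $ i * cnj (\<phi> $ j))
     = mat n n (\<lambda>(p,q). \<Sum>x\<in>{0::nat}. (complex_of_real (sqrt a) * \<phi> $ p) * cnj (complex_of_real (sqrt a) * \<phi> $ q))"
    using assms by (intro eq_matI) (auto simp: mult_ac simp flip: of_real_mult)
  then show ?thesis by (simp only: psd_gram)
qed

text \<open>Let S be the root of the first state and P the projection onto \<phi>. Then adj (S P) (S
  P) = P S S P = N P, where N is the expectation of the first state in \<phi>; the root of this is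
  sqrt N times P, of trace sqrt N.\<close>

lemma fidelity_pure:
  assumes \<phi>: "unit_vec_in n \<phi>" and fin: "finite I"
  shows "fidelity (mat n n (\<lambda>(p,q). \<Sum>x\<in>I. g x p * cnj (g x q))) (proj \<phi>)
    = sqrt (\<Sum>x\<in>I. (cmod (\<Sum>p<n. cnj (\<phi> $ p) * g x p))\<^sup>2)"
proof -
  let ?\<rho> = "mat n n (\<lambda>(p,q). \<Sum>x\<in>I. g x p * cnj (g x q))"
  define N where "N = (\<Sum>x\<in>I. (cmod (\<Sum>p<n. cnj (\<phi> $ p) * g x p))\<^sup>2)"
  have N0: "0 \<le> N" by (simp add: N_def sum_nonneg)
  have cv: "\<phi> \<in> carrier_vec n" using \<phi> by (simp add: unit_vec_in_def)
  have Pm: "proj \<phi> = mat n n (\<lambda>(i,j). complex_of_real 1 * \<phi> $ i * cnj (\<phi> $ j))"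
    using cv by (intro eq_matI) (auto simp: proj_def)
  have P: "proj \<phi> \<in> carrier_mat n n" using cv by (rule proj_carrier)
  have pP: "psd n (proj \<phi>)" unfolding Pm by (rule psd_scaled_proj) simp
  have sP: "msqrt (proj \<phi>) = proj \<phi>"
  proof (rule msqrt_eqI[OF pP])
    show "proj \<phi> * proj \<phi> = proj \<phi>"
      unfolding Pm using scaled_proj_mult[OF \<phi>, of "complex_of_real 1" "complex_of_real 1"] by simp
  qed
  define S where "S = msqrt ?\<rho>"
  have S: "psd n S" "S * S = ?\<rho>" unfolding S_def using psd_msqrt[OF psd_gram] by blast+
  then have cS: "S \<in> carrier_mat n n" "adj S = S" by (auto simp: psd_def)
  have c\<rho>: "?\<rho> \<in> carrier_mat n n" by simp
  have "adj (S * proj \<phi>) * (S * proj \<phi>) = (proj \<phi> * S) * (S * proj \<phi>)"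
    using adj_mult[OF cS(1) P] cS(2) pP by (simp add: psd_def)
  also have "\<dots> = proj \<phi> * (S * S) * proj \<phi>"
    using P cS(1) by (simp add: assoc_mult_mat[of _ n n _ n _ n])
  also have "\<dots> = mat n n (\<lambda>(i,j). complex_of_real N * \<phi> $ i * cnj (\<phi> $ j))" (is "_ = ?M")
  proof (rule eq_matI)
    fix i j assume "i < dim_row ?M" "j < dim_col ?M"
    then have ij: "i < n" "j < n" by auto
    define b where "b x = (\<Sum>p<n. cnj (\<phi> $ p) * g x p)" for x
    have cb: "cnj (b x) = (\<Sum>q<n. cnj (g x q) * \<phi> $ q)" for x by (simp add: b_def mult.commute)
    have Pe: "proj \<phi> $$ (p,q) = \<phi> $ p * cnj (\<phi> $ q)" if "p < n" "q < n" for p q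
      using that cv by (simp add: proj_def)
    have 1: "(proj \<phi> * ?\<rho>) $$ (i,q) = \<phi> $ i * (\<Sum>x\<in>I. b x * cnj (g x q))" if q: "q < n" for q
    proof -
      have "(proj \<phi> * ?\<rho>) $$ (i,q) = (\<Sum>p<n. \<Sum>x\<in>I. \<phi> $ i * ((cnj (\<phi> $ p) * g x p) * cnj (g x q)))"
        unfolding mat_mult_entry[OF P c\<rho> ij(1) q]
        by (intro sum.cong refl) (use ij q in \<open>simp add: Pe sum_distrib_left mult.assoc\<close>)
      also have "\<dots> = \<phi> $ i * (\<Sum>x\<in>I. b x * cnj (g x q))"
        by (subst sum.swap) (simp only: b_def sum_distrib_left sum_distrib_right)
      finally show ?thesis .
    qed
    have "(proj \<phi> * ?\<rho> * proj \<phi>) $$ (i,j)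
      = (\<Sum>q<n. \<Sum>x\<in>I. \<phi> $ i * cnj (\<phi> $ j) * (b x * (cnj (g x q) * \<phi> $ q)))"
      unfolding mat_mult_entry[OF mult_carrier_mat[OF P c\<rho>] P ij]
      by (intro sum.cong refl)
        (use ij in \<open>simp add: 1 Pe sum_distrib_left sum_distrib_right mult_ac del: index_mult_mat\<close>)
    also have "\<dots> = \<phi> $ i * cnj (\<phi> $ j) * (\<Sum>x\<in>I. b x * cnj (b x))"
      by (subst sum.swap) (simp only: cb sum_distrib_left)
    also have "(\<Sum>x\<in>I. b x * cnj (b x)) = complex_of_real N"
      unfolding N_def b_def[symmetric] mult_cnj_cmod by simp
    finally show "(proj \<phi> * (S * S) * proj \<phi>) $$ (i,j) = ?M $$ (i,j)"
      using ij by (simp add: S(2) del: index_mult_mat)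
  qed (use P in auto)
  finally have XX: "adj (S * proj \<phi>) * (S * proj \<phi>) = ?M" .
  have "msqrt ?M = mat n n (\<lambda>(i,j). complex_of_real (sqrt N) * \<phi> $ i * cnj (\<phi> $ j))"
  proof (rule msqrt_eqI[OF psd_scaled_proj])
    show "mat n n (\<lambda>(i,j). complex_of_real (sqrt N) * \<phi> $ i * cnj (\<phi> $ j)) *
      mat n n (\<lambda>(i,j). complex_of_real (sqrt N) * \<phi> $ i * cnj (\<phi> $ j)) = ?M"
      unfolding scaled_proj_mult[OF \<phi>] using N0 by (simp flip: of_real_mult)
  qed (use N0 in simp)
  then have "fidelity ?\<rho> (proj \<phi>) = Re (\<Sum>i<n. complex_of_real (sqrt N) * \<phi> $ i * cnj (\<phi> $ i))"
    unfolding fidelity_def trace_norm_def sP S_def[symmetric] XX by (simp add: mtrace_def)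
  also have "(\<Sum>i<n. complex_of_real (sqrt N) * \<phi> $ i * cnj (\<phi> $ i))
      = complex_of_real (sqrt N) * (\<Sum>i<n. cnj (\<phi> $ i) * \<phi> $ i)"
    by (simp add: sum_distrib_left mult_ac)
  finally show ?thesis using unit_vec_in_sum[OF \<phi>] by (simp add: N_def)
qed

section \<open>Channels acting on one half of a bipartite pure state\<close>

lemma ext_R_carrier: "ext_R dL dR dout \<Phi> X \<in> carrier_mat (dout * dR) (dout * dR)"
  by (simp add: ext_R_def msum_def)

lemma ext_R_entry:
  assumes pq: "p < dout * dR" "q < dout * dR"
    and \<Phi>: "\<And>X. X \<in> carrier_mat dL dL \<Longrightarrow> \<Phi> X \<in> carrier_mat dout dout"
  shows "ext_R dL dR dout \<Phi> X $$ (p,q) =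
    \<Phi> (mat dL dL (\<lambda>(l,l'). X $$ (l * dR + p mod dR, l' * dR + q mod dR))) $$ (p div dR, q div dR)"
proof -
  have dR: "0 < dR" using pq by (cases dR) auto
  let ?B = "\<lambda>a b. mat dL dL (\<lambda>(l,l'). X $$ (l * dR + a, l' * dR + b))"
  have "kron (\<Phi> (?B a b)) (ket_bra dR a b) $$ (p,q) =
      (if (a,b) = (p mod dR, q mod dR) then \<Phi> (?B a b) $$ (p div dR, q div dR) else 0)" for a b
  proof -
    have "\<Phi> (?B a b) \<in> carrier_mat dout dout" by (rule \<Phi>) simp
    then show ?thesis using pq dR by (auto simp: kron_def ket_bra_def)
  qed
  note kr = this
  have "ext_R dL dR dout \<Phi> X $$ (p,q) = (\<Sum>ab\<in>{..<dR} \<times> {..<dR}.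
      kron (\<Phi> (?B (fst ab) (snd ab))) (ket_bra dR (fst ab) (snd ab)) $$ (p,q))"
    unfolding ext_R_def msum_def using pq by (simp add: case_prod_beta)
  also have "\<dots> = (\<Sum>ab\<in>{..<dR} \<times> {..<dR}.
      if ab = (p mod dR, q mod dR) then \<Phi> (?B (fst ab) (snd ab)) $$ (p div dR, q div dR) else 0)"
    by (intro sum.cong refl) (simp only: kr prod.collapse)
  also have "\<dots> = \<Phi> (?B (p mod dR) (q mod dR)) $$ (p div dR, q div dR)"
    by (subst sum.delta) (use dR in auto)
  finally show ?thesis .
qed

lemma kraus_entry:
  assumes K: "K \<in> carrier_mat n m" and X: "X \<in> carrier_mat m m" and ij: "i < n" "j < n"
  shows "(K * X * adj K) $$ (i,j) = (\<Sum>l<m. \<Sum>l'<m. K $$ (i,l) * X $$ (l,l') * cnj (K $$ (j,l')))"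
proof -
  have KX: "K * X \<in> carrier_mat n m" using K X by simp
  have "(K * X * adj K) $$ (i,j) = (\<Sum>l'<m. \<Sum>l<m. K $$ (i,l) * X $$ (l,l') * cnj (K $$ (j,l')))"
    unfolding mat_mult_entry[OF KX adj_carrier[OF K] ij]
    by (intro sum.cong refl)
      (use ij in \<open>simp add: mat_mult_entry[OF K X] adj_entry[OF K] sum_distrib_right del: index_mult_mat\<close>)
  then show ?thesis by (subst sum.swap)
qed

text \<open>The output state is the Gram sum of the vectors obtained by applying each
  \<open>K x\<close> to the first factor of \<phi>, so the squared fidelity is the sum of the
  squared overlaps of these vectors with \<phi>.\<close>

lemma F_phi_kraus:
  assumes \<phi>: "unit_vec_in (d * dR) \<phi>" and fin: "finite I"
    and K: "\<And>x. x \<in> I \<Longrightarrow> K x \<in> carrier_mat d d"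
    and \<Phi>: "\<And>X. X \<in> carrier_mat d d \<Longrightarrow> \<Phi> X = msum d d I (\<lambda>x. K x * X * adj (K x))"
  shows "F_phi d dR d \<phi> \<Phi> id = sqrt (\<Sum>x\<in>I. (cmod (\<Sum>p<d * dR. cnj (\<phi> $ p) *
     (\<Sum>l<d. K x $$ (p div dR, l) * \<phi> $ (l * dR + p mod dR))))\<^sup>2)"
proof -
  let ?n = "d * dR"
  let ?g = "\<lambda>x p. \<Sum>l<d. K x $$ (p div dR, l) * \<phi> $ (l * dR + p mod dR)"
  have cv: "\<phi> \<in> carrier_vec ?n" using \<phi> by (simp add: unit_vec_in_def)
  have idx: "l * dR + p mod dR < ?n" if "l < d" "p < ?n" for l p
  proof -
    have "p mod dR < dR" using that by (cases dR) auto
    then have "l * dR + p mod dR < Suc l * dR" by simp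
    also have "\<dots> \<le> ?n" using that by (intro mult_le_mono1) simp
    finally show ?thesis .
  qed
  have pe: "proj \<phi> $$ (p,q) = \<phi> $ p * cnj (\<phi> $ q)" if "p < ?n" "q < ?n" for p q
    using that cv by (simp add: proj_def)
  have div: "p div dR < d" if "p < ?n" for p using that by (simp add: less_mult_imp_div_less)
  have 1: "ext_R d dR d id (proj \<phi>) = proj \<phi>"
  proof (rule eq_matI)
    fix p q assume "p < dim_row (proj \<phi>)" "q < dim_col (proj \<phi>)"
    then have pq: "p < ?n" "q < ?n" using cv by (auto simp: proj_def)
    show "ext_R d dR d id (proj \<phi>) $$ (p,q) = proj \<phi> $$ (p,q)"
      by (subst ext_R_entry[OF pq]) (use pq div in auto)
  qed (use cv ext_R_carrier[of d dR d id "proj \<phi>"] in \<open>auto simp: proj_def\<close>)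
  have 2: "ext_R d dR d \<Phi> (proj \<phi>) = mat ?n ?n (\<lambda>(p,q). \<Sum>x\<in>I. ?g x p * cnj (?g x q))" (is "_ = ?M")
  proof (rule eq_matI)
    fix p q assume "p < dim_row ?M" "q < dim_col ?M"
    then have pq: "p < ?n" "q < ?n" by auto
    let ?X = "mat d d (\<lambda>(l,l'). proj \<phi> $$ (l * dR + p mod dR, l' * dR + q mod dR))"
    have X: "?X \<in> carrier_mat d d" by simp
    have "ext_R d dR d \<Phi> (proj \<phi>) $$ (p,q) = \<Phi> ?X $$ (p div dR, q div dR)"
      by (rule ext_R_entry[OF pq]) (simp add: \<Phi> msum_def)
    also have "\<dots> = (\<Sum>x\<in>I. (K x * ?X * adj (K x)) $$ (p div dR, q div dR))"
      using div pq by (simp add: \<Phi>[OF X] msum_def)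
    also have "\<dots> = (\<Sum>x\<in>I. ?g x p * cnj (?g x q))"
    proof (intro sum.cong refl)
      fix x assume x: "x \<in> I"
      have "(K x * ?X * adj (K x)) $$ (p div dR, q div dR)
        = (\<Sum>l<d. \<Sum>l'<d. K x $$ (p div dR, l) * \<phi> $ (l * dR + p mod dR) *
            (cnj (K x $$ (q div dR, l')) * cnj (\<phi> $ (l' * dR + q mod dR))))"
        unfolding kraus_entry[OF K[OF x] X div[OF pq(1)] div[OF pq(2)]]
        by (intro sum.cong refl) (use idx pq in \<open>simp add: pe mult_ac\<close>)
      also have "\<dots> = ?g x p * cnj (?g x q)" by (simp add: sum_product)
      finally show "(K x * ?X * adj (K x)) $$ (p div dR, q div dR) = ?g x p * cnj (?g x q)" .
    qed
    finally show "ext_R d dR d \<Phi> (proj \<phi>) $$ (p,q) = ?M $$ (p,q)" using pq by simp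
  qed (use ext_R_carrier[of d dR d \<Phi> "proj \<phi>"] in auto)
  show ?thesis unfolding F_phi_def 1 2 by (rule fidelity_pure[OF \<phi> fin])
qed

text \<open>Both probe states have this form: the maximally entangled state, and the equal
  superposition of |0>|0> and |dL - 1>|dL - 1>.\<close>

definition schmidt_vec :: "nat \<Rightarrow> (nat \<Rightarrow> real) \<Rightarrow> complex vec" where
  "schmidt_vec d s = vec (d * d) (\<lambda>i. if i div d = i mod d then complex_of_real (s (i mod d)) else 0)"

lemma diagonal_index_less:
  assumes "j < d" "l < d"
  shows "l * d + j < d * (d :: nat)"
proof -
  have "l * d + j < Suc l * d" using assms by simp
  also have "\<dots> \<le> d * d" using assms by (intro mult_le_mono1) simp
  finally show ?thesis .
qed

lemma sum_diagonal_index: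
  fixes f :: "nat \<Rightarrow> 'a :: comm_monoid_add"
  shows "(\<Sum>p<d * d. if p div d = p mod d then f p else 0) = (\<Sum>j<d. f (j * d + j))"
proof -
  have "(\<Sum>p<d * d. if p div d = p mod d then f p else 0) = (\<Sum>p\<in>{p. p < d * d \<and> p div d = p mod d}. f p)"
    by (subst sum.inter_filter[symmetric]) (auto intro!: sum.cong)
  also have "{p. p < d * d \<and> p div d = p mod d} = (\<lambda>j. j * d + j) ` {..<d}"
  proof -
    have "p \<in> (\<lambda>j. j * d + j) ` {..<d}" if "p < d * d" "p div d = p mod d" for p
      using that div_mult_mod_eq[of p d] less_mult_imp_div_less[of p d d] by (intro image_eqI[of _ _ "p div d"]) auto
    then show ?thesis using diagonal_index_less by auto
  qed
  also have "(\<Sum>p\<in>(\<lambda>j. j * d + j) ` {..<d}. f p) = (\<Sum>j<d. f (j * d + j))"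
  proof (subst sum.reindex)
    show "inj_on (\<lambda>j. j * d + j) {..<d}"
    proof (rule inj_onI)
      fix x y assume "x * d + x = y * d + y"
      then have "x * Suc d = y * Suc d" by simp
      then show "x = y" by (metis mult_cancel2 nat.distinct(1))
    qed
  qed simp
  finally show ?thesis .
qed

lemma unit_schmidt_vec:
  assumes "(\<Sum>j<d. (s j)\<^sup>2) = 1"
  shows "unit_vec_in (d * d) (schmidt_vec d s)"
proof -
  have "(\<Sum>i<d * d. (cmod (schmidt_vec d s $ i))\<^sup>2) = (\<Sum>i<d * d. if i div d = i mod d then (s (i mod d))\<^sup>2 else 0)"
    by (intro sum.cong) (auto simp: schmidt_vec_def)
  also have "\<dots> = (\<Sum>j<d. (s j)\<^sup>2)" by (simp add: sum_diagonal_index)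
  finally show ?thesis using assms by (simp add: unit_vec_in_def schmidt_vec_def)
qed

lemma F_phi_schmidt:
  assumes s: "(\<Sum>j<d. (s j)\<^sup>2) = 1" and fin: "finite I"
    and K: "\<And>x. x \<in> I \<Longrightarrow> K x \<in> carrier_mat d d"
    and \<Phi>: "\<And>X. X \<in> carrier_mat d d \<Longrightarrow> \<Phi> X = msum d d I (\<lambda>x. K x * X * adj (K x))"
  shows "F_phi d d d (schmidt_vec d s) \<Phi> id
    = sqrt (\<Sum>x\<in>I. (cmod (\<Sum>j<d. complex_of_real ((s j)\<^sup>2) * K x $$ (j,j)))\<^sup>2)"
proof -
  have "(\<Sum>p<d * d. cnj (schmidt_vec d s $ p) *
     (\<Sum>l<d. K x $$ (p div d, l) * schmidt_vec d s $ (l * d + p mod d)))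
    = (\<Sum>j<d. complex_of_real ((s j)\<^sup>2) * K x $$ (j,j))" for x
  proof -
    have e: "schmidt_vec d s $ (l * d + j) = (if l = j then complex_of_real (s j) else 0)" if "l < d" "j < d" for l j
      using that diagonal_index_less[OF that(2,1)] by (simp add: schmidt_vec_def)
    have "(\<Sum>p<d * d. cnj (schmidt_vec d s $ p) *
       (\<Sum>l<d. K x $$ (p div d, l) * schmidt_vec d s $ (l * d + p mod d)))
      = (\<Sum>p<d * d. if p div d = p mod d then complex_of_real (s (p mod d)) *
         (\<Sum>l<d. K x $$ (p div d, l) * schmidt_vec d s $ (l * d + p mod d)) else 0)"
      by (intro sum.cong) (auto simp: schmidt_vec_def)
    also have "\<dots> = (\<Sum>j<d. complex_of_real (s j) * (\<Sum>l<d. K x $$ (j, l) * schmidt_vec d s $ (l * d + j)))"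
      unfolding sum_diagonal_index by (intro sum.cong refl) simp
    also have "\<dots> = (\<Sum>j<d. complex_of_real ((s j)\<^sup>2) * K x $$ (j,j))"
    proof (intro sum.cong refl)
      fix j assume "j \<in> {..<d}"
      then have j: "j < d" by simp
      have "(\<Sum>l<d. K x $$ (j, l) * schmidt_vec d s $ (l * d + j)) = (\<Sum>l<d. if l = j then K x $$ (j,j) * complex_of_real (s j) else 0)"
        by (intro sum.cong) (use j e in auto)
      then show "complex_of_real (s j) * (\<Sum>l<d. K x $$ (j, l) * schmidt_vec d s $ (l * d + j)) = complex_of_real ((s j)\<^sup>2) * K x $$ (j,j)"
        using j by (simp add: power2_eq_square mult_ac)
    qed
    finally show ?thesis .
  qed
  then show ?thesis
    using F_phi_kraus[OF unit_schmidt_vec[OF s] fin K \<Phi>] by simp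
qed

lemma max_ent_schmidt: "max_ent d = schmidt_vec d (\<lambda>_. 1 / sqrt (real d))"
  by (simp add: max_ent_def schmidt_vec_def)

section \<open>Root-closed sets of weights\<close>

text \<open>What is retained of the weights of SU(d): integral pairing with coroots, invariance
  under transpositions in the Weyl group, and one step down a root string. Coordinates from
  \<open>d\<close> on are left free, so that fixing the last coordinate yields a root-closed set for
  a smaller \<open>d\<close>.\<close>

definition root_closed :: "nat \<Rightarrow> (nat \<Rightarrow> real) set \<Rightarrow> bool" where
  "root_closed d S \<longleftrightarrow> (\<forall>\<mu>\<in>S. \<forall>a<d. \<forall>b<d. a \<noteq> b \<longrightarrow>
     \<mu> a - \<mu> b \<in> \<int> \<and> \<mu>(a := \<mu> b, b := \<mu> a) \<in> S \<and>
     (\<mu> b < \<mu> a \<longrightarrow> \<mu>(a := \<mu> a - 1, b := \<mu> b + 1) \<in> S))"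

lemma Ints_nonneg_eq_nat:
  fixes x :: real
  assumes "x \<in> \<int>" "0 \<le> x"
  shows "\<exists>n. x = real n"
proof -
  have "x \<in> \<nat>" using assms by (simp add: Nats_altdef2)
  then show ?thesis by (auto elim: Nats_cases)
qed

text \<open>Single steps are available as long as the entry at \<open>a\<close> exceeds the one at
  \<open>b\<close>, which covers the first half of the string. The transposition of \<open>a\<close>
  and \<open>b\<close> reflects this half onto the other one.\<close>

lemma root_closed_string:
  assumes S: "root_closed d S" and \<mu>: "\<mu> \<in> S" and ab: "a < d" "b < d" "a \<noteq> b"
    and j: "real j \<le> \<mu> a - \<mu> b"
  shows "\<mu>(a := \<mu> a - real j, b := \<mu> b + real j) \<in> S"
proof -
  have half: "\<mu>(a := \<mu> a - real i, b := \<mu> b + real i) \<in> S" if "2 * real i \<le> \<mu> a - \<mu> b" for i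
    using that
  proof (induction i)
    case 0
    then show ?case using \<mu> ab by simp
  next
    case (Suc i)
    let ?\<nu> = "\<mu>(a := \<mu> a - real i, b := \<mu> b + real i)"
    have "?\<nu> \<in> S" by (rule Suc.IH) (use Suc.prems in simp)
    moreover have "?\<nu> b < ?\<nu> a" using Suc.prems ab by simp
    ultimately have "?\<nu>(a := ?\<nu> a - 1, b := ?\<nu> b + 1) \<in> S"
      using S ab unfolding root_closed_def by blast
    moreover have "?\<nu>(a := ?\<nu> a - 1, b := ?\<nu> b + 1) = \<mu>(a := \<mu> a - real (Suc i), b := \<mu> b + real (Suc i))"
      using ab by (auto simp: fun_eq_iff)
    ultimately show ?case by (simp only:)
  qed
  show ?thesis
  proof (cases "2 * real j \<le> \<mu> a - \<mu> b")
    case True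
    then show ?thesis by (rule half)
  next
    case False
    have "\<mu> a - \<mu> b \<in> \<int>" using S \<mu> ab unfolding root_closed_def by blast
    moreover have "0 \<le> \<mu> a - \<mu> b" using j by linarith
    ultimately obtain n where n: "\<mu> a - \<mu> b = real n"
      using Ints_nonneg_eq_nat by blast
    have jn: "j \<le> n" using j n by simp
    let ?\<nu> = "\<mu>(a := \<mu> a - real (n - j), b := \<mu> b + real (n - j))"
    have "?\<nu> \<in> S" using half[of "n - j"] False n jn by (simp add: of_nat_diff)
    then have "?\<nu>(a := ?\<nu> b, b := ?\<nu> a) \<in> S" using S ab unfolding root_closed_def by blast
    moreover have "?\<nu>(a := ?\<nu> b, b := ?\<nu> a) = \<mu>(a := \<mu> a - real j, b := \<mu> b + real j)"
      using ab n jn by (auto simp: fun_eq_iff of_nat_diff)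
    ultimately show ?thesis by (simp only:)
  qed
qed

lemma root_closed_slice:
  assumes "root_closed (Suc d) S"
  shows "root_closed d {\<mu> \<in> S. \<mu> d = y}"
  using assms unfolding root_closed_def by auto

lemma card_slices_le:
  fixes S :: "(nat \<Rightarrow> real) set"
  assumes "finite S"
  shows "(\<Sum>y\<le>m. card {\<mu> \<in> S. \<mu> d = c + real y}) \<le> card S"
proof -
  have "(\<Sum>y\<le>m. card {\<mu> \<in> S. \<mu> d = c + real y}) = card (\<Union>y\<in>{..m}. {\<mu> \<in> S. \<mu> d = c + real y})"
    using assms by (subst card_UN_disjoint) auto
  also have "\<dots> \<le> card S" using assms by (intro card_mono) auto
  finally show ?thesis .
qed

lemma choose_add_mono: "(m :: nat) \<le> n \<Longrightarrow> (d + m) choose m \<le> (d + n) choose n"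
proof (induction rule: dec_induct)
  case (step n)
  have "(d + n) choose n \<le> (d + Suc n) choose Suc n" by simp
  then show ?case using step by linarith
qed simp

text \<open>Induction on \<open>d\<close>: after permuting coordinates, the largest and the smallest coordinate of the weight
  differ by some \<open>n \<ge> m\<close> and are not the last one; root strings through it meet the slices with last
  coordinate \<open>\<nu> q + y\<close>, \<open>y \<le> n\<close>, and the bounds for the slices add up to the hockey-stick sum.\<close>
lemma card_root_closed:
  assumes "2 \<le> d" "finite S" "root_closed d S" "\<mu> \<in> S" "a < d" "b < d" "a \<noteq> b" "\<mu> a - \<mu> b = real m"
  shows "(d - 1 + m) choose m \<le> card S"
  using assms
proof (induction d arbitrary: S \<mu> a b m rule: dec_induct)
  case base
  \<comment> \<open>For two coordinates the root string alone supplies the m + 1 weights.\<close>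
  let ?f = "\<lambda>j. \<mu>(a := \<mu> a - real j, b := \<mu> b + real j)"
  have "inj_on ?f {..m}"
  proof (rule inj_onI)
    fix i j assume "?f i = ?f j"
    then have "?f i b = ?f j b" by (rule fun_cong)
    then show "i = j" by simp
  qed
  then have "card (?f ` {..m}) = Suc m" by (simp add: card_image)
  moreover have "?f ` {..m} \<subseteq> S"
    using root_closed_string[OF base(2,3,4,5,6)] base(7) by auto
  ultimately have "Suc m \<le> card S" using card_mono[OF \<open>finite S\<close>] by metis
  then show ?case by simp
next
  case (step d)
  let ?A = "\<mu> ` {..d}"
  have "Max ?A \<in> ?A" by (rule Max_in) auto
  then obtain p' where p': "p' \<le> d" "\<mu> p' = Max ?A" by (metis atMost_iff imageE)
  have "Min ?A \<in> ?A" by (rule Min_in) auto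
  then obtain q' where q': "q' \<le> d" "\<mu> q' = Min ?A" by (metis atMost_iff imageE)
  have le: "\<mu> i \<le> \<mu> p'" "\<mu> q' \<le> \<mu> i" if "i \<le> d" for i
    using that p' q' by auto
  have gap: "real m \<le> \<mu> p' - \<mu> q'" using le(1)[of a] le(2)[of b] step.prems by simp
  show ?case
  proof (cases "p' = q'")
    case True
    then have "m = 0" using gap by simp
    moreover have "card S \<noteq> 0" using step.prems by auto
    ultimately show ?thesis by simp
  next
    case False
    have swap: "\<mu>(x := \<mu> y, y := \<mu> x) \<in> S" if "x < Suc d" "y < Suc d" "x \<noteq> y" for x y
      using step.prems(2,3) that unfolding root_closed_def by blast
    have int: "\<nu> x - \<nu> y \<in> \<int>" if "\<nu> \<in> S" "x < Suc d" "y < Suc d" "x \<noteq> y" for \<nu> x y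
      using step.prems(2) that unfolding root_closed_def by blast
    have natdiff: "\<exists>n. \<nu> x - \<nu> y = real n" if "\<nu> \<in> S" "x < Suc d" "y < Suc d" "x \<noteq> y" "\<nu> y \<le> \<nu> x" for \<nu> x y
      using Ints_nonneg_eq_nat[OF int[OF that(1-4)]] that(5) by simp
    \<comment> \<open>The induction hypothesis speaks of the first \<open>d\<close> coordinates. An
      extreme entry sitting at \<open>d\<close> is moved to a spare coordinate \<open>c\<close>,
      which exists because \<open>d\<close> is at least 2.\<close>
    obtain \<nu> p q where \<nu>: "\<nu> \<in> S" "p < d" "q < d" "p \<noteq> q" "\<nu> p = \<mu> p'" "\<nu> q = \<mu> q'"
      "\<mu> q' \<le> \<nu> d" "\<nu> d \<le> \<mu> p'"
    proof -
      have other: "\<exists>c<d. c \<noteq> x" for x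
        using step.hyps by (intro exI[of _ "if x = 0 then 1 else 0"]) auto
      consider "p' < d" "q' < d" | "p' = d" "q' < d" | "p' < d" "q' = d"
        using p' q' False by linarith
      then show ?thesis
      proof cases
        case 1
        then show ?thesis using that[of \<mu> p' q'] step.prems(3) False le by auto
      next
        case 2
        obtain c where "c < d" "c \<noteq> q'" using other by blast
        then show ?thesis using that[of "\<mu>(c := \<mu> d, d := \<mu> c)" c q'] swap[of c d] 2 le by auto
      next
        case 3
        obtain c where "c < d" "c \<noteq> p'" using other by blast
        then show ?thesis using that[of "\<mu>(c := \<mu> d, d := \<mu> c)" p' c] swap[of c d] 3 le by auto
      qed
    qed
    obtain x where x: "\<nu> d - \<nu> q = real x" using natdiff[of \<nu> d q] \<nu> by auto
    obtain n where n: "\<nu> p - \<nu> q = real n"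
      using natdiff[of \<nu> p q] \<nu> le(2)[of p'] p' by auto
    have mn: "m \<le> n" using gap n \<nu> by simp
    have xn: "x \<le> n" using x n \<nu> by simp
    let ?S = "\<lambda>y. {\<mu> \<in> S. \<mu> d = \<nu> q + real y}"
    have IH: "(d - 1 + s) choose s \<le> card (?S y)"
      if "\<eta> \<in> ?S y" "\<eta> p - \<eta> q = real s" for \<eta> y s
    proof (rule step.IH)
      show "root_closed d (?S y)" by (rule root_closed_slice) (rule step.prems)
    qed (use that \<nu> step.prems in auto)
    \<comment> \<open>Up to the level \<open>x\<close> of \<open>\<nu>\<close>, a string from
      \<open>d\<close> to \<open>q\<close> lowers the last coordinate to level \<open>y\<close> and
      raises the one at \<open>q\<close>; the gap between \<open>p\<close> and \<open>q\<close>
      becomes n - (x - y).\<close>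
    have lower: "(d - 1 + (n - x + y)) choose (n - x + y) \<le> card (?S y)" if "y \<le> x" for y
    proof (rule IH)
      let ?\<eta> = "\<nu>(d := \<nu> d - real (x - y), q := \<nu> q + real (x - y))"
      show "?\<eta> \<in> ?S y"
        using root_closed_string[OF step.prems(2) \<nu>(1), of d q "x - y"] \<nu> x that
        by (auto simp: of_nat_diff)
      show "?\<eta> p - ?\<eta> q = real (n - x + y)"
        using \<nu> n xn that by (auto simp: of_nat_diff)
    qed
    \<comment> \<open>Above level \<open>x\<close> the string runs from \<open>p\<close> to
      \<open>d\<close> and leaves the gap n - y + x. This is weakened to n - y, so that the slices
      together use every s <= n exactly once: n - x, ..., n come from \<open>lower\<close> and 0,
      ..., n - x - 1 from here.\<close>
    have upper: "(d - 1 + (n - y)) choose (n - y) \<le> card (?S y)" if "x < y" "y \<le> n" for y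
    proof -
      let ?\<eta> = "\<nu>(p := \<nu> p - real (y - x), d := \<nu> d + real (y - x))"
      have "(d - 1 + (n - y + x)) choose (n - y + x) \<le> card (?S y)"
      proof (rule IH)
        show "?\<eta> \<in> ?S y"
          using root_closed_string[OF step.prems(2) \<nu>(1), of p d "y - x"] \<nu> x n that
          by (auto simp: of_nat_diff)
        show "?\<eta> p - ?\<eta> q = real (n - y + x)"
          using \<nu> n xn that by (auto simp: of_nat_diff)
      qed
      moreover have "(d - 1 + (n - y)) choose (n - y) \<le> (d - 1 + (n - y + x)) choose (n - y + x)"
        by (rule choose_add_mono) simp
      ultimately show ?thesis by linarith
    qed
    let ?c = "\<lambda>s. (d - 1 + s) choose s"
    have "(Suc d - 1 + n) choose n = (\<Sum>s\<le>n. ?c s)"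
      using sum_choose_lower[of "d - 1" n] step.hyps by simp
    also have "{..n} = (\<lambda>y. n - x + y) ` {..x} \<union> (\<lambda>y. n - y) ` {x<..n}"
    proof -
      have "s \<in> (\<lambda>y. n - x + y) ` {..x} \<union> (\<lambda>y. n - y) ` {x<..n}" if "s \<le> n" for s
      proof (cases "n - x \<le> s")
        case True
        then have "s = (\<lambda>y. n - x + y) (s - (n - x))" "s - (n - x) \<in> {..x}" using that xn by auto
        then show ?thesis by blast
      next
        case False
        then have "s = (\<lambda>y. n - y) (n - s)" "n - s \<in> {x<..n}" using that xn by auto
        then show ?thesis by blast
      qed
      then show ?thesis using xn by auto
    qed
    also have "(\<Sum>s\<in>\<dots>. ?c s) = (\<Sum>s\<in>(\<lambda>y. n - x + y) ` {..x}. ?c s) + (\<Sum>s\<in>(\<lambda>y. n - y) ` {x<..n}. ?c s)"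
      using xn by (intro sum.union_disjoint) auto
    also have "\<dots> = (\<Sum>y\<le>x. ?c (n - x + y)) + (\<Sum>y\<in>{x<..n}. ?c (n - y))"
      by (subst (1 2) sum.reindex) (auto simp: inj_on_def)
    also have "\<dots> \<le> (\<Sum>y\<le>x. card (?S y)) + (\<Sum>y\<in>{x<..n}. card (?S y))"
      using lower upper by (intro add_mono sum_mono) auto
    also have "\<dots> = (\<Sum>y\<le>n. card (?S y))"
      using xn by (subst sum.union_disjoint[symmetric]) (auto intro!: sum.cong)
    also have "\<dots> \<le> card S" using step.prems by (intro card_slices_le)
    finally have "(Suc d - 1 + n) choose n \<le> card S" .
    moreover have "(Suc d - 1 + m) choose m \<le> (Suc d - 1 + n) choose n"
      using mn by (rule choose_add_mono)
    ultimately show ?thesis by linarith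
  qed
qed

section \<open>Weights of representations of SU(d)\<close>

lemma isometry_sum:
  assumes "Q \<in> carrier_mat k k" "adj Q * Q = 1\<^sub>m k"
  shows "(\<Sum>r<k. (cmod (\<Sum>s<k. Q $$ (r,s) * x s))\<^sup>2) = (\<Sum>s<k. (cmod (x s))\<^sup>2)"
proof -
  have "complex_of_real (\<Sum>r<k. (cmod (\<Sum>s<k. Q $$ (r,s) * x s))\<^sup>2)
      = (\<Sum>r<k. (\<Sum>s<k. Q $$ (r,s) * x s) * cnj (\<Sum>s<k. Q $$ (r,s) * x s))"
    by (simp only: of_real_sum mult_cnj_cmod)
  also have "\<dots> = (\<Sum>r<k. \<Sum>s<k. \<Sum>t<k. x s * cnj (x t) * (cnj (Q $$ (r,t)) * Q $$ (r,s)))"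
    by (simp add: sum_product mult_ac)
  also have "\<dots> = (\<Sum>s<k. \<Sum>t<k. \<Sum>r<k. x s * cnj (x t) * (cnj (Q $$ (r,t)) * Q $$ (r,s)))"
    by (rule trans[OF sum.swap]) (intro sum.cong refl sum.swap)
  also have "\<dots> = (\<Sum>s<k. \<Sum>t<k. if t = s then x s * cnj (x s) else 0)"
    by (intro sum.cong refl) (simp add: isometry_cols[OF assms] flip: sum_distrib_left)
  also have "\<dots> = complex_of_real (\<Sum>s<k. (cmod (x s))\<^sup>2)"
    by (simp add: mult_cnj_cmod)
  finally show ?thesis by (simp only: of_real_eq_iff)
qed

text \<open>At a coordinate of largest modulus the eigenvalue equation gives |\<mu> + 1| <= k / (k +
  1) < 1, which a nonnegative real part of \<mu> excludes. This is the reason for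
  \<open>Suc k\<close> in the bound.\<close>

lemma near_identity_eigenvalue:
  fixes A :: "complex mat"
  assumes A: "A \<in> carrier_mat k k"
    and near: "\<And>r s. r < k \<Longrightarrow> s < k \<Longrightarrow> cmod (A $$ (r,s) - 1\<^sub>m k $$ (r,s)) < 1 / real (Suc k)"
    and w: "w \<in> carrier_vec k" and eig: "\<And>r. r < k \<Longrightarrow> (A *\<^sub>v w) $ r = - \<mu> * w $ r" and \<mu>: "0 \<le> Re \<mu>"
    and r: "r < k"
  shows "w $ r = 0"
proof -
  let ?W = "(\<lambda>r. cmod (w $ r)) ` {..<k}"
  have "Max ?W \<in> ?W" using r by (intro Max_in) auto
  then obtain p where p: "p < k" "cmod (w $ p) = Max ?W" by auto
  have le: "cmod (w $ s) \<le> cmod (w $ p)" if "s < k" for s using that p by simp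
  have "w $ p = 0"
  proof (rule ccontr)
    assume "w $ p \<noteq> 0"
    then have pos: "0 < cmod (w $ p)" by simp
    have "(- \<mu> - 1) * w $ p = (A *\<^sub>v w) $ p - w $ p" by (simp add: eig[OF p(1)] algebra_simps)
    also have "\<dots> = (\<Sum>s<k. (A $$ (p,s) - 1\<^sub>m k $$ (p,s)) * w $ s)"
    proof -
      have "(\<Sum>s<k. 1\<^sub>m k $$ (p,s) * w $ s) = (\<Sum>s<k. if s = p then w $ p else 0)"
        by (intro sum.cong) (use p in auto)
      then show ?thesis
        using p by (simp add: mat_vec_entry[OF A w p(1)] left_diff_distrib sum_subtractf del: index_mult_mat_vec)
    qed
    finally have "cmod (- \<mu> - 1) * cmod (w $ p) = cmod (\<Sum>s<k. (A $$ (p,s) - 1\<^sub>m k $$ (p,s)) * w $ s)"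
      by (metis norm_mult)
    also have "\<dots> \<le> (\<Sum>s<k. cmod ((A $$ (p,s) - 1\<^sub>m k $$ (p,s)) * w $ s))" by (rule norm_sum)
    also have "\<dots> \<le> (\<Sum>s<k. 1 / real (Suc k) * cmod (w $ p))"
    proof (intro sum_mono)
      fix s assume "s \<in> {..<k}"
      then have s: "s < k" by simp
      then show "cmod ((A $$ (p,s) - 1\<^sub>m k $$ (p,s)) * w $ s) \<le> 1 / real (Suc k) * cmod (w $ p)"
        unfolding norm_mult by (intro mult_mono less_imp_le[OF near[OF p(1) s]] le[OF s]) auto
    qed
    also have "\<dots> < 1 * cmod (w $ p)"
      using pos by (simp add: field_simps)
    finally have "cmod (- \<mu> - 1) < 1" using pos by simp
    moreover have "\<bar>Re (- \<mu> - 1)\<bar> \<le> cmod (- \<mu> - 1)" by (rule abs_Re_le_cmod)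
    ultimately show False using \<mu> by simp
  qed
  then show ?thesis using le[OF r] by simp
qed

lemma cis_eq_1_all:
  assumes "\<And>s. cis (s * y) = 1"
  shows "y = 0"
proof (rule ccontr)
  assume "y \<noteq> 0"
  then have "cis (pi / y * y) = -1" by (simp add: cis_pi)
  then show False using assms[of "pi / y"] by simp
qed

text \<open>Integer multiples of the times t0 / 2^n approximate every real \<open>t\<close>; by
  continuity an eigenvalue equation known at these multiples extends to the whole one-parameter
  group.\<close>

lemma dyadic_floor_tendsto:
  fixes t t0 :: real
  assumes "0 < t0"
  shows "(\<lambda>n. of_int \<lfloor>t * 2 ^ n / t0\<rfloor> * (t0 / 2 ^ n)) \<longlonglongrightarrow> t"
proof (rule tendsto_sandwich[of "\<lambda>n. t - t0 * (1/2) ^ n" _ _ "\<lambda>_. t"])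
  show "(\<lambda>n. t - t0 * (1/2) ^ n) \<longlonglongrightarrow> t"
    using tendsto_diff[OF tendsto_const[of t] tendsto_mult_right_zero[OF LIMSEQ_realpow_zero[of "1/2 :: real"], of t0]] by simp
  show "\<forall>\<^sub>F n in sequentially. t - t0 * (1/2) ^ n \<le> of_int \<lfloor>t * 2 ^ n / t0\<rfloor> * (t0 / 2 ^ n)"
  proof (intro always_eventually allI)
    fix n
    have "(t * 2 ^ n / t0 - 1) * (t0 / 2 ^ n) \<le> of_int \<lfloor>t * 2 ^ n / t0\<rfloor> * (t0 / 2 ^ n)"
      using assms by (intro mult_right_mono) (linarith, simp)
    moreover have "(t * 2 ^ n / t0 - 1) * (t0 / 2 ^ n) = t - t0 * (1/2) ^ n"
      using assms by (simp add: left_diff_distrib power_one_over diff_divide_distrib)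
    ultimately show "t - t0 * (1/2) ^ n \<le> of_int \<lfloor>t * 2 ^ n / t0\<rfloor> * (t0 / 2 ^ n)" by simp
  qed
  show "\<forall>\<^sub>F n in sequentially. of_int \<lfloor>t * 2 ^ n / t0\<rfloor> * (t0 / 2 ^ n) \<le> t"
  proof (intro always_eventually allI)
    fix n
    have "of_int \<lfloor>t * 2 ^ n / t0\<rfloor> * (t0 / 2 ^ n) \<le> (t * 2 ^ n / t0) * (t0 / 2 ^ n)"
      using assms by (intro mult_right_mono) (linarith, simp)
    then show "of_int \<lfloor>t * 2 ^ n / t0\<rfloor> * (t0 / 2 ^ n) \<le> t" using assms by simp
  qed
qed simp

text \<open>The eigenvalue of \<open>U (t0 / 2 ^ n)\<close> is a square root of the previous one; as \<open>U\<close> has no eigenvalue with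
  nonpositive real part near \<open>0\<close>, the square root with positive real part occurs.\<close>
lemma one_parameter_eigenvector:
  fixes U :: "real \<Rightarrow> complex mat"
  assumes U: "\<And>t. U t \<in> carrier_mat k k" and unitary: "\<And>t. adj (U t) * U t = 1\<^sub>m k"
    and add: "\<And>s t. U (s + t) = U s * U t" and per: "U (2 * pi) = 1\<^sub>m k"
    and cont: "\<And>r s t. r < k \<Longrightarrow> s < k \<Longrightarrow> isCont (\<lambda>t. U t $$ (r,s)) t"
    and t0: "0 < t0"
    and near: "\<And>t r s. \<bar>t\<bar> \<le> t0 \<Longrightarrow> r < k \<Longrightarrow> s < k \<Longrightarrow> cmod (U t $$ (r,s) - 1\<^sub>m k $$ (r,s)) < 1 / real (Suc k)"
    and v: "v \<in> carrier_vec k" "v \<noteq> 0\<^sub>v k" and eig: "U t0 *\<^sub>v v = z \<cdot>\<^sub>v v"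
  shows "\<exists>c :: int. \<forall>t. U t *\<^sub>v v = cis (of_int c * t) \<cdot>\<^sub>v v"
proof -
  obtain r0 where r0: "r0 < k" "v $ r0 \<noteq> 0"
  proof -
    have "\<exists>r<k. v $ r \<noteq> 0"
    proof (rule ccontr)
      assume "\<not> ?thesis"
      then have "v = 0\<^sub>v k" using v(1) by (intro eq_vecI) auto
      then show False using v(2) by simp
    qed
    then show ?thesis using that by blast
  qed
  define nv where "nv = (\<Sum>r<k. (cmod (v $ r))\<^sup>2)"
  have nv: "0 < nv" unfolding nv_def using r0 by (intro sum_pos2[of _ r0]) auto
  have entry: "(U t *\<^sub>v u) $ r = (\<Sum>s<k. U t $$ (r,s) * u $ s)" if "u \<in> carrier_vec k" "r < k" for t u r
    using mat_vec_entry[OF U that] .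
  have "nv = (\<Sum>r<k. (cmod ((U t0 *\<^sub>v v) $ r))\<^sup>2)"
    using isometry_sum[OF U unitary, of t0 "\<lambda>s. v $ s"]
    by (simp add: nv_def entry[OF v(1)] del: index_mult_mat_vec)
  also have "\<dots> = (cmod z)\<^sup>2 * nv"
  proof -
    have "(cmod ((U t0 *\<^sub>v v) $ r))\<^sup>2 = (cmod z)\<^sup>2 * (cmod (v $ r))\<^sup>2" if "r < k" for r
      unfolding eig using that v(1) by (simp add: norm_mult power_mult_distrib)
    then show ?thesis unfolding nv_def sum_distrib_left by (intro sum.cong refl) simp
  qed
  finally have "(cmod z)\<^sup>2 = 1" using nv by simp
  then have "cmod z = 1" using norm_ge_zero[of z] by (simp add: power2_eq_1_iff)
  then have zx: "z = cis (Arg z)" using cis_Arg[of z] by (cases "z = 0") (simp_all add: sgn_div_norm)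
  define x where "x = Arg z"
  have xb: "\<bar>x\<bar> \<le> pi" unfolding x_def using Arg_bounded[of z] by auto
  have U0: "U 0 = 1\<^sub>m k"
  proof -
    have "adj (U 0) * (U 0 * U 0) = adj (U 0) * U 0" using add[of 0 0] by simp
    moreover have "adj (U 0) * (U 0 * U 0) = U 0"
      using assoc_mult_mat[OF adj_carrier[OF U] U U, of 0 0 0] unitary[of 0] U[of 0] by simp
    ultimately show ?thesis using unitary[of 0] by simp
  qed
  have halves: "U (t0 / 2 ^ n) *\<^sub>v v = cis (x / 2 ^ n) \<cdot>\<^sub>v v" for n
  proof (induction n)
    case 0
    then show ?case using eig zx by (simp add: x_def)
  next
    case (Suc n)
    let ?A = "U (t0 / 2 ^ Suc n)" and ?m = "cis (x / 2 ^ Suc n)"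
    have AA: "?A * ?A = U (t0 / 2 ^ n)" by (simp flip: add)
    have mm: "?m * ?m = cis (x / 2 ^ n)" by (simp add: cis_mult)
    have Av: "?A *\<^sub>v v \<in> carrier_vec k" by (rule mult_mat_vec_carrier[OF U v(1)])
    \<comment> \<open>With A for \<open>?A\<close> and m for \<open>?m\<close>, the equation A A v =
      m m v yields A w = - m w, and \<open>near_identity_eigenvalue\<close> makes \<open>w\<close>
      vanish.\<close>
    define w where "w = ?A *\<^sub>v v - ?m \<cdot>\<^sub>v v"
    have w: "w \<in> carrier_vec k" using Av v by (simp add: w_def)
    have "?A *\<^sub>v w = ?A *\<^sub>v (?A *\<^sub>v v) - ?A *\<^sub>v (?m \<cdot>\<^sub>v v)"
      unfolding w_def using Av v by (intro mult_minus_distrib_mat_vec[OF U]) auto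
    also have "?A *\<^sub>v (?A *\<^sub>v v) = (?m * ?m) \<cdot>\<^sub>v v"
      using assoc_mult_mat_vec[OF U U v(1), of "t0 / 2 ^ Suc n" "t0 / 2 ^ Suc n"] Suc.IH unfolding AA mm by simp
    also have "?A *\<^sub>v (?m \<cdot>\<^sub>v v) = ?m \<cdot>\<^sub>v (?A *\<^sub>v v)" by (rule mult_mat_vec[OF U v(1)])
    finally have Aw: "?A *\<^sub>v w = (?m * ?m) \<cdot>\<^sub>v v - ?m \<cdot>\<^sub>v (?A *\<^sub>v v)" .
    have "w $ r = 0" if r: "r < k" for r
    proof (rule near_identity_eigenvalue[OF U _ w _ _ r])
      show "cmod (?A $$ (p,s) - 1\<^sub>m k $$ (p,s)) < 1 / real (Suc k)" if "p < k" "s < k" for p s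
      proof (rule near[OF _ that])
        have "(1::real) \<le> 2 ^ Suc n" by (rule one_le_power) simp
        then have "t0 / 2 ^ Suc n \<le> t0 / 1" using t0 by (intro divide_left_mono) simp_all
        then show "\<bar>t0 / 2 ^ Suc n\<bar> \<le> t0" using t0 by simp
      qed
      show "(?A *\<^sub>v w) $ p = - ?m * w $ p" if "p < k" for p
        unfolding Aw using that Av v U[of "t0 / 2 ^ Suc n"] by (simp add: w_def algebra_simps del: index_mult_mat_vec)
      \<comment> \<open>An argument is at most pi in absolute value, so one halving already brings
        the phase into [-pi/2, pi/2], where the cosine is nonnegative.\<close>
      have "\<bar>x\<bar> / 2 ^ Suc n \<le> pi / 2 ^ Suc n" using xb by (intro divide_right_mono) auto
      also have "\<dots> \<le> pi / 2" by (intro divide_left_mono) auto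
      finally have "\<bar>x / 2 ^ Suc n\<bar> \<le> pi / 2" by simp
      then have "- (pi / 2) \<le> x / 2 ^ Suc n" "x / 2 ^ Suc n \<le> pi / 2" by (simp_all only: abs_le_iff neg_le_iff_le minus_le_iff)
      then show "0 \<le> Re ?m" using cos_ge_zero by (simp only: cis.sel(1))
    qed
    then have "(?A *\<^sub>v v) $ r = (?m \<cdot>\<^sub>v v) $ r" if "r < k" for r
      using that v(1) Av by (simp add: w_def del: index_mult_mat_vec)
    then show ?case using carrier_vecD[OF Av] carrier_vecD[OF v(1)] by (intro eq_vecI) simp_all
  qed
  have step: "U (s + t) *\<^sub>v v = (cis a * cis b) \<cdot>\<^sub>v v" if "U s *\<^sub>v v = cis a \<cdot>\<^sub>v v" "U t *\<^sub>v v = cis b \<cdot>\<^sub>v v" for s t a b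
  proof -
    have "U (s + t) *\<^sub>v v = U s *\<^sub>v (U t *\<^sub>v v)" unfolding add by (rule assoc_mult_mat_vec[OF U U v(1)])
    then show ?thesis using that mult_mat_vec[OF U v(1)] by (simp add: smult_smult_assoc mult.commute)
  qed
  have nats: "U (real m * s) *\<^sub>v v = cis (real m * a) \<cdot>\<^sub>v v" if "U s *\<^sub>v v = cis a \<cdot>\<^sub>v v" for m s a
  proof (induction m)
    case 0
    then show ?case using U0 v by simp
  next
    case (Suc m)
    have "real (Suc m) * s = real m * s + s" "cis (real (Suc m) * a) = cis (real m * a) * cis a"
      by (simp_all add: algebra_simps cis_mult)
    then show ?case using step[OF Suc that] by simp
  qed
  have neg: "U (- s) *\<^sub>v v = cis (- a) \<cdot>\<^sub>v v" if "U s *\<^sub>v v = cis a \<cdot>\<^sub>v v" for s a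
  proof -
    have "U (- s) * U s = 1\<^sub>m k" using add[of "- s" s] U0 by simp
    then have "v = U (- s) *\<^sub>v (U s *\<^sub>v v)"
      using assoc_mult_mat_vec[OF U U v(1), of "- s" s] v(1) by simp
    also have "\<dots> = cis a \<cdot>\<^sub>v (U (- s) *\<^sub>v v)" using that mult_mat_vec[OF U v(1)] by simp
    finally have "cis (- a) \<cdot>\<^sub>v v = cis (- a) \<cdot>\<^sub>v (cis a \<cdot>\<^sub>v (U (- s) *\<^sub>v v))" by simp
    then show ?thesis by (simp add: smult_smult_assoc cis_mult)
  qed
  have ints: "U (of_int m * s) *\<^sub>v v = cis (of_int m * a) \<cdot>\<^sub>v v" if "U s *\<^sub>v v = cis a \<cdot>\<^sub>v v" for m :: int and s a
  proof (cases "0 \<le> m")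
    case True
    then show ?thesis using nats[OF that, of "nat m"] by simp
  next
    case False
    then show ?thesis using neg[OF nats[OF that, of "nat (- m)"]] by simp
  qed
  define c where "c = x / t0"
  have all: "U t *\<^sub>v v = cis (c * t) \<cdot>\<^sub>v v" for t
  proof (rule eq_vecI)
    fix r assume "r < dim_vec (cis (c * t) \<cdot>\<^sub>v v)"
    then have r: "r < k" using v by simp
    let ?s = "\<lambda>n. of_int \<lfloor>t * 2 ^ n / t0\<rfloor> * (t0 / 2 ^ n)"
    have s: "?s \<longlonglongrightarrow> t" by (rule dyadic_floor_tendsto[OF t0])
    let ?f = "\<lambda>t. \<Sum>s<k. U t $$ (r,s) * v $ s"
    have "isCont ?f t" using cont r by (intro continuous_intros) auto
    then have lim1: "(\<lambda>n. ?f (?s n)) \<longlonglongrightarrow> ?f t" using s by (rule isCont_tendsto_compose)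
    have eq: "(\<lambda>n. ?f (?s n)) = (\<lambda>n. cis (c * ?s n) * v $ r)"
    proof
      fix n
      have "?f (?s n) = (U (?s n) *\<^sub>v v) $ r" using entry[OF v(1) r] by simp
      also have "\<dots> = cis (of_int \<lfloor>t * 2 ^ n / t0\<rfloor> * (x / 2 ^ n)) * v $ r"
        unfolding ints[OF halves] using v r by simp
      also have "of_int \<lfloor>t * 2 ^ n / t0\<rfloor> * (x / 2 ^ n) = c * ?s n" using t0 by (simp add: c_def)
      finally show "?f (?s n) = cis (c * ?s n) * v $ r" .
    qed
    have lim2: "(\<lambda>n. cis (c * ?s n) * v $ r) \<longlonglongrightarrow> cis (c * t) * v $ r"
      by (intro tendsto_intros s)
    have "?f t = cis (c * t) * v $ r" by (rule LIMSEQ_unique[OF lim1[unfolded eq] lim2])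
    then show "(U t *\<^sub>v v) $ r = (cis (c * t) \<cdot>\<^sub>v v) $ r" using entry[OF v(1) r] v r by simp
  qed (use U v in auto)
  \<comment> \<open>The period 2 pi of the group makes the exponent \<open>c\<close> an
    integer.\<close>
  have "v $ r0 = cis (c * (2 * pi)) * v $ r0"
    using arg_cong[OF all[of "2 * pi"], of "\<lambda>u. u $ r0"] per v r0 by simp
  then have "cis (c * (2 * pi)) = 1" using r0 by simp
  then have "cos (c * (2 * pi)) = 1" by (simp add: complex_eq_iff)
  then obtain n :: int where "c * (2 * pi) = of_int n * 2 * pi" using cos_one_2pi_int by auto
  then have "c = of_int n" by simp
  then show ?thesis using all by blast
qed

section \<open>The maximal torus and rotations in coordinate planes\<close>

definition torus :: "nat \<Rightarrow> (nat \<Rightarrow> real) \<Rightarrow> complex mat" where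
  "torus d \<theta> = cdiag d (\<lambda>j. cis (\<theta> j))"

text \<open>The angles of the one-parameter subgroup of a coroot; a weight \<mu> pairs with them to
  (\<mu> a - \<mu> b) t.\<close>

definition coroot :: "nat \<Rightarrow> nat \<Rightarrow> real \<Rightarrow> nat \<Rightarrow> real" where
  "coroot a b t = (\<lambda>j. if j = a then t else if j = b then - t else 0)"

definition emb2 :: "nat \<Rightarrow> nat \<Rightarrow> nat \<Rightarrow> complex \<Rightarrow> complex \<Rightarrow> complex \<Rightarrow> complex \<Rightarrow> complex mat" where
  "emb2 d a b \<alpha> \<beta> \<gamma> \<delta> = mat d d (\<lambda>(i,j).
     if i = a \<and> j = a then \<alpha> else if i = a \<and> j = b then \<beta> else
     if i = b \<and> j = a then \<gamma> else if i = b \<and> j = b then \<delta> else if i = j then 1 else 0)"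

definition rot :: "nat \<Rightarrow> nat \<Rightarrow> nat \<Rightarrow> real \<Rightarrow> complex mat" where
  "rot d a b t = emb2 d a b (cos t) (- sin t) (sin t) (cos t)"

lemma torus_carrier [simp]: "torus d \<theta> \<in> carrier_mat d d"
  by (simp add: torus_def)

lemma torus_add: "torus d (\<lambda>j. \<theta> j + \<eta> j) = torus d \<theta> * torus d \<eta>"
  by (simp add: torus_def cdiag_mult cis_mult)

lemma torus_zero: "torus d (\<lambda>_. 0) = 1\<^sub>m d"
  by (simp add: torus_def cdiag_one)

lemma torus_cong: "(\<And>j. j < d \<Longrightarrow> \<theta> j = \<eta> j) \<Longrightarrow> torus d \<theta> = torus d \<eta>"
  unfolding torus_def cdiag_def by (intro cong_mat) auto

lemma adj_torus: "adj (torus d \<theta>) = torus d (\<lambda>j. - \<theta> j)"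
  by (simp add: torus_def adj_cdiag cis_cnj)

lemma det_cdiag: "det (cdiag d a) = (\<Prod>j<d. a j)"
proof -
  have "det (cdiag d a) = prod_list (diag_mat (cdiag d a))"
    by (rule det_upper_triangular[of _ d]) (auto simp: cdiag_def)
  also have "diag_mat (cdiag d a) = map a [0..<d]"
    by (auto simp: diag_mat_def cdiag_def)
  finally show ?thesis by (simp add: prod.list_conv_set_nth atLeast0LessThan)
qed

lemma prod_cis: "finite A \<Longrightarrow> (\<Prod>j\<in>A. cis (\<theta> j)) = cis (\<Sum>j\<in>A. \<theta> j)"
  by (induction A rule: finite_induct) (auto simp: cis_mult)

lemma torus_SU:
  assumes "(\<Sum>j<d. \<theta> j) = 0"
  shows "torus d \<theta> \<in> SU d"
proof -
  have "adj (torus d \<theta>) * torus d \<theta> = 1\<^sub>m d"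
    unfolding adj_torus using torus_add[of d "\<lambda>j. - \<theta> j" \<theta>] torus_zero by simp
  moreover have "det (torus d \<theta>) = 1"
    using assms by (simp add: torus_def det_cdiag prod_cis)
  ultimately show ?thesis by (simp add: SU_def)
qed

lemma SU_mult:
  assumes "U \<in> SU d" "W \<in> SU d"
  shows "U * W \<in> SU d"
proof -
  have c: "U \<in> carrier_mat d d" "W \<in> carrier_mat d d" "adj U \<in> carrier_mat d d" "adj W \<in> carrier_mat d d"
    using assms by (auto simp: SU_def)
  have "adj U * (U * W) = (adj U * U) * W" by (rule assoc_mult_mat[OF c(3,1,2), symmetric])
  also have "\<dots> = W" using assms c by (simp add: SU_def)
  finally have "adj (U * W) * (U * W) = adj W * W"
    unfolding adj_mult[OF c(1,2)] assoc_mult_mat[OF c(4,3) mult_carrier_mat[OF c(1,2)]] by simp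
  then have "adj (U * W) * (U * W) = 1\<^sub>m d" using assms by (simp add: SU_def)
  moreover have "det (U * W) = 1" using assms c det_mult[OF c(1,2)] by (simp add: SU_def)
  ultimately show ?thesis using c by (simp add: SU_def)
qed

lemma SU_adj:
  assumes "U \<in> SU d"
  shows "adj U \<in> SU d" "U * adj U = 1\<^sub>m d"
proof -
  have c: "U \<in> carrier_mat d d" "adj U \<in> carrier_mat d d" and 1: "adj U * U = 1\<^sub>m d" and det: "det U = 1"
    using assms by (auto simp: SU_def)
  show 2: "U * adj U = 1\<^sub>m d" by (rule mat_mult_left_right_inverse[OF c(2,1) 1])
  have "det (adj U) = 1" using arg_cong[OF 2, of det] det_mult[OF c] det by simp
  then show "adj U \<in> SU d" using c 2 by (simp add: SU_def)
qed

lemma sum_coroot: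
  assumes "a < d" "b < d" "a \<noteq> b"
  shows "(\<Sum>j<d. f j * coroot a b t j) = (f a - f b) * t"
proof -
  have "(\<Sum>j<d. f j * coroot a b t j) = (\<Sum>j\<in>{a,b}. f j * coroot a b t j)"
    using assms by (intro sum.mono_neutral_right) (auto simp: coroot_def)
  then show ?thesis using assms by (simp add: coroot_def left_diff_distrib)
qed

lemma sum_coroot_zero:
  "a < d \<Longrightarrow> b < d \<Longrightarrow> a \<noteq> b \<Longrightarrow> (\<Sum>j<d. coroot a b t j) = 0"
  using sum_coroot[of a d b "\<lambda>_. 1" t] by simp

lemma emb2_carrier [simp]: "emb2 d a b \<alpha> \<beta> \<gamma> \<delta> \<in> carrier_mat d d"
  by (simp add: emb2_def)

lemma emb2_zero:
  assumes "i < d" "k < d" "i \<noteq> k" "\<not> ((i = a \<or> i = b) \<and> (k = a \<or> k = b))"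
  shows "emb2 d a b x y u v $$ (i,k) = 0"
  using assms unfolding emb2_def by simp presburger

lemma emb2_mult:
  assumes ab: "a < d" "b < d" "a \<noteq> b"
  shows "emb2 d a b \<alpha> \<beta> \<gamma> \<delta> * emb2 d a b \<alpha>' \<beta>' \<gamma>' \<delta>' =
    emb2 d a b (\<alpha> * \<alpha>' + \<beta> * \<gamma>') (\<alpha> * \<beta>' + \<beta> * \<delta>') (\<gamma> * \<alpha>' + \<delta> * \<gamma>') (\<gamma> * \<beta>' + \<delta> * \<delta>')"
    (is "?A * ?B = ?C")
proof (rule eq_matI)
  fix i j assume "i < dim_row ?C" "j < dim_col ?C"
  then have ij: "i < d" "j < d" by (auto simp: emb2_def)
  have e: "(?A * ?B) $$ (i,j) = (\<Sum>k<d. ?A $$ (i,k) * ?B $$ (k,j))"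
    by (rule mat_mult_entry[OF emb2_carrier emb2_carrier ij])
  show "(?A * ?B) $$ (i,j) = ?C $$ (i,j)"
  proof (cases "i = a \<or> i = b")
    case True
    have "(\<Sum>k<d. ?A $$ (i,k) * ?B $$ (k,j)) = (\<Sum>k\<in>{a,b}. ?A $$ (i,k) * ?B $$ (k,j))"
    proof (rule sum.mono_neutral_right)
      show "\<forall>k\<in>{..<d} - {a,b}. ?A $$ (i,k) * ?B $$ (k,j) = 0"
      proof
        fix k assume k: "k \<in> {..<d} - {a,b}"
        then have "?A $$ (i,k) = 0" using True ij by (intro emb2_zero) auto
        then show "?A $$ (i,k) * ?B $$ (k,j) = 0" by simp
      qed
    qed (use ab in auto)
    also have "\<dots> = ?A $$ (i,a) * ?B $$ (a,j) + ?A $$ (i,b) * ?B $$ (b,j)" using ab by simp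
    also have "\<dots> = ?C $$ (i,j)"
    proof -
      consider "j = a" | "j = b" | "j \<noteq> a" "j \<noteq> b" by blast
      then show ?thesis using True ij ab unfolding emb2_def by cases (elim disjE; simp)+
    qed
    finally show ?thesis unfolding e .
  next
    case False
    have "(\<Sum>k<d. ?A $$ (i,k) * ?B $$ (k,j)) = (\<Sum>k\<in>{i}. ?A $$ (i,k) * ?B $$ (k,j))"
    proof (rule sum.mono_neutral_right)
      show "\<forall>k\<in>{..<d} - {i}. ?A $$ (i,k) * ?B $$ (k,j) = 0"
      proof
        fix k assume k: "k \<in> {..<d} - {i}"
        then have "?A $$ (i,k) = 0" using False ij by (intro emb2_zero) auto
        then show "?A $$ (i,k) * ?B $$ (k,j) = 0" by simp
      qed
    qed (use ij in auto)
    then show ?thesis unfolding e using ij ab False by (simp add: emb2_def)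
  qed
qed (auto simp: emb2_def)

lemma emb2_one: "emb2 d a b 1 0 0 1 = 1\<^sub>m d"
proof (rule eq_matI)
  fix i j assume "i < dim_row (1\<^sub>m d)" "j < dim_col (1\<^sub>m d)"
  then show "emb2 d a b 1 0 0 1 $$ (i,j) = 1\<^sub>m d $$ (i,j)"
    by (cases "i = a"; cases "i = b"; cases "j = a"; cases "j = b"; simp add: emb2_def)
qed (simp_all add: emb2_def)

lemma adj_emb2: "adj (emb2 d a b \<alpha> \<beta> \<gamma> \<delta>) = emb2 d a b (cnj \<alpha>) (cnj \<gamma>) (cnj \<beta>) (cnj \<delta>)"
proof (rule eq_matI)
  let ?R = "emb2 d a b (cnj \<alpha>) (cnj \<gamma>) (cnj \<beta>) (cnj \<delta>)"
  fix i j assume "i < dim_row ?R" "j < dim_col ?R"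
  then have ij: "i < d" "j < d" by (simp_all add: emb2_def)
  show "adj (emb2 d a b \<alpha> \<beta> \<gamma> \<delta>) $$ (i,j) = ?R $$ (i,j)"
    unfolding adj_entry[OF emb2_carrier ij] using ij
    by (cases "i = a"; cases "i = b"; cases "j = a"; cases "j = b"; simp add: emb2_def)
qed (simp_all add: adj_def emb2_def)

lemma torus_coroot:
  assumes "a \<noteq> b"
  shows "torus d (coroot a b t) = emb2 d a b (cis t) 0 0 (cis (- t))"
proof (rule eq_matI)
  let ?R = "emb2 d a b (cis t) 0 0 (cis (- t))"
  fix i j assume "i < dim_row ?R" "j < dim_col ?R"
  then have ij: "i < d" "j < d" by (simp_all add: emb2_def)
  then show "torus d (coroot a b t) $$ (i,j) = ?R $$ (i,j)"
    using assms
    by (cases "i = a"; cases "i = b"; cases "j = a"; cases "j = b"; simp add: torus_def cdiag_def emb2_def coroot_def)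
qed (simp_all add: torus_def cdiag_def emb2_def)

text \<open>Its columns \<open>a\<close> and \<open>b\<close> are eigenvectors of all rotations in
  that plane, with phases chosen so that the determinant is 1. Through it, by \<open>rot_eq\<close>,
  rotations are conjugate to torus elements inside SU(d), and their images under a representation
  become explicit trigonometric sums.\<close>

definition root_frame :: "nat \<Rightarrow> nat \<Rightarrow> nat \<Rightarrow> complex mat" where
  "root_frame d a b = emb2 d a b (1 / sqrt 2) (- \<i> / sqrt 2) (- \<i> / sqrt 2) (1 / sqrt 2)"

lemma sqrt2_sq: "complex_of_real (sqrt 2) * complex_of_real (sqrt 2) = 2"
  unfolding of_real_mult[symmetric] by simp

lemma root_frame_SU:
  assumes ab: "a < d" "b < d" "a \<noteq> b"
  shows "root_frame d a b \<in> SU d"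
proof -
  obtain h where h: "h = complex_of_real (1 / sqrt 2)" by simp
  have hh: "h * h = 1 / 2" unfolding h of_real_mult[symmetric] by simp
  then have h0: "h \<noteq> 0" by auto
  let ?u = "(h - 1) / (- \<i> * h)"
  have "root_frame d a b = emb2 d a b h (- \<i> * h) (- \<i> * h) h"
    by (simp add: root_frame_def h)
  \<comment> \<open>A factorisation into three shears; each is an elementary row operation of
    determinant 1.\<close>
  also have "\<dots> = emb2 d a b 1 ?u 0 1 * emb2 d a b 1 0 (- \<i> * h) 1 * emb2 d a b 1 ?u 0 1"
  proof -
    have 1: "1 + ?u * (- \<i> * h) = h" using h0 by simp
    have "h * ?u + ?u = (h * h - 1) / (- \<i> * h)"
      by (simp only: times_divide_eq_right add_divide_distrib[symmetric]) (simp add: algebra_simps)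
    also have "\<dots> = (1 / 2) / (\<i> * h)" by (simp only: hh) (simp add: field_simps)
    also have "\<dots> = - \<i> * h" using hh h0 by (simp add: field_simps)
    finally have 2: "h * ?u + ?u = - \<i> * h" .
    have 3: "- \<i> * h * ?u + 1 = h" using h0 by simp
    show ?thesis unfolding emb2_mult[OF ab] using 1 2 3 by simp
  qed
  finally have eq: "root_frame d a b = emb2 d a b 1 ?u 0 1 * emb2 d a b 1 0 (- \<i> * h) 1 * emb2 d a b 1 ?u 0 1" .
  have up: "det (emb2 d a b 1 u 0 1) = 1" for u
  proof -
    have "emb2 d a b 1 u 0 1 = addrow_mat d u a b"
      using ab by (intro eq_matI) (auto simp: emb2_def addrow_mat_def)
    then show ?thesis using ab by (simp add: det_addrow_mat)
  qed
  have low: "det (emb2 d a b 1 0 u 1) = 1" for u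
  proof -
    have "emb2 d a b 1 0 u 1 = addrow_mat d u b a"
      using ab by (intro eq_matI) (auto simp: emb2_def addrow_mat_def)
    then show ?thesis using ab by (simp add: det_addrow_mat)
  qed
  have "det (root_frame d a b) = 1"
    unfolding eq by (simp only: det_mult[OF mult_carrier_mat[OF emb2_carrier emb2_carrier] emb2_carrier]
        det_mult[OF emb2_carrier emb2_carrier] up low mult_1)
  moreover have "adj (root_frame d a b) * root_frame d a b = 1\<^sub>m d"
    unfolding root_frame_def adj_emb2 emb2_mult[OF ab]
    by (simp add: sqrt2_sq flip: emb2_one[of d a b])
  ultimately show ?thesis by (simp add: SU_def root_frame_def)
qed

lemma rot_eq:
  assumes ab: "a < d" "b < d" "a \<noteq> b"
  shows "rot d a b t = root_frame d a b * torus d (coroot a b t) * adj (root_frame d a b)"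
proof -
  obtain h where h: "h = complex_of_real (1 / sqrt 2)" by simp
  have hh: "h * h = 1 / 2" unfolding h of_real_mult[symmetric] by simp
  have ch: "cnj h = h" unfolding h by simp
  have c: "cis t + cis (- t) = 2 * complex_of_real (cos t)" "cis t - cis (- t) = 2 * \<i> * complex_of_real (sin t)"
    by (simp_all add: complex_eq_iff)
  have "root_frame d a b = emb2 d a b h (- \<i> * h) (- \<i> * h) h" by (simp add: root_frame_def h)
  then have "root_frame d a b * torus d (coroot a b t) * adj (root_frame d a b)
    = emb2 d a b ((h * h) * (cis t + cis (- t))) (\<i> * (h * h) * (cis t - cis (- t)))
       (- \<i> * (h * h) * (cis t - cis (- t))) ((h * h) * (cis t + cis (- t)))"
    by (simp add: adj_emb2 torus_coroot[OF ab(3)] emb2_mult[OF ab] ch algebra_simps)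
  also have "\<dots> = rot d a b t" unfolding hh c rot_def by simp
  finally show ?thesis by simp
qed

lemma rot_SU:
  assumes ab: "a < d" "b < d" "a \<noteq> b"
  shows "rot d a b t \<in> SU d"
  unfolding rot_eq[OF ab]
  by (intro SU_mult root_frame_SU[OF ab] SU_adj torus_SU sum_coroot_zero[OF ab])

lemma torus_rot_commute:
  assumes "\<theta> a = \<theta> b"
  shows "torus d \<theta> * rot d a b t = rot d a b t * torus d \<theta>"
proof (rule eq_matI)
  have c: "rot d a b t \<in> carrier_mat d d" by (simp add: rot_def)
  fix i j assume "i < dim_row (rot d a b t * torus d \<theta>)" "j < dim_col (rot d a b t * torus d \<theta>)"
  then have ij: "i < d" "j < d" by (simp_all add: rot_def emb2_def torus_def cdiag_def)
  show "(torus d \<theta> * rot d a b t) $$ (i,j) = (rot d a b t * torus d \<theta>) $$ (i,j)"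
    unfolding torus_def cdiag_mult_entry[OF c ij] mult_cdiag_entry[OF c ij]
  proof (cases "i = j \<or> (i = a \<or> i = b) \<and> (j = a \<or> j = b)")
    case True
    then have "\<theta> i = \<theta> j" using assms by auto
    then show "cis (\<theta> i) * rot d a b t $$ (i,j) = rot d a b t $$ (i,j) * cis (\<theta> j)" by (simp only: mult.commute)
  next
    case False
    then have "rot d a b t $$ (i,j) = 0" unfolding rot_def using ij by (intro emb2_zero) auto
    then show "cis (\<theta> i) * rot d a b t $$ (i,j) = rot d a b t $$ (i,j) * cis (\<theta> j)" by simp
  qed
qed (simp_all add: rot_def emb2_def torus_def cdiag_def)

text \<open>The quarter turn represents the transposition of \<open>a\<close> and \<open>b\<close>
  in the Weyl group.\<close>

lemma torus_swap:
  assumes ab: "a < d" "b < d" "a \<noteq> b"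
  shows "torus d \<theta> * rot d a b (pi / 2) = rot d a b (pi / 2) * torus d (\<theta>(a := \<theta> b, b := \<theta> a))"
proof (rule eq_matI)
  let ?w = "rot d a b (pi / 2)" and ?\<theta> = "\<theta>(a := \<theta> b, b := \<theta> a)"
  have c: "?w \<in> carrier_mat d d" by (simp add: rot_def)
  fix i j assume "i < dim_row (?w * torus d ?\<theta>)" "j < dim_col (?w * torus d ?\<theta>)"
  then have ij: "i < d" "j < d" by (simp_all add: rot_def emb2_def torus_def cdiag_def)
  show "(torus d \<theta> * ?w) $$ (i,j) = (?w * torus d ?\<theta>) $$ (i,j)"
    unfolding torus_def cdiag_mult_entry[OF c ij] mult_cdiag_entry[OF c ij]
  proof (cases "?w $$ (i,j) = 0")
    case False
    have "i = j \<or> (i = a \<or> i = b) \<and> (j = a \<or> j = b)"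
    proof (rule ccontr)
      assume "\<not> ?thesis"
      then have "?w $$ (i,j) = 0" unfolding rot_def using ij by (intro emb2_zero) auto
      then show False using False by simp
    qed
    moreover have "?w $$ (a,a) = 0" "?w $$ (b,b) = 0" using ab by (simp_all add: rot_def emb2_def)
    ultimately have "i = j \<and> i \<noteq> a \<and> i \<noteq> b \<or> i = a \<and> j = b \<or> i = b \<and> j = a" using False by metis
    then have "\<theta> i = ?\<theta> j" using ab(3) by (elim disjE conjE) simp_all
    then show "cis (\<theta> i) * ?w $$ (i,j) = ?w $$ (i,j) * cis (?\<theta> j)" by (simp only: mult.commute)
  qed simp
qed (simp_all add: rot_def emb2_def torus_def cdiag_def)

text \<open>Multiplying out, the product on the left is \<open>[[\<alpha>, -\<beta>], [\<beta>, cnj \<alpha>]]\<close> with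
  \<open>\<alpha> = cos\<^sup>2 t - sin\<^sup>2 t cis (4 h)\<close> and the real number \<open>\<beta> = sin (2 t) cos (2 h)\<close>; such a
  matrix is a rotation by \<open>arcsin \<beta>\<close> between two torus elements with phase half the argument of \<open>\<alpha>\<close>.\<close>
lemma rot_conjugate_product:
  fixes h :: real
  defines "\<tau> \<equiv> \<lambda>t. arcsin (sin (2 * t) * cos (2 * h))"
  defines "\<eta> \<equiv> \<lambda>t. arctan (- ((sin t)\<^sup>2 * sin (4 * h)) / ((cos t)\<^sup>2 - (sin t)\<^sup>2 * cos (4 * h))) / 2"
  assumes ab: "a < d" "b < d" "a \<noteq> b" and pos: "0 < (cos t)\<^sup>2 - (sin t)\<^sup>2 * cos (4 * h)"
  shows "torus d (coroot a b h) * rot d a b t * torus d (coroot a b (- 2 * h)) * rot d a b t * torus d (coroot a b h)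
    = torus d (coroot a b (\<eta> t)) * rot d a b (\<tau> t) * torus d (coroot a b (\<eta> t))"
proof -
  define R where "R = (cos t)\<^sup>2 - (sin t)\<^sup>2 * cos (4 * h)"
  define J where "J = - ((sin t)\<^sup>2 * sin (4 * h))"
  define B where "B = sin (2 * t) * cos (2 * h)"
  have R: "0 < R" using pos by (simp add: R_def)
  have c4: "cos (4 * h) = 2 * (cos (2 * h))\<^sup>2 - 1" using cos_double_cos[of "2 * h"] by simp
  have "(cos (4 * h))\<^sup>2 + (sin (4 * h))\<^sup>2 = 1" by simp
  then have s4: "(sin (4 * h))\<^sup>2 = 1 - (cos (4 * h))\<^sup>2" by linarith
  have st: "(sin t)\<^sup>2 = 1 - (cos t)\<^sup>2" by (simp add: sin_squared_eq)
  \<comment> \<open>The first column of the product in the \<open>a\<close>-\<open>b\<close> plane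
    is (R + i J, B), and this is its normalisation; it makes \<open>B\<close> the sine of an angle
    whose cosine is the modulus of R + i J.\<close>
  have RJB: "R\<^sup>2 + J\<^sup>2 + B\<^sup>2 = 1"
  proof -
    have "J\<^sup>2 = ((sin t)\<^sup>2)\<^sup>2 * (1 - (cos (4 * h))\<^sup>2)" by (simp add: J_def power_mult_distrib s4)
    moreover have "B\<^sup>2 = 4 * (sin t)\<^sup>2 * (cos t)\<^sup>2 * (cos (2 * h))\<^sup>2"
      by (simp add: B_def sin_double power_mult_distrib)
    moreover have "(x - (1 - x) * (2 * y - 1))\<^sup>2 + (1 - x)\<^sup>2 * (1 - (2 * y - 1)\<^sup>2) + 4 * (1 - x) * x * y = 1"
      for x y :: real by (simp add: power2_eq_square algebra_simps)
    ultimately show ?thesis unfolding R_def c4 st by simp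
  qed
  have "B\<^sup>2 \<le> 1" using RJB zero_le_power2[of R] zero_le_power2[of J] by linarith
  then have Bb: "-1 \<le> B" "B \<le> 1" using abs_square_le_1[of B] by auto
  have sinB: "sin (\<tau> t) = B" unfolding \<tau>_def B_def[symmetric] using Bb by simp
  have cosB: "cos (\<tau> t) = sqrt (R\<^sup>2 + J\<^sup>2)"
    unfolding \<tau>_def B_def[symmetric] cos_arcsin[OF Bb] using RJB by (simp add: algebra_simps)
  have rr: "sqrt (R\<^sup>2 + J\<^sup>2) = R * sqrt (1 + (J / R)\<^sup>2)"
  proof -
    have "R\<^sup>2 + J\<^sup>2 = R\<^sup>2 * (1 + (J / R)\<^sup>2)" using R by (simp add: field_simps power2_eq_square)
    then show ?thesis using R by (simp add: real_sqrt_mult)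
  qed
  \<comment> \<open>Since \<open>R\<close> is positive, arctan (J / R) is the argument of R + i J;
    half of it goes to each of the two torus factors.\<close>
  have eta: "2 * \<eta> t = arctan (J / R)" by (simp add: \<eta>_def J_def R_def)
  have sp: "0 < sqrt (1 + (J / R)\<^sup>2)" by (simp add: add_pos_nonneg)
  have ce: "cos (2 * \<eta> t) * cos (\<tau> t) = R" unfolding eta cosB rr cos_arctan using sp by simp
  have se: "sin (2 * \<eta> t) * cos (\<tau> t) = J" unfolding eta cosB rr sin_arctan using sp R by simp
  have ce2: "((cos (\<eta> t))\<^sup>2 - (sin (\<eta> t))\<^sup>2) * cos (\<tau> t) = R" using ce by (simp add: cos_double)
  have se2: "(2 * sin (\<eta> t) * cos (\<eta> t)) * cos (\<tau> t) = J" using se by (simp add: sin_double)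
  have ce': "cis (\<eta> t) * cos (\<tau> t) * cis (\<eta> t) = Complex R J"
    using ce2 se2 by (simp add: complex_eq_iff power2_eq_square algebra_simps)
  have ce'': "cis (- \<eta> t) * cos (\<tau> t) * cis (- \<eta> t) = Complex R (- J)"
    using ce2 se2 by (simp add: complex_eq_iff power2_eq_square algebra_simps)
  define E E' where "E = cis h" and "E' = cis (- h)"
  have EE: "E * E' = 1" by (simp add: E_def E'_def cis_mult)
  have E2: "cis (2 * h) = E * E" "cis (- (2 * h)) = E' * E'" "cis (4 * h) = E * E * E * E" "cis (- (4 * h)) = E' * E' * E' * E'"
    by (simp_all add: E_def E'_def cis_mult)
  have cC: "2 * complex_of_real (cos (2 * h)) = E * E + E' * E'"
    unfolding E2[symmetric] by (simp add: complex_eq_iff)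
  let ?c = "complex_of_real (cos t)" and ?s = "complex_of_real (sin t)"
  have "Complex R J = ?c * ?c - ?s * ?s * cis (4 * h)" "Complex R (- J) = ?c * ?c - ?s * ?s * cis (- (4 * h))"
    by (simp_all add: complex_eq_iff R_def J_def power2_eq_square)
  then have RJ: "Complex R J = ?c * ?c - ?s * ?s * (E * E * E * E)"
    "Complex R (- J) = ?c * ?c - ?s * ?s * (E' * E' * E' * E')"
    by (simp_all only: E2)
  have BE: "complex_of_real B = ?s * ?c * (E * E + E' * E')"
    unfolding cC[symmetric] B_def sin_double by simp
  have pe: "E * (?c * (E' * E') * ?c - ?s * (E * E) * ?s) * E = Complex R J"
    "E' * (?c * (E * E) * ?c - ?s * (E' * E') * ?s) * E' = Complex R (- J)"
    "E * (?c * (E' * E') * ?s + ?s * (E * E) * ?c) * E' = complex_of_real B"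
    "E' * (?s * (E' * E') * ?c + ?c * (E * E) * ?s) * E = complex_of_real B"
  proof -
    have "E * (?c * (E' * E') * ?c - ?s * (E * E) * ?s) * E = (E * E') * (E * E') * (?c * ?c) - ?s * ?s * (E * E * E * E)"
      by (simp add: algebra_simps)
    then show "E * (?c * (E' * E') * ?c - ?s * (E * E) * ?s) * E = Complex R J" by (simp add: EE RJ)
    have "E' * (?c * (E * E) * ?c - ?s * (E' * E') * ?s) * E' = (E * E') * (E * E') * (?c * ?c) - ?s * ?s * (E' * E' * E' * E')"
      by (simp add: algebra_simps)
    then show "E' * (?c * (E * E) * ?c - ?s * (E' * E') * ?s) * E' = Complex R (- J)" by (simp add: EE RJ)
    have "E * (?c * (E' * E') * ?s + ?s * (E * E) * ?c) * E' = (E * E') * (?s * ?c * (E * E + E' * E'))"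
      by (simp add: algebra_simps)
    then show "E * (?c * (E' * E') * ?s + ?s * (E * E) * ?c) * E' = complex_of_real B" by (simp add: EE BE)
    have "E' * (?s * (E' * E') * ?c + ?c * (E * E) * ?s) * E = (E * E') * (?s * ?c * (E * E + E' * E'))"
      by (simp add: algebra_simps)
    then show "E' * (?s * (E' * E') * ?c + ?c * (E * E) * ?s) * E = complex_of_real B" by (simp add: EE BE)
  qed
  have q: "cis (\<eta> t) * cis (- \<eta> t) = 1" by (simp add: cis_mult)
  have pq: "cis (\<eta> t) * complex_of_real B * cis (- \<eta> t) = complex_of_real B"
    "cis (- \<eta> t) * complex_of_real B * cis (\<eta> t) = complex_of_real B"
  proof -
    have "cis (\<eta> t) * complex_of_real B * cis (- \<eta> t) = (cis (\<eta> t) * cis (- \<eta> t)) * complex_of_real B"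
      "cis (- \<eta> t) * complex_of_real B * cis (\<eta> t) = (cis (\<eta> t) * cis (- \<eta> t)) * complex_of_real B"
      by (simp_all only: mult_ac)
    then show "cis (\<eta> t) * complex_of_real B * cis (- \<eta> t) = complex_of_real B"
      "cis (- \<eta> t) * complex_of_real B * cis (\<eta> t) = complex_of_real B" unfolding q by simp_all
  qed
  have "torus d (coroot a b h) * rot d a b t * torus d (coroot a b (- 2 * h)) * rot d a b t * torus d (coroot a b h)
    = emb2 d a b (E * (?c * (E' * E') * ?c - ?s * (E * E) * ?s) * E)
       (- (E * (?c * (E' * E') * ?s + ?s * (E * E) * ?c) * E'))
       (E' * (?s * (E' * E') * ?c + ?c * (E * E) * ?s) * E)
       (E' * (?c * (E * E) * ?c - ?s * (E' * E') * ?s) * E')"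
    unfolding torus_coroot[OF ab(3)] rot_def emb2_mult[OF ab]
    by (simp add: E2 E2(1,2)[unfolded mult.commute[of 2 h]] E_def[symmetric] E'_def[symmetric] algebra_simps)
  also have "\<dots> = emb2 d a b (cis (\<eta> t) * cos (\<tau> t) * cis (\<eta> t)) (- (cis (\<eta> t) * complex_of_real B * cis (- \<eta> t)))
       (cis (- \<eta> t) * complex_of_real B * cis (\<eta> t)) (cis (- \<eta> t) * cos (\<tau> t) * cis (- \<eta> t))"
    unfolding pe pq ce' ce'' by simp
  also have "\<dots> = torus d (coroot a b (\<eta> t)) * rot d a b (\<tau> t) * torus d (coroot a b (\<eta> t))"
    unfolding torus_coroot[OF ab(3)] rot_def emb2_mult[OF ab] sinB by simp
  finally show ?thesis .
qed

section \<open>Diagonalising the image of the torus\<close>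

lemma cmod_cis_diff: "cmod (cis x - cis y) \<le> \<bar>x - y\<bar>"
proof (rule power2_le_imp_le)
  have "(cmod (cis x - cis y))\<^sup>2 = (cos x - cos y)\<^sup>2 + (sin x - sin y)\<^sup>2"
    by (simp add: cmod_power2)
  also have "\<dots> = ((cos x)\<^sup>2 + (sin x)\<^sup>2) + ((cos y)\<^sup>2 + (sin y)\<^sup>2) - 2 * (cos x * cos y + sin x * sin y)"
    by (simp add: power2_eq_square algebra_simps)
  also have "\<dots> = 2 - 2 * cos (x - y)" by (simp add: cos_diff)
  also have "\<dots> = 4 * (sin ((x - y) / 2))\<^sup>2"
  proof -
    have "2 * ((x - y) / 2) = x - y" by simp
    then have "cos (x - y) = 1 - 2 * (sin ((x - y) / 2))\<^sup>2"
      using cos_double_sin[of "(x - y) / 2"] by (simp only:)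
    then show ?thesis by simp
  qed
  also have "\<dots> \<le> 4 * (\<bar>(x - y) / 2\<bar>)\<^sup>2"
    using power_mono[OF abs_sin_x_le_abs_x[of "(x - y) / 2"], of 2] by simp
  also have "\<dots> = \<bar>x - y\<bar>\<^sup>2" by (simp add: power_divide)
  finally show "(cmod (cis x - cis y))\<^sup>2 \<le> \<bar>x - y\<bar>\<^sup>2" .
qed simp

lemma torus_entry_diff:
  assumes "p < d" "q < d" and \<theta>: "\<And>j. j < d \<Longrightarrow> \<bar>\<theta> j - \<eta> j\<bar> \<le> e" and "0 \<le> e"
  shows "cmod (torus d \<theta> $$ (p,q) - torus d \<eta> $$ (p,q)) \<le> e"
proof (cases "p = q")
  case True
  have "cmod (cis (\<theta> q) - cis (\<eta> q)) \<le> \<bar>\<theta> q - \<eta> q\<bar>" by (rule cmod_cis_diff)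
  then show ?thesis using assms(1,2) \<theta>[of q] True by (simp add: torus_def cdiag_def)
next
  case False
  then show ?thesis using assms by (simp add: torus_def cdiag_def)
qed

lemma one_SU: "1\<^sub>m d \<in> SU d"
  by (simp add: SU_def)

lemma rep_one:
  assumes "cont_unitary_rep d k \<rho>"
  shows "\<rho> (1\<^sub>m d) = 1\<^sub>m k"
proof -
  let ?A = "\<rho> (1\<^sub>m d)"
  have A: "?A \<in> carrier_mat k k" "adj ?A * ?A = 1\<^sub>m k"
    using assms one_SU unfolding cont_unitary_rep_def by blast+
  have "\<rho> (1\<^sub>m d * 1\<^sub>m d) = ?A * ?A" using assms one_SU unfolding cont_unitary_rep_def by blast
  then have "?A * ?A = ?A" by simp
  then have "adj ?A * (?A * ?A) = 1\<^sub>m k" using A by simp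
  moreover have "adj ?A * (?A * ?A) = ?A"
    using assoc_mult_mat[OF adj_carrier[OF A(1)] A(1) A(1)] A by simp
  ultimately show ?thesis by simp
qed

lemma rep_adj:
  assumes rep: "cont_unitary_rep d k \<rho>" and W: "W \<in> SU d"
  shows "\<rho> (adj W) = adj (\<rho> W)"
proof -
  have c: "\<rho> W \<in> carrier_mat k k" "\<rho> (adj W) \<in> carrier_mat k k" and u: "adj (\<rho> W) * \<rho> W = 1\<^sub>m k"
    using rep W SU_adj[OF W] unfolding cont_unitary_rep_def by blast+
  have "\<rho> (adj W) * \<rho> W = \<rho> (adj W * W)"
    using rep W SU_adj[OF W] unfolding cont_unitary_rep_def by metis
  also have "\<dots> = 1\<^sub>m k" using rep_one[OF rep] W by (simp add: SU_def)
  finally have 1: "\<rho> (adj W) * \<rho> W = 1\<^sub>m k" .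
  have 2: "\<rho> W * adj (\<rho> W) = 1\<^sub>m k"
    by (rule mat_mult_left_right_inverse[OF adj_carrier[OF c(1)] c(1) u])
  have "\<rho> (adj W) = \<rho> (adj W) * (\<rho> W * adj (\<rho> W))" using 2 c by simp
  also have "\<dots> = (\<rho> (adj W) * \<rho> W) * adj (\<rho> W)"
    by (rule assoc_mult_mat[OF c(2,1) adj_carrier[OF c(1)], symmetric])
  finally show ?thesis by (simp only: 1 left_mult_one_mat[OF adj_carrier[OF c(1)]])
qed

lemma coroot_add: "coroot a b (s + t) = (\<lambda>j. coroot a b s j + coroot a b t j)"
  by (simp add: coroot_def fun_eq_iff)

lemma coroot_minus: "coroot a b (- t) = (\<lambda>j. - coroot a b t j)"
  by (simp add: coroot_def fun_eq_iff)

lemma coroot_diff_le: "\<bar>coroot a b s j - coroot a b t j\<bar> \<le> \<bar>s - t\<bar>"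
  by (simp add: coroot_def abs_minus_commute)

text \<open>Angles of sum 0 are combinations of the coroots joining \<open>j\<close> to the last
  coordinate N = d - 1. Simultaneous diagonalisation handles a finite family, so each of these
  one-parameter groups is sampled at one small time \<open>t0\<close>;
  \<open>one_parameter_eigenvector\<close> then recovers the action at all times on the same
  eigenvectors.\<close>

theorem torus_weights:
  assumes rep: "cont_unitary_rep d k \<rho>" and d: "1 \<le> d"
  shows "\<exists>Q \<mu>. Q \<in> carrier_mat k k \<and> adj Q * Q = 1\<^sub>m k \<and> Q * adj Q = 1\<^sub>m k \<and>
    (\<forall>l. \<forall>j\<ge>d. \<mu> l j = (0::real)) \<and> (\<forall>l. \<forall>a<d. \<forall>b<d. \<mu> l a - \<mu> l b \<in> \<int>) \<and> (\<forall>l. (\<Sum>j<d. \<mu> l j) = 0) \<and>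
    (\<forall>\<theta>. (\<Sum>j<d. \<theta> j) = 0 \<longrightarrow> \<rho> (torus d \<theta>) = Q * cdiag k (\<lambda>l. cis (\<Sum>j<d. \<mu> l j * \<theta> j)) * adj Q)"
proof -
  define N where "N = d - 1"
  have dN: "d = Suc N" using d by (simp add: N_def)
  have SUc: "torus d (coroot j N t) \<in> SU d" if "j < N" for j t
    using that dN by (intro torus_SU sum_coroot_zero) auto
  have carr: "\<rho> W \<in> carrier_mat k k" "adj (\<rho> W) * \<rho> W = 1\<^sub>m k" if "W \<in> SU d" for W
    using rep that unfolding cont_unitary_rep_def by blast+
  have mult: "\<rho> (W * W') = \<rho> W * \<rho> W'" if "W \<in> SU d" "W' \<in> SU d" for W W'
    using rep that unfolding cont_unitary_rep_def by blast
  have cont: "\<exists>\<delta>>0. \<forall>W \<in> SU d. (\<forall>j<d. \<forall>l<d. cmod (W $$ (j,l) - W' $$ (j,l)) < \<delta>) \<longrightarrow>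
        (\<forall>j<k. \<forall>l<k. cmod (\<rho> W $$ (j,l) - \<rho> W' $$ (j,l)) < e)" if "W' \<in> SU d" "0 < e" for W' e
    using rep that unfolding cont_unitary_rep_def by blast
  define U where "U j t = \<rho> (torus d (coroot j N t))" for j t
  have close: "\<exists>\<delta>>0. \<forall>s. \<bar>s - t\<bar> < \<delta> \<longrightarrow> (\<forall>p<k. \<forall>q<k. cmod (U j s $$ (p,q) - U j t $$ (p,q)) < e)"
    if j: "j < N" and e: "0 < e" for j t e
  proof -
    obtain \<delta> where \<delta>: "0 < \<delta>" and *: "\<forall>W \<in> SU d. (\<forall>p<d. \<forall>q<d. cmod (W $$ (p,q) - torus d (coroot j N t) $$ (p,q)) < \<delta>) \<longrightarrow>
        (\<forall>p<k. \<forall>q<k. cmod (\<rho> W $$ (p,q) - U j t $$ (p,q)) < e)"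
      using cont[OF SUc[OF j] e, of t] unfolding U_def by blast
    have "\<forall>p<k. \<forall>q<k. cmod (U j s $$ (p,q) - U j t $$ (p,q)) < e" if s: "\<bar>s - t\<bar> < \<delta>" for s
    proof -
      have "cmod (torus d (coroot j N s) $$ (p,q) - torus d (coroot j N t) $$ (p,q)) < \<delta>" if "p < d" "q < d" for p q
      proof -
        have "cmod (torus d (coroot j N s) $$ (p,q) - torus d (coroot j N t) $$ (p,q)) \<le> \<bar>s - t\<bar>"
          by (rule torus_entry_diff[OF that coroot_diff_le]) simp
        then show ?thesis using s by linarith
      qed
      then show ?thesis using *[rule_format, OF SUc[OF j, of s]] unfolding U_def by blast
    qed
    then show ?thesis using \<delta> by blast
  qed
  obtain \<delta> where \<delta>: "0 < \<delta>" and near: "\<forall>W \<in> SU d. (\<forall>p<d. \<forall>q<d. cmod (W $$ (p,q) - 1\<^sub>m d $$ (p,q)) < \<delta>) \<longrightarrow>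
        (\<forall>p<k. \<forall>q<k. cmod (\<rho> W $$ (p,q) - \<rho> (1\<^sub>m d) $$ (p,q)) < 1 / real (Suc k))"
    using cont[OF one_SU, of "1 / real (Suc k)"] by (auto simp del: of_nat_Suc)
  define t0 where "t0 = \<delta> / 2"
  have t0: "0 < t0" using \<delta> by (simp add: t0_def)
  have U0: "torus d (coroot j N 0) = 1\<^sub>m d" for j
    using torus_cong[of d "coroot j N 0" "\<lambda>_. 0"] by (simp add: coroot_def torus_zero)
  have near_U: "cmod (U j t $$ (r,s) - 1\<^sub>m k $$ (r,s)) < 1 / real (Suc k)"
    if j: "j < N" and t: "\<bar>t\<bar> \<le> t0" and rs: "r < k" "s < k" for j t r s
  proof -
    have "cmod (torus d (coroot j N t) $$ (p,q) - 1\<^sub>m d $$ (p,q)) < \<delta>" if "p < d" "q < d" for p q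
    proof -
      have "cmod (torus d (coroot j N t) $$ (p,q) - torus d (coroot j N 0) $$ (p,q)) \<le> \<bar>t - 0\<bar>"
        by (rule torus_entry_diff[OF that coroot_diff_le]) simp
      then show ?thesis using t \<delta> by (simp only: U0) (simp add: t0_def)
    qed
    then have "cmod (\<rho> (torus d (coroot j N t)) $$ (r,s) - \<rho> (1\<^sub>m d) $$ (r,s)) < 1 / real (Suc k)"
      using near[rule_format, OF SUc[OF j, of t]] rs by blast
    then show ?thesis by (simp only: U_def rep_one[OF rep])
  qed
  have U_adj: "adj (U j t) = U j (- t)" if "j < N" for j t
    unfolding U_def rep_adj[OF rep SUc[OF that], symmetric] adj_torus coroot_minus ..
  have U_comm: "U i s * U j t = U j t * U i s" if "i < N" "j < N" for i j s t
  proof -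
    have "U i s * U j t = \<rho> (torus d (\<lambda>x. coroot i N s x + coroot j N t x))"
      by (simp only: U_def torus_add mult[OF SUc[OF that(1)] SUc[OF that(2)]])
    also have "\<dots> = \<rho> (torus d (\<lambda>x. coroot j N t x + coroot i N s x))" by (simp only: add.commute)
    also have "\<dots> = U j t * U i s"
      by (simp only: U_def torus_add mult[OF SUc[OF that(2)] SUc[OF that(1)]])
    finally show ?thesis .
  qed
  \<comment> \<open>The times - t0 close the family under adjoints.\<close>
  define As where "As = map (\<lambda>j. U j t0) [0..<N] @ map (\<lambda>j. U j (- t0)) [0..<N]"
  have As: "A \<in> set As \<longleftrightarrow> (\<exists>j<N. A = U j t0 \<or> A = U j (- t0))" for A
    by (auto simp: As_def)
  have "\<forall>A\<in>set As. A \<in> carrier_mat k k" using carr(1) SUc by (auto simp: As U_def)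
  moreover have "\<forall>A\<in>set As. \<forall>B\<in>set As. A * B = B * A"
  proof (intro ballI)
    fix A B assume "A \<in> set As" "B \<in> set As"
    then obtain i j s t where "i < N" "j < N" "A = U i s" "B = U j t" unfolding As by blast
    then show "A * B = B * A" using U_comm by simp
  qed
  moreover have "\<forall>A\<in>set As. adj A \<in> set As"
  proof
    fix A assume "A \<in> set As"
    then obtain j where j: "j < N" and A: "A = U j t0 \<or> A = U j (- t0)" using As by blast
    from A have "adj A = U j (- t0) \<or> adj A = U j t0"
      by (elim disjE) (simp_all only: U_adj[OF j] minus_minus simp_thms)
    then show "adj A \<in> set As" using As j by blast
  qed
  ultimately obtain Q where Q: "Q \<in> carrier_mat k k" "adj Q * Q = 1\<^sub>m k" "Q * adj Q = 1\<^sub>m k"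
    and diag: "\<forall>A\<in>set As. \<exists>a. A = Q * cdiag k a * adj Q"
    using simultaneous_diagonalization[of As k] by blast
  have col: "col Q l \<in> carrier_vec k" for l using Q(1) by auto
  have "\<exists>c :: int. \<forall>t. U j t *\<^sub>v col Q l = cis (of_int c * t) \<cdot>\<^sub>v col Q l" if j: "j < N" and l: "l < k" for j l
  proof -
    obtain a where a: "U j t0 = Q * cdiag k a * adj Q" using diag j As by blast
    have "U j t0 *\<^sub>v col Q l = a l \<cdot>\<^sub>v col Q l"
    proof (rule eq_vecI)
      fix i assume "i < dim_vec (a l \<cdot>\<^sub>v col Q l)"
      then have "i < k" using Q(1) by simp
      then show "(U j t0 *\<^sub>v col Q l) $ i = (a l \<cdot>\<^sub>v col Q l) $ i"
        unfolding a conj_cdiag_eigenvector[OF Q(1,2) \<open>i < k\<close> l] using Q(1) l by simp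
    qed (use Q(1) in \<open>simp add: a\<close>)
    moreover have "col Q l \<noteq> 0\<^sub>v k"
    proof
      assume 0: "col Q l = 0\<^sub>v k"
      have "Q $$ (i,l) = 0" if "i < k" for i
        using arg_cong[OF 0, of "\<lambda>v. v $ i"] that l Q(1) by simp
      then show False using isometry_cols[OF Q(1,2) l l] by simp
    qed
    ultimately show ?thesis
    proof (intro one_parameter_eigenvector[where U = "U j", OF _ _ _ _ _ t0 near_U[OF j] col])
      show "U j t \<in> carrier_mat k k" "adj (U j t) * U j t = 1\<^sub>m k" for t
        unfolding U_def using carr SUc[OF j] by auto
      show "U j (s + t) = U j s * U j t" for s t
        unfolding U_def coroot_add torus_add by (rule mult[OF SUc[OF j] SUc[OF j]])
      have "torus d (coroot j N (2 * pi)) = 1\<^sub>m d"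
        unfolding torus_def cdiag_one[symmetric] coroot_def
        by (intro arg_cong[of _ _ "cdiag d"]) (auto simp: fun_eq_iff simp flip: cis_cnj)
      then show "U j (2 * pi) = 1\<^sub>m k" unfolding U_def by (simp only: rep_one[OF rep])
      show "isCont (\<lambda>t. U j t $$ (r,s)) t" if "r < k" "s < k" for r s t
      proof -
        have "\<exists>\<delta>>0. \<forall>x. dist x t < \<delta> \<longrightarrow> dist (U j x $$ (r,s)) (U j t $$ (r,s)) < e" if "0 < e" for e
          using close[OF j that, of t] \<open>r < k\<close> \<open>s < k\<close> unfolding dist_norm real_norm_def by blast
        then show ?thesis unfolding isCont_def LIM_def by blast
      qed
    qed
  qed
  then obtain c :: "nat \<Rightarrow> nat \<Rightarrow> int" where
    c: "\<And>j l t. j < N \<Longrightarrow> l < k \<Longrightarrow> U j t *\<^sub>v col Q l = cis (of_int (c j l) * t) \<cdot>\<^sub>v col Q l"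
    by metis
  have Ud: "U j t = Q * cdiag k (\<lambda>l. cis (of_int (c j l) * t)) * adj Q" if "j < N" for j t
    by (rule conj_cdiag_of_eigenvectors[OF _ Q(1,3) c[OF that]]) (use carr(1) SUc[OF that] in \<open>simp_all add: U_def\<close>)
  \<comment> \<open>Induction on the number of prescribed angles; the coordinate \<open>N\<close>
    absorbs their sum, so every intermediate element stays in SU(d).\<close>
  have partial: "\<rho> (torus d (\<lambda>j. if j < m then \<theta> j else if j = N then - (\<Sum>i<m. \<theta> i) else 0))
      = Q * cdiag k (\<lambda>l. cis (\<Sum>j<m. of_int (c j l) * \<theta> j)) * adj Q" if "m \<le> N" for m and \<theta> :: "nat \<Rightarrow> real"
    using that
  proof (induction m)
    case 0
    have "torus d (\<lambda>j. if j < 0 then \<theta> j else if j = N then - (\<Sum>i<0. \<theta> i) else 0) = 1\<^sub>m d"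
      unfolding torus_zero[symmetric] by (intro torus_cong) simp
    then show ?case using Q by (simp add: rep_one[OF rep] cdiag_one)
  next
    case (Suc m)
    let ?\<theta> = "\<lambda>m j. if j < m then \<theta> j else if j = N then - (\<Sum>i<m. \<theta> i) else 0"
    have mN: "m < N" using Suc.prems by simp
    have SUm: "torus d (?\<theta> m) \<in> SU d"
    proof (rule torus_SU)
      have "(\<Sum>j<d. ?\<theta> m j) = (\<Sum>j<N. if j < m then \<theta> j else 0) - (\<Sum>i<m. \<theta> i)"
        unfolding dN using mN by (auto intro!: sum.cong)
      also have "(\<Sum>j<N. if j < m then \<theta> j else 0) = (\<Sum>j<m. \<theta> j)"
        using mN by (intro sum.mono_neutral_cong_right) auto
      finally show "(\<Sum>j<d. ?\<theta> m j) = 0" by simp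
    qed
    have "torus d (?\<theta> (Suc m)) = torus d (\<lambda>j. ?\<theta> m j + coroot m N (\<theta> m) j)"
      using mN by (intro torus_cong) (auto simp: coroot_def less_Suc_eq)
    then have "\<rho> (torus d (?\<theta> (Suc m))) = \<rho> (torus d (?\<theta> m)) * U m (\<theta> m)"
      unfolding torus_add U_def by (simp only: mult[OF SUm SUc[OF mN]])
    also have "\<dots> = Q * (cdiag k (\<lambda>l. cis (\<Sum>j<m. of_int (c j l) * \<theta> j)) * cdiag k (\<lambda>l. cis (of_int (c m l) * \<theta> m))) * adj Q"
      unfolding Ud[OF mN] using Suc.IH mN
      by (simp only: less_imp_le mult_cancel_mid[OF Q(1,2) adj_carrier[OF Q(1)] cdiag_carrier cdiag_carrier])
    finally show ?case by (simp add: cdiag_mult cis_mult)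
  qed
  define c' where "c' l j = (if j < N then of_int (c j l) else (0::real))" for l j
  \<comment> \<open>Subtracting the mean changes neither the pairing with angles of sum 0 nor the
    differences of the entries, which remain integers.\<close>
  define \<mu> where "\<mu> l j = (if j < d then c' l j - (\<Sum>i<N. c' l i) / real d else 0)" for l j
  have "\<rho> (torus d \<theta>) = Q * cdiag k (\<lambda>l. cis (\<Sum>j<d. \<mu> l j * \<theta> j)) * adj Q" if \<theta>: "(\<Sum>j<d. \<theta> j) = 0" for \<theta>
  proof -
    have "torus d \<theta> = torus d (\<lambda>j. if j < N then \<theta> j else if j = N then - (\<Sum>i<N. \<theta> i) else 0)"
    proof (rule torus_cong)
      have "\<theta> N = - (\<Sum>i<N. \<theta> i)" using \<theta> unfolding dN by simp
      then show "\<theta> j = (if j < N then \<theta> j else if j = N then - (\<Sum>i<N. \<theta> i) else 0)" if "j < d" for j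
        using that dN by (cases "j = N") auto
    qed
    moreover have "(\<Sum>j<d. \<mu> l j * \<theta> j) = (\<Sum>j<N. of_int (c j l) * \<theta> j)" for l
    proof -
      have "(\<Sum>j<d. \<mu> l j * \<theta> j) = (\<Sum>j<d. c' l j * \<theta> j) - (\<Sum>i<N. c' l i) / real d * (\<Sum>j<d. \<theta> j)"
        by (simp add: \<mu>_def left_diff_distrib sum_subtractf sum_distrib_left)
      also have "\<dots> = (\<Sum>j<d. c' l j * \<theta> j)" using \<theta> by simp
      also have "\<dots> = (\<Sum>j<N. of_int (c j l) * \<theta> j)" unfolding dN by (simp add: c'_def)
      finally show ?thesis .
    qed
    ultimately show ?thesis using partial[OF order_refl, of \<theta>] by simp
  qed
  moreover have "(\<Sum>j<d. \<mu> l j) = 0" for l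
  proof -
    have "(\<Sum>j<d. \<mu> l j) = (\<Sum>j<d. c' l j) - real d * ((\<Sum>i<N. c' l i) / real d)"
      by (simp add: \<mu>_def sum_subtractf)
    also have "(\<Sum>j<d. c' l j) = (\<Sum>i<N. c' l i)" unfolding dN by (simp add: c'_def)
    finally show ?thesis using d by simp
  qed
  moreover have "\<mu> l a - \<mu> l b \<in> \<int>" if "a < d" "b < d" for l a b
    using that by (simp add: \<mu>_def c'_def)
  moreover have "\<mu> l j = 0" if "d \<le> j" for l j using that by (simp add: \<mu>_def)
  ultimately show ?thesis using Q by (intro exI[of _ Q] exI[of _ \<mu>]) blast
qed

section \<open>Weyl group and root strings acting on weights\<close>

lemma sum_split_pair:
  fixes g :: "nat \<Rightarrow> real"
  assumes "a < d" "b < d" "a \<noteq> b"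
  shows "(\<Sum>j<d. g j) = (\<Sum>j\<in>{..<d} - {a,b}. g j) + (g a + g b)"
  using sum.subset_diff[of "{a,b}" "{..<d}" g] assms by simp

lemma has_vector_derivative_cis:
  assumes "(f has_real_derivative D) (at x)"
  shows "((\<lambda>t. cis (c * f t)) has_vector_derivative cis (c * f x) * (\<i> * complex_of_real (c * D))) (at x)"
  unfolding has_vector_derivative_complex_iff
  using assms by (auto intro!: derivative_eq_intros simp: algebra_simps)

lemma has_vector_derivative_eventually_eq:
  fixes f g :: "real \<Rightarrow> complex"
  assumes ev: "eventually (\<lambda>t. f t = g t) (nhds x)"
    and "(f has_vector_derivative u) (at x)" "(g has_vector_derivative v) (at x)"
  shows "u = v"
proof -
  have e: "eventually (\<lambda>t. Re (f t) = Re (g t)) (nhds x)" "eventually (\<lambda>t. Im (f t) = Im (g t)) (nhds x)"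
    using ev by (auto elim: eventually_mono)
  have "((\<lambda>t. Re (f t)) has_field_derivative Re v) (at x)" "((\<lambda>t. Im (f t)) has_field_derivative Im v) (at x)"
    using assms(3) DERIV_cong_ev[OF refl e(1) refl] DERIV_cong_ev[OF refl e(2) refl]
    unfolding has_vector_derivative_complex_iff by simp_all
  then have "Re u = Re v" "Im u = Im v"
    using assms(2) unfolding has_vector_derivative_complex_iff by (auto dest: DERIV_unique)
  then show ?thesis by (simp add: complex_eq_iff)
qed

text \<open>For h (|x| + 2) = pi both h |x| and 2 h lie in [0, pi], where the cosine is
  injective.\<close>

lemma abs_eq_2_if_cos_eq:
  fixes x :: real
  assumes "\<And>h. cos (h * x) = cos (2 * h)"
  shows "\<bar>x\<bar> = 2"
proof -
  obtain h where h: "h = pi / (\<bar>x\<bar> + 2)" by simp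
  have h0: "0 < h" unfolding h by (intro divide_pos_pos) auto
  have "h * (\<bar>x\<bar> + 2) = pi" unfolding h by (simp add: add_nonneg_eq_0_iff)
  then have hp: "h * \<bar>x\<bar> + 2 * h = pi" by (simp only: distrib_left mult.commute)
  have hx: "0 \<le> h * \<bar>x\<bar>" using h0 by simp
  have "cos (h * \<bar>x\<bar>) = cos (h * x)"
  proof (cases "0 \<le> x")
    case False
    then have "h * \<bar>x\<bar> = - (h * x)" by simp
    then show ?thesis by (simp only: cos_minus)
  qed simp
  then have c: "cos (h * \<bar>x\<bar>) = cos (2 * h)" by (rule trans) (rule assms)
  have "h * \<bar>x\<bar> \<le> pi" "0 \<le> 2 * h" "2 * h \<le> pi" using hp hx h0 by linarith+
  then have "h * \<bar>x\<bar> = 2 * h" by (intro cos_inj_pi[OF hx _ _ _ c])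
  then show ?thesis using h0 by (simp only: mult.commute[of 2] mult_cancel_left) simp
qed

text \<open>Since the angles add up to \<open>0\<close>, a weight is only determined modulo constants; it is normalised to have
  sum \<open>0\<close>, so that only the differences of its entries are integers.\<close>
locale weight_rep =
  fixes d k :: nat and \<sigma> :: "complex mat \<Rightarrow> complex mat" and \<mu> :: "nat \<Rightarrow> nat \<Rightarrow> real"
  assumes carr: "W \<in> SU d \<Longrightarrow> \<sigma> W \<in> carrier_mat k k"
    and mult: "W \<in> SU d \<Longrightarrow> W' \<in> SU d \<Longrightarrow> \<sigma> (W * W') = \<sigma> W * \<sigma> W'"
    and torus: "(\<Sum>j<d. \<theta> j) = 0 \<Longrightarrow> \<sigma> (torus d \<theta>) = cdiag k (\<lambda>l. cis (\<Sum>j<d. \<mu> l j * \<theta> j))"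
    and support: "d \<le> j \<Longrightarrow> \<mu> l j = 0"
    and sum0: "(\<Sum>j<d. \<mu> l j) = 0"
    and integral: "a < d \<Longrightarrow> b < d \<Longrightarrow> \<mu> l a - \<mu> l b \<in> \<int>"
begin

lemma sigma_one: "\<sigma> (1\<^sub>m d) = 1\<^sub>m k"
  using torus[of "\<lambda>_. 0"] by (simp add: torus_zero cdiag_one)

lemma sigma_adj:
  assumes "W \<in> SU d"
  shows "\<sigma> W * \<sigma> (adj W) = 1\<^sub>m k" "\<sigma> (adj W) * \<sigma> W = 1\<^sub>m k"
  using mult[OF assms SU_adj(1)[OF assms]] mult[OF SU_adj(1)[OF assms] assms] SU_adj(2)[OF assms] assms
  by (simp_all add: sigma_one SU_def)

text \<open>A single value of a character determines the pairing only modulo 2 pi; agreement along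
  the whole ray s \<theta> removes this ambiguity.\<close>

lemma weight_orthogonal:
  assumes "\<And>s. cis (\<Sum>j<d. \<mu> l j * (s * \<theta> j)) = cis (\<Sum>j<d. \<mu>' j * (s * \<theta> j))"
  shows "(\<Sum>j<d. (\<mu> l j - \<mu>' j) * \<theta> j) = 0"
proof (rule cis_eq_1_all)
  fix s
  have "s * (\<Sum>j<d. (\<mu> l j - \<mu>' j) * \<theta> j) = (\<Sum>j<d. \<mu> l j * (s * \<theta> j)) - (\<Sum>j<d. \<mu>' j * (s * \<theta> j))"
    by (simp add: sum_distrib_left left_diff_distrib right_diff_distrib sum_subtractf mult_ac)
  then show "cis (s * (\<Sum>j<d. (\<mu> l j - \<mu>' j) * \<theta> j)) = 1"
    using assms[of s] by (simp add: cis_divide[symmetric])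
qed

text \<open>By \<open>torus_swap\<close>, a nonzero matrix entry forces the characters of
  \<open>\<mu> l'\<close> and of the transposed \<open>\<mu> l\<close> to agree on the torus. The
  difference of the two weights has sum 0, so it may itself be taken as the angles, and then its
  squared norm vanishes.\<close>

lemma swap_weight:
  assumes ab: "a < d" "b < d" "a \<noteq> b" and l: "l' < k" "l < k" and ne: "\<sigma> (rot d a b (pi / 2)) $$ (l',l) \<noteq> 0"
  shows "\<mu> l' = (\<mu> l)(a := \<mu> l b, b := \<mu> l a)"
proof -
  let ?w = "rot d a b (pi / 2)" and ?\<nu> = "(\<mu> l)(a := \<mu> l b, b := \<mu> l a)"
  have w: "?w \<in> SU d" by (rule rot_SU[OF ab])
  have sum_swap: "(\<Sum>j<d. f j * (\<theta>(a := \<theta> b, b := \<theta> a)) j) = (\<Sum>j<d. (f(a := f b, b := f a)) j * \<theta> j)"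
    for f \<theta> :: "nat \<Rightarrow> real"
    using ab unfolding sum_split_pair[OF ab] by (simp add: algebra_simps)
  have eq: "cis (\<Sum>j<d. \<mu> l' j * \<theta> j) = cis (\<Sum>j<d. ?\<nu> j * \<theta> j)" if \<theta>: "(\<Sum>j<d. \<theta> j) = 0" for \<theta>
  proof -
    let ?\<theta> = "\<theta>(a := \<theta> b, b := \<theta> a)"
    have \<theta>': "(\<Sum>j<d. ?\<theta> j) = 0" using sum_swap[of "\<lambda>_. 1" \<theta>] \<theta> by (simp add: fun_upd_idem)
    have E: "\<sigma> (torus d \<theta>) * \<sigma> ?w = \<sigma> ?w * \<sigma> (torus d ?\<theta>)"
      unfolding mult[OF torus_SU[OF \<theta>] w, symmetric] mult[OF w torus_SU[OF \<theta>'], symmetric] torus_swap[OF ab] ..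
    have "cis (\<Sum>j<d. \<mu> l' j * \<theta> j) * \<sigma> ?w $$ (l',l) = \<sigma> ?w $$ (l',l) * cis (\<Sum>j<d. \<mu> l j * ?\<theta> j)"
      using arg_cong[OF E, of "\<lambda>M. M $$ (l',l)"]
      unfolding torus[OF \<theta>] torus[OF \<theta>'] cdiag_mult_entry[OF carr[OF w] l] mult_cdiag_entry[OF carr[OF w] l]
      by assumption
    then show ?thesis using ne by (simp only: sum_swap mult.commute[of "cis _"] mult_cancel_left simp_thms)
  qed
  have nu0: "(\<Sum>j<d. ?\<nu> j) = 0" using sum_swap[of "\<mu> l" "\<lambda>_. 1"] sum0[of l] by (simp add: fun_upd_idem)
  let ?\<delta> = "\<lambda>j. \<mu> l' j - ?\<nu> j"
  have d0: "(\<Sum>j<d. ?\<delta> j) = 0" using sum0[of l'] nu0 by (simp only: sum_subtractf)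
  have "(\<Sum>j<d. ?\<delta> j * ?\<delta> j) = 0"
  proof (rule weight_orthogonal)
    fix s :: real
    have "(\<Sum>j<d. s * ?\<delta> j) = 0" using d0 by (simp only: sum_distrib_left[symmetric])
    then show "cis (\<Sum>j<d. \<mu> l' j * (s * ?\<delta> j)) = cis (\<Sum>j<d. ?\<nu> j * (s * ?\<delta> j))" by (rule eq)
  qed
  then have "\<forall>j\<in>{..<d}. ?\<delta> j * ?\<delta> j = 0" by (subst (asm) sum_nonneg_eq_0_iff) auto
  then have h1: "\<mu> l' j = ?\<nu> j" if "j < d" for j using that by simp
  have h2: "\<mu> l' j = ?\<nu> j" if "d \<le> j" for j using that ab support by simp
  show ?thesis
  proof
    fix j show "\<mu> l' j = ?\<nu> j" by (cases "j < d") (erule h1, rule h2, simp)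
  qed
qed

text \<open>The matrix entries of the image of a rotation (see \<open>sigma_rot\<close>), written so
  that the dependence on \<open>t\<close> is visibly analytic.\<close>

definition rotc :: "nat \<Rightarrow> nat \<Rightarrow> real \<Rightarrow> nat \<Rightarrow> nat \<Rightarrow> complex" where
  "rotc a b t l' l = (\<Sum>m<k. \<sigma> (root_frame d a b) $$ (l',m) * cis ((\<mu> m a - \<mu> m b) * t) * \<sigma> (adj (root_frame d a b)) $$ (m,l))"

text \<open>The derivative of \<open>rotc\<close> at t = 0; it stands for the image of the
  infinitesimal rotation, expressed through its eigenvectors and the integers
  \<open>\<mu> m a - \<mu> m b\<close>.\<close>

definition gen :: "nat \<Rightarrow> nat \<Rightarrow> nat \<Rightarrow> nat \<Rightarrow> complex" where
  "gen a b l' l = (\<Sum>m<k. \<sigma> (root_frame d a b) $$ (l',m) * (\<i> * complex_of_real (\<mu> m a - \<mu> m b)) * \<sigma> (adj (root_frame d a b)) $$ (m,l))"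

context
  fixes a b :: nat
  assumes ab: "a < d" "b < d" "a \<noteq> b"
begin

abbreviation "G \<equiv> \<sigma> (root_frame d a b)"
abbreviation "G' \<equiv> \<sigma> (adj (root_frame d a b))"

lemma frame_carrier: "G \<in> carrier_mat k k" "G' \<in> carrier_mat k k"
  using carr root_frame_SU[OF ab] SU_adj(1)[OF root_frame_SU[OF ab]] by auto

lemma sigma_coroot: "\<sigma> (torus d (coroot a b t)) = cdiag k (\<lambda>l. cis ((\<mu> l a - \<mu> l b) * t))"
  using torus[OF sum_coroot_zero[OF ab], of t] by (simp add: sum_coroot[OF ab])

lemma sigma_rot:
  assumes l: "l' < k" "l < k"
  shows "\<sigma> (rot d a b t) $$ (l',l) = rotc a b t l' l"
proof -
  note F = root_frame_SU[OF ab] and T = torus_SU[OF sum_coroot_zero[OF ab, of t]]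
  have "\<sigma> (rot d a b t) = G * \<sigma> (torus d (coroot a b t)) * G'"
    unfolding rot_eq[OF ab] mult[OF SU_mult[OF F T] SU_adj(1)[OF F]] mult[OF F T] ..
  also have "\<dots> $$ (l',l) = rotc a b t l' l"
    unfolding sigma_coroot rotc_def mat_mult_entry[OF mult_carrier_mat[OF frame_carrier(1) cdiag_carrier] frame_carrier(2) l]
    using l by (intro sum.cong refl) (simp only: lessThan_iff mult_cdiag_entry[OF frame_carrier(1)])
  finally show ?thesis .
qed

lemma frame_inverse:
  assumes "m < k" "m' < k"
  shows "(\<Sum>p<k. G $$ (m,p) * G' $$ (p,m')) = (if m = m' then 1 else 0)"
    "(\<Sum>p<k. G' $$ (m,p) * G $$ (p,m')) = (if m = m' then 1 else 0)"
  using mat_mult_entry[OF frame_carrier assms] mat_mult_entry[OF frame_carrier(2,1) assms]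
    sigma_adj[OF root_frame_SU[OF ab]] assms by simp_all

lemma rotc_zero: "l' < k \<Longrightarrow> l < k \<Longrightarrow> rotc a b 0 l' l = (if l' = l then 1 else 0)"
  by (simp add: rotc_def frame_inverse)

lemma rotc_deriv:
  assumes "(f has_real_derivative D) (at 0)" "f 0 = 0"
  shows "((\<lambda>t. rotc a b (f t) l' l) has_vector_derivative gen a b l' l * complex_of_real D) (at 0)"
proof -
  have "((\<lambda>t. cis (c * f t)) has_vector_derivative \<i> * complex_of_real (c * D)) (at 0)" for c
    using has_vector_derivative_cis[OF assms(1), of c] assms(2) by simp
  then have "((\<lambda>t. rotc a b (f t) l' l) has_vector_derivative
    (\<Sum>m<k. G $$ (l',m) * (\<i> * complex_of_real ((\<mu> m a - \<mu> m b) * D)) * G' $$ (m,l))) (at 0)"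
    unfolding rotc_def
    by (intro has_vector_derivative_sum has_vector_derivative_mult_right has_vector_derivative_mult_left)
  moreover have "(\<Sum>m<k. G $$ (l',m) * (\<i> * complex_of_real ((\<mu> m a - \<mu> m b) * D)) * G' $$ (m,l))
    = gen a b l' l * complex_of_real D"
    unfolding gen_def sum_distrib_right by (intro sum.cong refl) (simp add: mult_ac)
  ultimately show ?thesis by (simp only:)
qed

lemma sigma_torus_rot_torus:
  assumes l: "l' < k" "l < k"
  shows "\<sigma> (torus d (coroot a b x) * rot d a b t * torus d (coroot a b y)) $$ (l',l)
    = cis ((\<mu> l' a - \<mu> l' b) * x) * rotc a b t l' l * cis ((\<mu> l a - \<mu> l b) * y)"
proof -
  note D = torus_SU[OF sum_coroot_zero[OF ab]] and R = rot_SU[OF ab]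
  have c: "cdiag k (\<lambda>l. cis ((\<mu> l a - \<mu> l b) * x)) * \<sigma> (rot d a b t) \<in> carrier_mat k k"
    by (rule mult_carrier_mat[OF cdiag_carrier carr[OF R]])
  show ?thesis
    unfolding mult[OF SU_mult[OF D R] D] mult[OF D R] sigma_coroot
      mult_cdiag_entry[OF c l] cdiag_mult_entry[OF carr[OF R] l] sigma_rot[OF l] ..
qed

text \<open>This is the derivative of \<open>rot_conjugate_product\<close> at \<open>t = 0\<close>. It plays the role of the relation
  \<open>[H,[H,X]] = 4 X\<close> for the Lie algebra, which is not at hand since \<open>\<sigma>\<close> is only defined on the group.\<close>
lemma gen_conjugate:
  assumes l: "l' < k" "l < k"
  shows "gen a b l' l * complex_of_real (2 * cos (h * ((\<mu> l' a - \<mu> l' b) - (\<mu> l a - \<mu> l b))))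
    = gen a b l' l * complex_of_real (2 * cos (2 * h))"
proof -
  define n where "n m = \<mu> m a - \<mu> m b" for m
  define \<tau> where "\<tau> t = arcsin (sin (2 * t) * cos (2 * h))" for t
  define \<eta> where "\<eta> t = arctan (- ((sin t)\<^sup>2 * sin (4 * h)) / ((cos t)\<^sup>2 - (sin t)\<^sup>2 * cos (4 * h))) / 2" for t
  note D = torus_SU[OF sum_coroot_zero[OF ab]] and R = rot_SU[OF ab]
  let ?L = "\<lambda>t. (\<Sum>m<k. cis (n l' * h) * rotc a b t l' m * cis (n m * (- 2 * h)) * rotc a b t m l) * cis (n l * h)"
  let ?P = "\<lambda>t. cis (n l' * \<eta> t) * rotc a b (\<tau> t) l' l * cis (n l * \<eta> t)"
  have "?L t = ?P t" if pos: "0 < (cos t)\<^sup>2 - (sin t)\<^sup>2 * cos (4 * h)" for t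
  proof -
    let ?X = "torus d (coroot a b h) * rot d a b t * torus d (coroot a b (- 2 * h))"
    have X: "?X \<in> SU d" by (intro SU_mult D R)
    have Xe: "\<sigma> ?X $$ (l',m) = cis (n l' * h) * rotc a b t l' m * cis (n m * (- 2 * h))" if "m < k" for m
      unfolding n_def by (rule sigma_torus_rot_torus[OF l(1) that])
    have "\<sigma> (?X * rot d a b t * torus d (coroot a b h)) $$ (l',l) = ?L t"
      unfolding mult[OF SU_mult[OF X R] D] mult[OF X R] sigma_coroot
        mult_cdiag_entry[OF mult_carrier_mat[OF carr[OF X] carr[OF R]] l] mat_mult_entry[OF carr[OF X] carr[OF R] l]
      unfolding n_def[symmetric]
      by (intro arg_cong2[of _ _ _ _ "(*)"] sum.cong refl) (simp_all only: lessThan_iff Xe sigma_rot[OF _ l(2)])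
    moreover have "\<sigma> (torus d (coroot a b (\<eta> t)) * rot d a b (\<tau> t) * torus d (coroot a b (\<eta> t))) $$ (l',l) = ?P t"
      unfolding n_def by (rule sigma_torus_rot_torus[OF l])
    ultimately show ?thesis
      using rot_conjugate_product[OF ab pos] unfolding \<eta>_def \<tau>_def by (simp only:)
  qed
  moreover have "eventually (\<lambda>t. 0 < (cos t)\<^sup>2 - (sin t)\<^sup>2 * cos (4 * h)) (nhds 0)"
  proof -
    have "((\<lambda>t. (cos t)\<^sup>2 - (sin t)\<^sup>2 * cos (4 * h)) \<longlongrightarrow> (cos 0)\<^sup>2 - (sin 0)\<^sup>2 * cos (4 * h)) (nhds 0)"
      by (intro tendsto_intros filterlim_ident)
    then show ?thesis by (rule order_tendstoD) simp
  qed
  ultimately have ev: "eventually (\<lambda>t. ?L t = ?P t) (nhds 0)" by (auto elim: eventually_mono)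
  have r: "((\<lambda>t. rotc a b t p q) has_vector_derivative gen a b p q) (at 0)" for p q
    using rotc_deriv[OF DERIV_ident refl, of p q] by simp
  \<comment> \<open>The product rule differentiates one of the two rotations while the other is the
    identity at t = 0. The sum over \<open>m\<close> collapses, and the remaining phases are
    conjugate to each other, which produces twice a cosine.\<close>
  have "(?L has_vector_derivative
     (\<Sum>m<k. cis (n l' * h) * rotc a b 0 l' m * cis (n m * (- 2 * h)) * gen a b m l
       + cis (n l' * h) * gen a b l' m * cis (n m * (- 2 * h)) * rotc a b 0 m l) * cis (n l * h)) (at 0)"
    by (intro has_vector_derivative_mult_left has_vector_derivative_sum has_vector_derivative_mult
        has_vector_derivative_mult_right r)
  moreover have "(\<Sum>m<k. cis (n l' * h) * rotc a b 0 l' m * cis (n m * (- 2 * h)) * gen a b m l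
       + cis (n l' * h) * gen a b l' m * cis (n m * (- 2 * h)) * rotc a b 0 m l) * cis (n l * h)
     = gen a b l' l * complex_of_real (2 * cos (h * (n l' - n l)))"
  proof -
    have "(\<Sum>m<k. cis (n l' * h) * rotc a b 0 l' m * cis (n m * (- 2 * h)) * gen a b m l)
      = (\<Sum>m<k. if m = l' then cis (n l' * h) * cis (n l' * (- 2 * h)) * gen a b l' l else 0)"
      by (intro sum.cong refl) (use l in \<open>simp add: rotc_zero\<close>)
    also have "\<dots> = cis (n l' * h) * cis (n l' * (- 2 * h)) * gen a b l' l" using l by simp
    finally have 1: "(\<Sum>m<k. cis (n l' * h) * rotc a b 0 l' m * cis (n m * (- 2 * h)) * gen a b m l)
      = cis (n l' * h) * cis (n l' * (- 2 * h)) * gen a b l' l" .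
    have "(\<Sum>m<k. cis (n l' * h) * gen a b l' m * cis (n m * (- 2 * h)) * rotc a b 0 m l)
      = (\<Sum>m<k. if m = l then cis (n l' * h) * gen a b l' l * cis (n l * (- 2 * h)) else 0)"
      by (intro sum.cong refl) (use l in \<open>simp add: rotc_zero\<close>)
    also have "\<dots> = cis (n l' * h) * gen a b l' l * cis (n l * (- 2 * h))" using l by simp
    finally have 2: "(\<Sum>m<k. cis (n l' * h) * gen a b l' m * cis (n m * (- 2 * h)) * rotc a b 0 m l)
      = cis (n l' * h) * gen a b l' l * cis (n l * (- 2 * h))" .
    have 3: "cis (n l' * h) * cis (n l' * (- 2 * h)) * cis (n l * h) = cis (- (h * (n l' - n l)))"
      "cis (n l' * h) * cis (n l * (- 2 * h)) * cis (n l * h) = cis (h * (n l' - n l))"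
      unfolding cis_mult by (rule arg_cong[of _ _ cis], simp add: algebra_simps)+
    have "(cis (n l' * h) * cis (n l' * (- 2 * h)) * gen a b l' l + cis (n l' * h) * gen a b l' l * cis (n l * (- 2 * h))) * cis (n l * h)
      = gen a b l' l * (cis (n l' * h) * cis (n l' * (- 2 * h)) * cis (n l * h) + cis (n l' * h) * cis (n l * (- 2 * h)) * cis (n l * h))"
      by (simp only: distrib_left distrib_right mult_ac)
    also have "\<dots> = gen a b l' l * complex_of_real (2 * cos (h * (n l' - n l)))"
      unfolding 3 by (intro arg_cong2[of _ _ _ _ "(*)"] refl) (simp add: complex_eq_iff)
    finally show ?thesis unfolding sum.distrib 1 2 .
  qed
  ultimately have dL: "(?L has_vector_derivative gen a b l' l * complex_of_real (2 * cos (h * (n l' - n l)))) (at 0)"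
    by (simp only:)
  \<comment> \<open>At 0 the angle \<open>\<tau>\<close> has slope 2 cos (2 h), while
    \<open>\<eta>\<close> is of second order in \<open>t\<close>; on the right side only the
    rotation contributes.\<close>
  have d\<tau>: "(\<tau> has_real_derivative 2 * cos (2 * h)) (at 0)"
    unfolding \<tau>_def by (auto intro!: derivative_eq_intros)
  have d\<eta>: "(\<eta> has_real_derivative 0) (at 0)"
    unfolding \<eta>_def by (auto intro!: derivative_eq_intros)
  have z: "\<tau> 0 = 0" "\<eta> 0 = 0" by (simp_all add: \<tau>_def \<eta>_def)
  have e: "((\<lambda>t. cis (c * \<eta> t)) has_vector_derivative 0) (at 0)" for c
    using has_vector_derivative_cis[OF d\<eta>, of c] by simp
  have "(?P has_vector_derivative
      (cis (n l' * \<eta> 0) * rotc a b (\<tau> 0) l' l) * 0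
      + (cis (n l' * \<eta> 0) * (gen a b l' l * complex_of_real (2 * cos (2 * h))) + 0 * rotc a b (\<tau> 0) l' l) * cis (n l * \<eta> 0)) (at 0)"
    by (intro has_vector_derivative_mult e rotc_deriv[OF d\<tau> z(1)])
  then have dP: "(?P has_vector_derivative gen a b l' l * complex_of_real (2 * cos (2 * h))) (at 0)"
    by (simp add: z)
  show ?thesis using has_vector_derivative_eventually_eq[OF ev dL dP] unfolding n_def .
qed

end

end

context weight_rep
begin

text \<open>The generator connects weights that differ by a root. Comparing cosines fixes the change
  along the root to 2 in absolute value; rotations commute with torus elements having equal angles
  at \<open>a\<close> and \<open>b\<close>, which rules out a change in any other direction.\<close>

lemma gen_step:
  assumes ab: "a < d" "b < d" "a \<noteq> b" and l: "l' < k" "l < k" and ne: "gen a b l' l \<noteq> 0"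
  shows "\<mu> l' = (\<mu> l)(a := \<mu> l a + 1, b := \<mu> l b - 1) \<or> \<mu> l' = (\<mu> l)(a := \<mu> l a - 1, b := \<mu> l b + 1)"
proof -
  define \<delta> where "\<delta> j = \<mu> l' j - \<mu> l j" for j
  have "cos (h * (\<delta> a - \<delta> b)) = cos (2 * h)" for h
  proof -
    have "(\<mu> l' a - \<mu> l' b) - (\<mu> l a - \<mu> l b) = \<delta> a - \<delta> b" by (simp add: \<delta>_def)
    then have "complex_of_real (2 * cos (h * (\<delta> a - \<delta> b))) = complex_of_real (2 * cos (2 * h))"
      using gen_conjugate[OF ab l, of h] ne by (simp only: mult_cancel_left simp_thms)
    then show ?thesis by (simp only: of_real_eq_iff)
  qed
  then have \<Delta>: "\<bar>\<delta> a - \<delta> b\<bar> = 2" by (rule abs_eq_2_if_cos_eq)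
  have eq: "cis (\<Sum>j<d. \<mu> l' j * \<theta> j) = cis (\<Sum>j<d. \<mu> l j * \<theta> j)"
    if \<theta>: "(\<Sum>j<d. \<theta> j) = 0" "\<theta> a = \<theta> b" for \<theta>
  proof -
    let ?x = "cis (\<Sum>j<d. \<mu> l' j * \<theta> j)" and ?y = "cis (\<Sum>j<d. \<mu> l j * \<theta> j)"
    note T = torus_SU[OF \<theta>(1)] and R = rot_SU[OF ab]
    have "(?x - ?y) * rotc a b t l' l = 0" for t
    proof -
      have E: "\<sigma> (torus d \<theta>) * \<sigma> (rot d a b t) = \<sigma> (rot d a b t) * \<sigma> (torus d \<theta>)"
        unfolding mult[OF T R, symmetric] mult[OF R T, symmetric] torus_rot_commute[where t=t, OF \<theta>(2)] ..
      have "?x * rotc a b t l' l = rotc a b t l' l * ?y"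
        using arg_cong[OF E, of "\<lambda>M. M $$ (l',l)"]
        unfolding torus[OF \<theta>(1)] cdiag_mult_entry[OF carr[OF R] l] mult_cdiag_entry[OF carr[OF R] l] sigma_rot[OF ab l]
        by assumption
      then show ?thesis by (simp only: left_diff_distrib mult.commute[of _ ?y] diff_self)
    qed
    moreover have "((\<lambda>t. (?x - ?y) * rotc a b t l' l) has_vector_derivative (?x - ?y) * (gen a b l' l * complex_of_real 1)) (at 0)"
      by (intro has_vector_derivative_mult_right rotc_deriv[OF ab DERIV_ident refl])
    ultimately have "((\<lambda>t. 0) has_vector_derivative (?x - ?y) * (gen a b l' l * complex_of_real 1)) (at 0)"
      by (simp only:)
    from has_vector_derivative_eventually_eq[OF _ this has_vector_derivative_const]
    have "(?x - ?y) * (gen a b l' l * complex_of_real 1) = 0" by simp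
    then show ?thesis using ne by simp
  qed
  define e where "e = (\<delta> a + \<delta> b) / 2"
  \<comment> \<open>\<open>\<theta>\<close> is the orthogonal projection of \<open>\<delta>\<close>
    onto the angles with equal entries at \<open>a\<close> and \<open>b\<close>. Its pairing with
    \<open>\<delta>\<close> is its squared norm, so the vanishing of the pairing leaves only the
    root direction.\<close>
  define \<theta> where "\<theta> = \<delta>(a := e, b := e)"
  have rest: "(\<Sum>j\<in>{..<d} - {a,b}. f j (\<theta> j)) = (\<Sum>j\<in>{..<d} - {a,b}. f j (\<delta> j))" for f :: "nat \<Rightarrow> real \<Rightarrow> real"
    by (intro sum.cong refl) (simp add: \<theta>_def)
  have \<theta>ab: "\<theta> a = e" "\<theta> b = e" using ab by (simp_all add: \<theta>_def)
  have "(\<Sum>j<d. \<delta> j) = 0" using sum0 by (simp add: \<delta>_def sum_subtractf)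
  then have \<theta>0: "(\<Sum>j<d. \<theta> j) = 0"
    using rest[of "\<lambda>_ x. x"] unfolding sum_split_pair[OF ab] \<theta>ab by (simp add: e_def)
  have "(\<Sum>j<d. (\<mu> l' j - \<mu> l j) * \<theta> j) = 0"
  proof (rule weight_orthogonal, rule eq)
    fix s show "(\<Sum>j<d. s * \<theta> j) = 0" using \<theta>0 by (simp only: sum_distrib_left[symmetric])
    show "s * \<theta> a = s * \<theta> b" by (simp only: \<theta>ab)
  qed
  then have "(\<Sum>j\<in>{..<d} - {a,b}. \<delta> j * \<delta> j) + (\<delta> a + \<delta> b)\<^sup>2 / 2 = 0"
    using rest[of "\<lambda>j x. \<delta> j * x"] unfolding \<delta>_def[symmetric] sum_split_pair[OF ab] \<theta>ab
    by (simp add: e_def power2_eq_square algebra_simps add_divide_distrib)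
  moreover have "0 \<le> (\<Sum>j\<in>{..<d} - {a,b}. \<delta> j * \<delta> j)" by (intro sum_nonneg) simp
  moreover have "0 \<le> (\<delta> a + \<delta> b)\<^sup>2 / 2" by simp
  ultimately have z: "(\<Sum>j\<in>{..<d} - {a,b}. \<delta> j * \<delta> j) = 0" "(\<delta> a + \<delta> b)\<^sup>2 / 2 = 0" by linarith+
  have "\<forall>j\<in>{..<d} - {a,b}. \<delta> j * \<delta> j = 0" using z(1) by (subst (asm) sum_nonneg_eq_0_iff) simp_all
  then have in0: "\<delta> j = 0" if "j < d" "j \<noteq> a" "j \<noteq> b" for j using that by simp
  have out0: "\<delta> j = 0" if "\<not> j < d" for j using support that by (simp add: \<delta>_def)
  have d0: "\<delta> j = 0" if "j \<noteq> a" "j \<noteq> b" for j using in0 out0 that by blast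
  have "\<delta> b = - \<delta> a" using z(2) by simp
  then have cases: "\<delta> a = 1 \<and> \<delta> b = -1 \<or> \<delta> a = -1 \<and> \<delta> b = 1" using \<Delta> by linarith
  have mu: "\<mu> l' j = \<mu> l j + \<delta> j" for j by (simp add: \<delta>_def)
  from cases show ?thesis
  proof
    assume "\<delta> a = 1 \<and> \<delta> b = -1"
    then have "\<mu> l' = (\<mu> l)(a := \<mu> l a + 1, b := \<mu> l b - 1)"
      using d0 ab by (intro ext) (simp add: mu)
    then show ?thesis by blast
  next
    assume "\<delta> a = -1 \<and> \<delta> b = 1"
    then have "\<mu> l' = (\<mu> l)(a := \<mu> l a - 1, b := \<mu> l b + 1)"
      using d0 ab by (intro ext) (simp add: mu)
    then show ?thesis by blast
  qed
qed

text \<open>\<open>rotc\<close> is the exponential of t times \<open>gen\<close>. Powers of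
  \<open>gen\<close> map the span of \<open>P\<close> into itself, and the exponential series
  inherits this.\<close>

lemma rotc_zero_invariant:
  assumes ab: "a < d" "b < d" "a \<noteq> b" and P: "P \<subseteq> {..<k}" "l \<in> P"
    and closed: "\<And>p q. q \<in> P \<Longrightarrow> p < k \<Longrightarrow> p \<notin> P \<Longrightarrow> gen a b p q = 0"
    and p: "p < k" "p \<notin> P"
  shows "rotc a b t p l = 0"
proof -
  define g where "g = \<sigma> (root_frame d a b)"
  define g' where "g' = \<sigma> (adj (root_frame d a b))"
  define z where "z m = \<i> * complex_of_real (\<mu> m a - \<mu> m b)" for m
  \<comment> \<open>\<open>Y N p\<close> is the entry (p,l) of the N-th power of \<open>gen\<close>;
    the frames cancel between consecutive factors.\<close>
  define Y where "Y N p = (\<Sum>m<k. g $$ (p,m) * z m ^ N * g' $$ (m,l))" for N p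
  have lk: "l < k" using P by auto
  have Y0: "Y 0 p = (if p = l then 1 else 0)" if "p < k" for p
    using frame_inverse(1)[OF ab that lk] by (simp add: Y_def g_def g'_def)
  have YS: "Y (Suc N) p = (\<Sum>x<k. gen a b p x * Y N x)" if "p < k" for N p
  proof -
    have "(\<Sum>x<k. gen a b p x * Y N x)
      = (\<Sum>x<k. \<Sum>m<k. \<Sum>m'<k. g $$ (p,m) * z m * z m' ^ N * g' $$ (m',l) * (g' $$ (m,x) * g $$ (x,m')))"
    proof -
      have "gen a b p x = (\<Sum>m<k. g $$ (p,m) * z m * g' $$ (m,x))" for x
        by (simp only: gen_def g_def g'_def z_def)
      then show ?thesis by (simp add: Y_def sum_product mult_ac)
    qed
    also have "\<dots> = (\<Sum>m<k. \<Sum>m'<k. \<Sum>x<k. g $$ (p,m) * z m * z m' ^ N * g' $$ (m',l) * (g' $$ (m,x) * g $$ (x,m')))"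
      by (rule trans[OF sum.swap]) (intro sum.cong refl sum.swap)
    also have "\<dots> = (\<Sum>m<k. \<Sum>m'<k. if m' = m then g $$ (p,m) * z m * z m ^ N * g' $$ (m,l) else 0)"
    proof (intro sum.cong refl)
      fix m m' assume "m \<in> {..<k}" "m' \<in> {..<k}"
      then have mm: "m < k" "m' < k" by auto
      show "(\<Sum>x<k. g $$ (p,m) * z m * z m' ^ N * g' $$ (m',l) * (g' $$ (m,x) * g $$ (x,m')))
        = (if m' = m then g $$ (p,m) * z m * z m ^ N * g' $$ (m,l) else 0)"
        unfolding sum_distrib_left[symmetric] g_def g'_def frame_inverse(2)[OF ab mm] by simp
    qed
    also have "\<dots> = Y (Suc N) p" by (simp add: Y_def mult.assoc)
    finally show ?thesis by simp
  qed
  have Yz: "Y N p = 0" if "p < k" "p \<notin> P" for N p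
    using that
  proof (induction N arbitrary: p)
    case 0
    then show ?case using Y0 P(2) by auto
  next
    case (Suc N)
    have "gen a b p x * Y N x = 0" if "x < k" for x
    proof (cases "x \<in> P")
      case True
      then show ?thesis using closed Suc.prems by simp
    next
      case False
      then show ?thesis using Suc.IH that by simp
    qed
    then show ?case unfolding YS[OF Suc.prems(1)] by (intro sum.neutral) simp
  qed
  have "(\<lambda>N. \<Sum>m<k. g $$ (p,m) * (((z m * complex_of_real t) ^ N) /\<^sub>R fact N) * g' $$ (m,l)) sums
      (\<Sum>m<k. g $$ (p,m) * exp (z m * complex_of_real t) * g' $$ (m,l))"
    by (intro sums_sum sums_mult sums_mult2 exp_converges)
  moreover have "(\<Sum>m<k. g $$ (p,m) * (((z m * complex_of_real t) ^ N) /\<^sub>R fact N) * g' $$ (m,l)) = 0" for N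
  proof -
    have "(\<Sum>m<k. g $$ (p,m) * (((z m * complex_of_real t) ^ N) /\<^sub>R fact N) * g' $$ (m,l))
      = (complex_of_real t ^ N /\<^sub>R fact N) * Y N p"
      unfolding Y_def sum_distrib_left
      by (intro sum.cong refl) (simp add: power_mult_distrib scaleR_conv_of_real mult_ac)
    then show ?thesis using Yz[OF p] by simp
  qed
  ultimately have "(\<lambda>N. 0) sums (\<Sum>m<k. g $$ (p,m) * exp (z m * complex_of_real t) * g' $$ (m,l))"
    by (simp only:)
  then have "(\<Sum>m<k. g $$ (p,m) * exp (z m * complex_of_real t) * g' $$ (m,l)) = 0"
    by (rule sums_unique2[OF _ sums_zero])
  moreover have "exp (z m * complex_of_real t) = cis ((\<mu> m a - \<mu> m b) * t)" for m
    by (simp add: z_def cis_conv_exp mult.assoc)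
  ultimately show ?thesis by (simp only: rotc_def g_def g'_def)
qed

lemma sigma_swap_nonzero:
  assumes ab: "a < d" "b < d" "a \<noteq> b" and l: "l < k"
  shows "\<exists>l'<k. \<sigma> (rot d a b t) $$ (l',l) \<noteq> 0"
proof (rule ccontr)
  assume "\<not> ?thesis"
  moreover have "(\<Sum>p<k. \<sigma> (adj (rot d a b t)) $$ (l,p) * \<sigma> (rot d a b t) $$ (p,l)) = 1"
    using mat_mult_entry[OF carr[OF SU_adj(1)[OF rot_SU[OF ab]]] carr[OF rot_SU[OF ab]] l l]
      sigma_adj(2)[OF rot_SU[OF ab]] l by (metis index_one_mat(1))
  ultimately show False by simp
qed

lemma swap_weight_exists:
  assumes ab: "a < d" "b < d" "a \<noteq> b" and l: "l < k"
  shows "\<exists>l'<k. \<mu> l' = (\<mu> l)(a := \<mu> l b, b := \<mu> l a)"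
  using sigma_swap_nonzero[OF ab l, of "pi / 2"] swap_weight[OF ab _ l] by blast

text \<open>Otherwise the indices with weights \<open>\<mu> l + j (e\<^sub>a - e\<^sub>b)\<close>, \<open>j \<ge> 0\<close>, span a space invariant
  under all rotations in the \<open>a\<close>-\<open>b\<close> plane, although the rotation by \<open>\<pi>/2\<close> exchanges the coordinates
  \<open>a\<close> and \<open>b\<close> of every weight.\<close>
lemma step_weight_exists:
  assumes ab: "a < d" "b < d" "a \<noteq> b" and l: "l < k" and less: "\<mu> l b < \<mu> l a"
  shows "\<exists>l'<k. \<mu> l' = (\<mu> l)(a := \<mu> l a - 1, b := \<mu> l b + 1)"
proof (rule ccontr)
  assume no: "\<not> ?thesis"
  define P where "P = {p. p < k \<and> (\<exists>j::nat. \<mu> p = (\<mu> l)(a := \<mu> l a + real j, b := \<mu> l b - real j))}"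
  have lP: "l \<in> P" unfolding P_def using l by (auto intro!: exI[of _ 0])
  have "gen a b p q = 0" if q: "q \<in> P" and p: "p < k" "p \<notin> P" for p q
  proof (rule ccontr)
    assume ne: "gen a b p q \<noteq> 0"
    obtain j where qk: "q < k" and j: "\<mu> q = (\<mu> l)(a := \<mu> l a + real j, b := \<mu> l b - real j)"
      using q unfolding P_def by blast
    from gen_step[OF ab p(1) qk ne] show False
    proof
      assume "\<mu> p = (\<mu> q)(a := \<mu> q a + 1, b := \<mu> q b - 1)"
      then have "\<mu> p = (\<mu> l)(a := \<mu> l a + real (Suc j), b := \<mu> l b - real (Suc j))"
        using ab(3) by (auto simp: j fun_eq_iff)
      then show False using p unfolding P_def by blast
    next
      \<comment> \<open>A step down from j = 0 would produce exactly the weight assumed not to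
        occur.\<close>
      assume *: "\<mu> p = (\<mu> q)(a := \<mu> q a - 1, b := \<mu> q b + 1)"
      show False
      proof (cases j)
        case 0
        then have "\<mu> p = (\<mu> l)(a := \<mu> l a - 1, b := \<mu> l b + 1)"
          using * ab(3) by (auto simp: j fun_eq_iff)
        then show False using no p by blast
      next
        case (Suc i)
        then have "\<mu> p = (\<mu> l)(a := \<mu> l a + real i, b := \<mu> l b - real i)"
          using * ab(3) by (auto simp: j fun_eq_iff)
        then show False using p unfolding P_def by blast
      qed
    qed
  qed
  then have z: "rotc a b t p l = 0" if "p < k" "p \<notin> P" for p t
    using that by (intro rotc_zero_invariant[OF ab _ lP]) (auto simp: P_def)
  obtain l' where l': "l' < k" "\<sigma> (rot d a b (pi / 2)) $$ (l',l) \<noteq> 0"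
    using sigma_swap_nonzero[OF ab l] by blast
  then have "l' \<in> P" using z sigma_rot[OF ab l'(1) l] by metis
  then obtain j where e1: "\<mu> l' = (\<mu> l)(a := \<mu> l a + real j, b := \<mu> l b - real j)" unfolding P_def by blast
  have e2: "\<mu> l' = (\<mu> l)(a := \<mu> l b, b := \<mu> l a)" by (rule swap_weight[OF ab l'(1) l l'(2)])
  \<comment> \<open>The quarter turn leads from \<open>l\<close> to a weight with entry
    \<open>\<mu> l b\<close> at \<open>a\<close>, whereas every weight in \<open>P\<close> has at
    least \<open>\<mu> l a\<close> there.\<close>
  have "\<mu> l a + real j = \<mu> l b" using fun_cong[OF e1, of a] fun_cong[OF e2, of a] ab(3) by simp
  then show False using less by simp
qed

lemma root_closed_weights: "root_closed d (\<mu> ` {..<k})"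
  unfolding root_closed_def
proof (intro ballI allI impI conjI)
  fix \<nu> a b assume "\<nu> \<in> \<mu> ` {..<k}" and ab: "a < d" "b < d" "a \<noteq> b"
  then obtain l where l: "l < k" "\<nu> = \<mu> l" by auto
  show "\<nu> a - \<nu> b \<in> \<int>" using integral ab l by simp
  show "\<nu>(a := \<nu> b, b := \<nu> a) \<in> \<mu> ` {..<k}"
    using swap_weight_exists[OF ab l(1)] unfolding l(2) by (metis imageI lessThan_iff)
  assume "\<nu> b < \<nu> a"
  then show "\<nu>(a := \<nu> a - 1, b := \<nu> b + 1) \<in> \<mu> ` {..<k}"
    using step_weight_exists[OF ab l(1)] unfolding l(2) by (metis imageI lessThan_iff)
qed

text \<open>\<open>m\<close> is the largest gap between the entries \<open>a\<close> and
  \<open>b\<close>, attained at some weight to which \<open>card_root_closed\<close> applies.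
  Several basis vectors may share a weight, so the number of weights is at most
  \<open>k\<close>.\<close>

lemma weight_spread:
  assumes ab: "a < d" "b < d" "a \<noteq> b" and k: "0 < k"
  shows "\<exists>m::nat. (\<forall>l<k. \<bar>\<mu> l a - \<mu> l b\<bar> \<le> real m) \<and> (d - 1 + m) choose m \<le> k"
proof -
  let ?A = "(\<lambda>l. \<bar>\<mu> l a - \<mu> l b\<bar>) ` {..<k}"
  have "Max ?A \<in> ?A" using k by (intro Max_in) auto
  then obtain l where l: "l < k" "Max ?A = \<bar>\<mu> l a - \<mu> l b\<bar>" by auto
  have "\<bar>\<mu> l a - \<mu> l b\<bar> \<in> \<int>" using integral ab by simp
  then obtain m where m: "\<bar>\<mu> l a - \<mu> l b\<bar> = real m" using Ints_nonneg_eq_nat by (meson abs_ge_zero)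
  have le: "\<bar>\<mu> p a - \<mu> p b\<bar> \<le> real m" if "p < k" for p
    using Max_ge[of ?A "\<bar>\<mu> p a - \<mu> p b\<bar>"] that l m by auto
  have d2: "2 \<le> d" using ab by linarith
  have card: "card (\<mu> ` {..<k}) \<le> k" using card_image_le[of "{..<k}" \<mu>] by simp
  have fin: "finite (\<mu> ` {..<k})" and mem: "\<mu> l \<in> \<mu> ` {..<k}" using l by auto
  have "(d - 1 + m) choose m \<le> card (\<mu> ` {..<k})"
  proof (cases rule: linorder_cases[of "\<mu> l b" "\<mu> l a"])
    case greater
    then have "\<mu> l b - \<mu> l a = real m" using m by simp
    then show ?thesis using card_root_closed[OF d2 fin root_closed_weights mem ab(2,1)] ab(3) by blast
  next
    case less
    then have "\<mu> l a - \<mu> l b = real m" using m by simp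
    then show ?thesis using card_root_closed[OF d2 fin root_closed_weights mem ab] by blast
  next
    case equal
    then have "\<mu> l a - \<mu> l b = real m" using m by simp
    then show ?thesis using card_root_closed[OF d2 fin root_closed_weights mem ab] by blast
  qed
  then show ?thesis using le card by (intro exI[of _ m]) auto
qed

end

text \<open>\<open>T\<close> is the charge that generates the image of the torus subgroup of the
  coroot. It is diagonal in the weight basis with the gaps
  \<open>\<mu> l 0 - \<mu> l (d - 1)\<close> as eigenvalues, so the number \<open>m\<close> bounding
  the gaps also bounds its norm.\<close>

theorem representation_generator:
  assumes rep: "cont_unitary_rep d k \<rho>" and d: "2 \<le> d" and k: "0 < k"
  shows "\<exists>T m. T \<in> carrier_mat k k \<and> adj T = T \<and>
    (\<forall>r<k. \<forall>s<k. ((\<lambda>t. \<rho> (torus d (coroot 0 (d - 1) t)) $$ (r,s)) has_vector_derivative \<i> * T $$ (r,s)) (at 0)) \<and>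
    (\<forall>x. (\<Sum>r<k. (cmod (\<Sum>s<k. T $$ (r,s) * x s))\<^sup>2) \<le> (real m)\<^sup>2 * (\<Sum>s<k. (cmod (x s))\<^sup>2)) \<and>
    (d - 1 + m) choose m \<le> k"
proof -
  have ab: "0 < d" "d - 1 < d" "0 \<noteq> d - 1" using d by auto
  have d1: "1 \<le> d" using d by simp
  from torus_weights[OF rep d1] obtain Q \<mu> where
    Q: "Q \<in> carrier_mat k k" "adj Q * Q = 1\<^sub>m k" "Q * adj Q = 1\<^sub>m k" and
    supp: "\<forall>l. \<forall>j\<ge>d. \<mu> l j = (0::real)" and int: "\<forall>l. \<forall>a<d. \<forall>b<d. \<mu> l a - \<mu> l b \<in> \<int>" and
    s0: "\<forall>l. (\<Sum>j<d. \<mu> l j) = 0" and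
    tor: "\<forall>\<theta>. (\<Sum>j<d. \<theta> j) = 0 \<longrightarrow> \<rho> (torus d \<theta>) = Q * cdiag k (\<lambda>l. cis (\<Sum>j<d. \<mu> l j * \<theta> j)) * adj Q"
    by (elim exE conjE)
  have aQ: "adj Q \<in> carrier_mat k k" using Q by simp
  have cr: "\<rho> W \<in> carrier_mat k k" if "W \<in> SU d" for W
    using rep that unfolding cont_unitary_rep_def by blast
  have mr: "\<rho> (W * W') = \<rho> W * \<rho> W'" if "W \<in> SU d" "W' \<in> SU d" for W W'
    using rep that unfolding cont_unitary_rep_def by blast
  interpret weight_rep d k "\<lambda>W. adj Q * \<rho> W * Q" \<mu>
  proof
    show "adj Q * \<rho> W * Q \<in> carrier_mat k k" if "W \<in> SU d" for W
      by (rule mult_carrier_mat[OF mult_carrier_mat[OF aQ cr[OF that]] Q(1)])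
    show "adj Q * \<rho> (W * W') * Q = adj Q * \<rho> W * Q * (adj Q * \<rho> W' * Q)" if "W \<in> SU d" "W' \<in> SU d" for W W'
      unfolding mr[OF that] by (rule mult_cancel_mid[OF aQ Q(3,1) cr[OF that(1)] cr[OF that(2)], symmetric])
    show "adj Q * \<rho> (torus d \<theta>) * Q = cdiag k (\<lambda>l. cis (\<Sum>j<d. \<mu> l j * \<theta> j))" if "(\<Sum>j<d. \<theta> j) = 0" for \<theta>
      unfolding tor[rule_format, OF that] by (rule unitary_conj_cancel[OF Q(1) aQ Q(2) cdiag_carrier])
  qed (use supp int s0 in auto)
  obtain m :: nat where m: "\<And>l. l < k \<Longrightarrow> \<bar>\<mu> l 0 - \<mu> l (d - 1)\<bar> \<le> real m" and choose: "(d - 1 + m) choose m \<le> k"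
    using weight_spread[OF ab k] by blast
  define n where "n l = \<mu> l 0 - \<mu> l (d - 1)" for l
  define T where "T = Q * cdiag k (\<lambda>l. complex_of_real (n l)) * adj Q"
  have T: "T \<in> carrier_mat k k" unfolding T_def by (rule mult_carrier_mat[OF mult_carrier_mat[OF Q(1) cdiag_carrier] aQ])
  have "adj T = T" unfolding T_def adj_conj_cdiag[OF Q(1)] by simp
  moreover have "((\<lambda>t. \<rho> (torus d (coroot 0 (d - 1) t)) $$ (r,s)) has_vector_derivative \<i> * T $$ (r,s)) (at 0)"
    if rs: "r < k" "s < k" for r s
  proof -
    have "\<rho> (torus d (coroot 0 (d - 1) t)) $$ (r,s) = (\<Sum>l<k. Q $$ (r,l) * cis (n l * t) * cnj (Q $$ (s,l)))" for t
      unfolding tor[rule_format, OF sum_coroot_zero[OF ab]] sum_coroot[OF ab] n_def by (rule conj_cdiag_entry[OF Q(1) rs])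
    moreover have "((\<lambda>t. \<Sum>l<k. Q $$ (r,l) * cis (n l * t) * cnj (Q $$ (s,l))) has_vector_derivative
       (\<Sum>l<k. Q $$ (r,l) * (cis (n l * 0) * (\<i> * complex_of_real (n l * 1))) * cnj (Q $$ (s,l)))) (at 0)"
      by (intro has_vector_derivative_sum has_vector_derivative_mult_right has_vector_derivative_mult_left
          has_vector_derivative_cis DERIV_ident)
    moreover have "(\<Sum>l<k. Q $$ (r,l) * (cis (n l * 0) * (\<i> * complex_of_real (n l * 1))) * cnj (Q $$ (s,l))) = \<i> * T $$ (r,s)"
      unfolding T_def conj_cdiag_entry[OF Q(1) rs] sum_distrib_left by (intro sum.cong refl) simp
    ultimately show ?thesis by (simp only:)
  qed
  moreover have "(\<Sum>r<k. (cmod (\<Sum>s<k. T $$ (r,s) * x s))\<^sup>2) \<le> (real m)\<^sup>2 * (\<Sum>s<k. (cmod (x s))\<^sup>2)" for x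
  proof -
    define y where "y l = (\<Sum>s<k. adj Q $$ (l,s) * x s)" for l
    have "(\<Sum>s<k. T $$ (r,s) * x s) = (\<Sum>l<k. Q $$ (r,l) * (complex_of_real (n l) * y l))" if r: "r < k" for r
    proof -
      have "(\<Sum>s<k. T $$ (r,s) * x s) = (\<Sum>s<k. \<Sum>l<k. Q $$ (r,l) * (complex_of_real (n l) * (adj Q $$ (l,s) * x s)))"
        unfolding T_def
        by (intro sum.cong refl) (simp add: conj_cdiag_entry[OF Q(1) r] adj_entry[OF Q(1)] sum_distrib_right mult.assoc)
      also have "\<dots> = (\<Sum>l<k. Q $$ (r,l) * (complex_of_real (n l) * y l))"
        unfolding y_def sum_distrib_left by (rule sum.swap)
      finally show ?thesis .
    qed
    then have "(\<Sum>r<k. (cmod (\<Sum>s<k. T $$ (r,s) * x s))\<^sup>2)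
        = (\<Sum>r<k. (cmod (\<Sum>l<k. Q $$ (r,l) * (complex_of_real (n l) * y l)))\<^sup>2)" by simp
    also have "\<dots> = (\<Sum>l<k. (cmod (complex_of_real (n l) * y l))\<^sup>2)" by (rule isometry_sum[OF Q(1,2)])
    also have "\<dots> \<le> (\<Sum>l<k. (real m)\<^sup>2 * (cmod (y l))\<^sup>2)"
    proof (intro sum_mono)
      fix l assume "l \<in> {..<k}"
      then have "\<bar>n l\<bar> \<le> real m" using m by (simp add: n_def)
      then have "\<bar>n l\<bar>\<^sup>2 \<le> (real m)\<^sup>2" by (rule power_mono) simp
      then show "(cmod (complex_of_real (n l) * y l))\<^sup>2 \<le> (real m)\<^sup>2 * (cmod (y l))\<^sup>2"
        by (simp add: norm_mult power_mult_distrib mult_right_mono)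
    qed
    also have "\<dots> = (real m)\<^sup>2 * (\<Sum>l<k. (cmod (\<Sum>s<k. adj Q $$ (l,s) * x s))\<^sup>2)"
      by (simp only: y_def sum_distrib_left)
    also have "(\<Sum>l<k. (cmod (\<Sum>s<k. adj Q $$ (l,s) * x s))\<^sup>2) = (\<Sum>s<k. (cmod (x s))\<^sup>2)"
      by (rule isometry_sum[OF aQ]) (simp add: Q(3))
    finally show ?thesis .
  qed
  ultimately show ?thesis using T choose by blast
qed

section \<open>Charges of transversal codes\<close>

context
  fixes n :: nat and d :: "nat \<Rightarrow> nat"
  assumes pos: "\<And>i. i < n \<Longrightarrow> 0 < d i"
begin

lemma wt_pos: "0 < wt n d i"
  unfolding wt_def by (intro prod_pos) (simp add: pos)

lemma wt_step: "i < n \<Longrightarrow> (\<Prod>j\<in>{i..<n}. d j) = d i * wt n d i"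
  by (simp add: wt_def prod.atLeast_Suc_lessThan)

lemma dimA_split: "i < n \<Longrightarrow> dimA n d = (\<Prod>j<i. d j) * (d i * wt n d i)"
  unfolding dimA_def wt_step[symmetric] lessThan_atLeast0
  by (rule prod.atLeastLessThan_concat[symmetric]) auto

lemma digit_less: "i < n \<Longrightarrow> digit n d i a < d i"
  unfolding digit_def using pos by simp

text \<open>The index is split into higher digits, the new digit and lower digits; unlike the
  definition, this form is free of truncated subtraction.\<close>

lemma set_digit_eq:
  "set_digit n d i a k = a div (wt n d i * d i) * (wt n d i * d i) + k * wt n d i + a mod wt n d i"
proof -
  let ?w = "wt n d i"
  have "a = a div ?w * ?w + a mod ?w" by simp
  also have "a div ?w = a div (?w * d i) * d i + digit n d i a"
    unfolding digit_def div_mult2_eq by simp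
  finally have "a = a div (?w * d i) * (?w * d i) + digit n d i a * ?w + a mod ?w"
    by (simp add: algebra_simps)
  then show ?thesis unfolding set_digit_def by linarith
qed

lemma set_digit_div_mod:
  assumes "k < d i"
  shows "set_digit n d i a k mod wt n d i = a mod wt n d i"
    and "set_digit n d i a k div wt n d i = a div (wt n d i * d i) * d i + k"
    and "set_digit n d i a k div (wt n d i * d i) = a div (wt n d i * d i)"
proof -
  let ?w = "wt n d i"
  have e: "set_digit n d i a k = a mod ?w + (a div (?w * d i) * d i + k) * ?w"
    unfolding set_digit_eq by (simp add: algebra_simps)
  show "set_digit n d i a k mod ?w = a mod ?w" unfolding e by simp
  show 2: "set_digit n d i a k div ?w = a div (?w * d i) * d i + k"
    unfolding e using wt_pos[of i] by simp
  show "set_digit n d i a k div (?w * d i) = a div (?w * d i)"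
    unfolding div_mult2_eq[of "set_digit n d i a k"] 2 using assms by simp
qed

lemma digit_set_digit_same: "k < d i \<Longrightarrow> digit n d i (set_digit n d i a k) = k"
  unfolding digit_def set_digit_div_mod(2) by simp

lemma set_digit_set_digit: "r < d i \<Longrightarrow> set_digit n d i (set_digit n d i a r) k = set_digit n d i a k"
  unfolding set_digit_eq[of i "set_digit n d i a r"] set_digit_div_mod unfolding set_digit_eq ..

lemma set_digit_digit: "set_digit n d i a (digit n d i a) = a"
  unfolding set_digit_def digit_def
  by (metis div_times_less_eq_dividend le_add_diff_inverse2 mod_less_eq_dividend mult_le_mono1 order_trans)

text \<open>Meant for digits: those of lower weight can be read off from the index modulo a higher
  weight.\<close>

lemma div_mod_of_dvd:
  fixes y :: nat
  assumes "e * c dvd w"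
  shows "(y mod w) div e mod c = y div e mod c"
proof -
  obtain t where w: "w = e * c * t" using assms by blast
  have "y div e mod c = (y mod (e * c)) div e" by (cases "e = 0") (simp_all add: mod_mult2_eq)
  moreover have "(y mod w) div e mod c = (y mod w mod (e * c)) div e" by (cases "e = 0") (simp_all add: mod_mult2_eq)
  moreover have "y mod w mod (e * c) = y mod (e * c)" unfolding w by (simp add: mod_mod_cancel)
  ultimately show ?thesis by simp
qed

lemma wt_dvd: "i < j \<Longrightarrow> j < n \<Longrightarrow> wt n d j * d j dvd wt n d i"
  using prod_dvd_prod_subset[of "{Suc i..<n}" "{j..<n}" d] wt_step[of j]
  by (simp add: wt_def mult.commute)

lemma digit_set_digit_other:
  assumes ij: "i < n" "j < n" "j \<noteq> i" and k: "k < d i"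
  shows "digit n d j (set_digit n d i a k) = digit n d j a"
proof (cases "i < j")
  case True
  then have "wt n d j * d j dvd wt n d i" using wt_dvd ij by blast
  then show ?thesis
    unfolding digit_def by (metis div_mod_of_dvd set_digit_div_mod(1)[OF k])
next
  case False
  then have "wt n d i * d i dvd wt n d j" using wt_dvd ij by force
  then obtain t where t: "wt n d j = wt n d i * d i * t" by blast
  show ?thesis unfolding digit_def t div_mult2_eq[of _ "wt n d i * d i" t] set_digit_div_mod(3)[OF k] ..
qed

lemma set_digit_less:
  assumes i: "i < n" and a: "a < dimA n d" and k: "k < d i"
  shows "set_digit n d i a k < dimA n d"
proof -
  let ?w = "wt n d i" and ?H = "\<Prod>j<i. d j"
  have D: "dimA n d = ?H * (?w * d i)" using dimA_split[OF i] by (simp add: mult.commute)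
  have "a div (?w * d i) < ?H" using a unfolding D by (simp add: less_mult_imp_div_less)
  then have "Suc (a div (?w * d i)) * (?w * d i) \<le> ?H * (?w * d i)" by (intro mult_le_mono1) simp
  moreover have "k * ?w + a mod ?w < ?w * d i"
  proof -
    have "k * ?w + a mod ?w < Suc k * ?w" using wt_pos[of i] by simp
    also have "\<dots> \<le> d i * ?w" using k by (intro mult_le_mono1) simp
    finally show ?thesis by (simp add: mult.commute)
  qed
  ultimately show ?thesis unfolding set_digit_eq D by simp
qed

lemma digits_inject:
  assumes ab: "a < dimA n d" "b < dimA n d" and eq: "\<And>i. i < n \<Longrightarrow> digit n d i a = digit n d i b"
  shows "a = b"
proof -
  have "a mod (\<Prod>j\<in>{m..<n}. d j) = b mod (\<Prod>j\<in>{m..<n}. d j)" if "m \<le> n" for m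
    using that
  proof (induction m rule: inc_induct)
    case base
    then show ?case by simp
  next
    case (step m)
    have "(\<Prod>j\<in>{m..<n}. d j) = wt n d m * d m" using wt_step[OF step(2)] by (simp add: mult.commute)
    moreover have "a mod wt n d m = b mod wt n d m" using step.IH by (simp add: wt_def)
    moreover have "a div wt n d m mod d m = b div wt n d m mod d m" using eq[OF step(2)] by (simp add: digit_def)
    ultimately show ?case by (simp add: mod_mult2_eq)
  qed
  from this[of 0] show ?thesis using ab by (simp add: dimA_def lessThan_atLeast0)
qed

lemma kron_all_entry:
  assumes M: "\<And>i. i < n \<Longrightarrow> M i \<in> carrier_mat (d i) (d i)"
  shows "kron_all n M \<in> carrier_mat (dimA n d) (dimA n d)"
    and "a < dimA n d \<Longrightarrow> b < dimA n d \<Longrightarrow> kron_all n M $$ (a,b) = (\<Prod>i<n. M i $$ (digit n d i a, digit n d i b))"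
proof -
  define F where "F m = foldr (\<lambda>i acc. kron (M i) acc) [m..<n] (1\<^sub>m 1)" for m
  define W where "W m = (\<Prod>j\<in>{m..<n}. d j)" for m
  \<comment> \<open>\<open>F m\<close> is the product of the factors from \<open>m\<close> on and
    \<open>W m\<close> its dimension. Digits refer to the weights of the full index; for factors
    from \<open>m\<close> on these weights are the ones of the partial product.\<close>
  have main: "F m \<in> carrier_mat (W m) (W m) \<and> (\<forall>a<W m. \<forall>b<W m.
      F m $$ (a,b) = (\<Prod>i\<in>{m..<n}. M i $$ (digit n d i a, digit n d i b)))" if "m \<le> n" for m
    using that
  proof (induction m rule: inc_induct)
    case base
    then show ?case by (simp add: F_def W_def)
  next
    case (step m)
    have F: "F m = kron (M m) (F (Suc m))" using step(2) by (simp add: F_def upt_conv_Cons)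
    have W: "W m = d m * W (Suc m)" "W (Suc m) = wt n d m"
      using step(2) by (simp_all add: W_def prod.atLeast_Suc_lessThan wt_def)
    have IH: "F (Suc m) \<in> carrier_mat (W (Suc m)) (W (Suc m))"
      "\<And>a b. a < W (Suc m) \<Longrightarrow> b < W (Suc m) \<Longrightarrow> F (Suc m) $$ (a,b) = (\<Prod>i\<in>{Suc m..<n}. M i $$ (digit n d i a, digit n d i b))"
      using step.IH by auto
    have wp: "0 < W (Suc m)" unfolding W(2) by (rule wt_pos)
    have "F m \<in> carrier_mat (W m) (W m)" using M[OF step(2)] IH(1) unfolding F kron_def W(1) by auto
    moreover have "F m $$ (a,b) = (\<Prod>i\<in>{m..<n}. M i $$ (digit n d i a, digit n d i b))"
      if ab: "a < W m" "b < W m" for a b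
    proof -
      have "F m $$ (a,b) = M m $$ (a div W (Suc m), b div W (Suc m)) * F (Suc m) $$ (a mod W (Suc m), b mod W (Suc m))"
        using M[OF step(2)] IH(1) ab unfolding F kron_def W(1) by auto
      also have "F (Suc m) $$ (a mod W (Suc m), b mod W (Suc m))
          = (\<Prod>i\<in>{Suc m..<n}. M i $$ (digit n d i (a mod W (Suc m)), digit n d i (b mod W (Suc m))))"
        using wp by (intro IH(2)) simp_all
      also have "\<dots> = (\<Prod>i\<in>{Suc m..<n}. M i $$ (digit n d i a, digit n d i b))"
      proof (intro prod.cong refl)
        fix i assume "i \<in> {Suc m..<n}"
        then have "wt n d i * d i dvd W (Suc m)" unfolding W(2) by (intro wt_dvd) auto
        then show "M i $$ (digit n d i (a mod W (Suc m)), digit n d i (b mod W (Suc m))) = M i $$ (digit n d i a, digit n d i b)"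
          unfolding digit_def by (simp only: div_mod_of_dvd)
      qed
      finally have "F m $$ (a,b) = M m $$ (a div W (Suc m), b div W (Suc m)) * (\<Prod>i\<in>{Suc m..<n}. M i $$ (digit n d i a, digit n d i b))" .
      moreover have "a div W (Suc m) = digit n d m a" "b div W (Suc m) = digit n d m b"
        using ab unfolding digit_def W by (simp_all add: less_mult_imp_div_less)
      ultimately show ?thesis using step(2) by (simp add: prod.atLeast_Suc_lessThan)
    qed
    ultimately show ?case by blast
  qed
  have W0: "W 0 = dimA n d" by (simp add: W_def dimA_def lessThan_atLeast0)
  show "kron_all n M \<in> carrier_mat (dimA n d) (dimA n d)" using main[of 0] unfolding W0 by (simp add: F_def kron_all_def)
  show "kron_all n M $$ (a,b) = (\<Prod>i<n. M i $$ (digit n d i a, digit n d i b))" if "a < dimA n d" "b < dimA n d"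
    using main[of 0] that unfolding W0 by (simp add: F_def kron_all_def lessThan_atLeast0)
qed

text \<open>Varying digit \<open>i\<close> of \<open>a\<close> alone reaches exactly these indices.
  The condition arises as a product of Kronecker deltas when all tensor factors but one are the
  identity.\<close>

lemma sum_agree_off:
  fixes f :: "nat \<Rightarrow> 'a :: comm_monoid_add"
  assumes i: "i < n" and a: "a < dimA n d"
  shows "(\<Sum>b<dimA n d. if (\<forall>j<n. j \<noteq> i \<longrightarrow> digit n d j a = digit n d j b) then f b else 0)
    = (\<Sum>r<d i. f (set_digit n d i a r))"
proof -
  have "{b. b < dimA n d \<and> (\<forall>j<n. j \<noteq> i \<longrightarrow> digit n d j a = digit n d j b)} = set_digit n d i a ` {..<d i}" (is "?S = _")
  proof
    show "?S \<subseteq> set_digit n d i a ` {..<d i}"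
    proof
      fix b assume b: "b \<in> ?S"
      have r: "digit n d i b < d i" by (rule digit_less[OF i])
      have "b = set_digit n d i a (digit n d i b)"
      proof (rule digits_inject)
        show "b < dimA n d" using b by simp
        show "set_digit n d i a (digit n d i b) < dimA n d" by (rule set_digit_less[OF i a r])
        show "digit n d j b = digit n d j (set_digit n d i a (digit n d i b))" if "j < n" for j
          using b that digit_set_digit_same[OF r] digit_set_digit_other[OF i that _ r] by (cases "j = i") auto
      qed
      then show "b \<in> set_digit n d i a ` {..<d i}" using r by blast
    qed
    show "set_digit n d i a ` {..<d i} \<subseteq> ?S"
      using set_digit_less[OF i a] digit_set_digit_other[OF i] by auto
  qed
  moreover have "inj_on (set_digit n d i a) {..<d i}"
    by (rule inj_onI) (metis digit_set_digit_same lessThan_iff)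
  moreover have "(\<Sum>b<dimA n d. if (\<forall>j<n. j \<noteq> i \<longrightarrow> digit n d j a = digit n d j b) then f b else 0) = sum f ?S"
    by (subst sum.inter_filter[symmetric]) (auto intro!: sum.cong)
  ultimately show ?thesis by (simp add: sum.reindex)
qed

text \<open>Exchanging digit \<open>i\<close> of the index with the separate digit \<open>r\<close>
  is an involution on the pairs (a,r).\<close>

lemma sum_exchange_digit:
  fixes f :: "nat \<Rightarrow> nat \<Rightarrow> 'a :: comm_monoid_add"
  assumes i: "i < n"
  shows "(\<Sum>a<dimA n d. \<Sum>r<d i. f (set_digit n d i a r) (digit n d i a)) = (\<Sum>a<dimA n d. \<Sum>r<d i. f a r)"
proof -
  let ?h = "\<lambda>(a,r). (set_digit n d i a r, digit n d i a)"
  have "(\<Sum>p\<in>{..<dimA n d} \<times> {..<d i}. (\<lambda>(a,r). f a r) (?h p)) = (\<Sum>p\<in>{..<dimA n d} \<times> {..<d i}. (\<lambda>(a,r). f a r) p)"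
    by (rule sum.reindex_bij_witness[where i = ?h and j = ?h])
      (auto simp: digit_set_digit_same set_digit_set_digit set_digit_digit set_digit_less[OF i] digit_less[OF i])
  then show ?thesis by (simp add: sum.cartesian_product case_prod_beta)
qed

end

section \<open>Derivatives of transversal unitaries\<close>

lemma has_vector_derivative_prod:
  fixes f :: "'i \<Rightarrow> real \<Rightarrow> complex"
  assumes "\<And>i. i \<in> I \<Longrightarrow> (f i has_vector_derivative f' i) (at x)"
  shows "((\<lambda>t. \<Prod>i\<in>I. f i t) has_vector_derivative (\<Sum>i\<in>I. f' i * (\<Prod>j\<in>I - {i}. f j x))) (at x)"
proof -
  have "((\<lambda>t. \<Prod>i\<in>I. f i t) has_derivative (\<lambda>y. \<Sum>i\<in>I. (y *\<^sub>R f' i) * (\<Prod>j\<in>I - {i}. f j x))) (at x)"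
    by (rule has_derivative_prod) (use assms in \<open>auto simp: has_vector_derivative_def\<close>)
  then show ?thesis by (simp add: has_vector_derivative_def scaleR_sum_right)
qed

text \<open>The expectation in \<open>v\<close> of the sum of all \<open>T i\<close>, each acting on
  subsystem \<open>i\<close>.\<close>

definition charge :: "nat \<Rightarrow> (nat \<Rightarrow> nat) \<Rightarrow> (nat \<Rightarrow> complex mat) \<Rightarrow> (nat \<Rightarrow> complex) \<Rightarrow> complex" where
  "charge n d T v = (\<Sum>i<n. \<Sum>b<dimA n d. \<Sum>r<d i. T i $$ (digit n d i b, r) * cnj (v b) * v (set_digit n d i b r))"

text \<open>At t = 0 every tensor factor is the identity, so each term of the product rule retains a
  single differentiated factor.\<close>

lemma expectation_derivative:
  assumes pos: "\<And>i. i < n \<Longrightarrow> 0 < d i"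
    and W: "\<And>i t. i < n \<Longrightarrow> W i t \<in> carrier_mat (d i) (d i)" and W0: "\<And>i. i < n \<Longrightarrow> W i 0 = 1\<^sub>m (d i)"
    and deriv: "\<And>i r s. i < n \<Longrightarrow> r < d i \<Longrightarrow> s < d i \<Longrightarrow> ((\<lambda>t. W i t $$ (r,s)) has_vector_derivative \<i> * T i $$ (r,s)) (at 0)"
  shows "((\<lambda>t. \<Sum>a<dimA n d. \<Sum>b<dimA n d. cnj (v a) * (kron_all n (\<lambda>i. W i t) $$ (a,b) * v b)) has_vector_derivative
      \<i> * charge n d T v) (at 0)" (is "(?g has_vector_derivative _) _")
    and "(\<Sum>a<dimA n d. \<Sum>b<dimA n d. cnj (v a) * (kron_all n (\<lambda>i. W i 0) $$ (a,b) * v b)) = (\<Sum>a<dimA n d. cnj (v a) * v a)"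
proof -
  let ?A = "dimA n d" and ?D = "\<lambda>i a. digit n d i a"
  note dl = digit_less[of n d, OF pos]
  have ent: "kron_all n (\<lambda>i. W i t) $$ (a,b) = (\<Prod>i<n. W i t $$ (?D i a, ?D i b))" if "a < ?A" "b < ?A" for t a b
    by (rule kron_all_entry(2)[OF pos W that])
  have one: "W i 0 $$ (?D i a, ?D i b) = (if ?D i a = ?D i b then 1 else 0)" if "i < n" for i a b
    using W0[OF that] dl[OF _ that] that by simp
  define ag where "ag i a b \<longleftrightarrow> (\<forall>j<n. j \<noteq> i \<longrightarrow> ?D j a = ?D j b)" for i a b
  have prod_if: "(\<Prod>j\<in>J. if P j then 1 else 0) = (if \<forall>j\<in>J. P j then 1 else (0::complex))" if "finite J" for J :: "nat set" and P
    using that by (induction J rule: finite_induct) auto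
  have dent: "((\<lambda>t. kron_all n (\<lambda>i. W i t) $$ (a,b)) has_vector_derivative
      (\<Sum>i<n. \<i> * T i $$ (?D i a, ?D i b) * (if ag i a b then 1 else 0))) (at 0)"
    if ab: "a < ?A" "b < ?A" for a b
  proof -
    have "((\<lambda>t. \<Prod>i<n. W i t $$ (?D i a, ?D i b)) has_vector_derivative
      (\<Sum>i<n. \<i> * T i $$ (?D i a, ?D i b) * (\<Prod>j\<in>{..<n} - {i}. W j 0 $$ (?D j a, ?D j b)))) (at 0)"
      by (intro has_vector_derivative_prod deriv dl) auto
    moreover have "(\<Prod>j\<in>{..<n} - {i}. W j 0 $$ (?D j a, ?D j b)) = (if ag i a b then 1 else 0)" for i
    proof -
      have "(\<Prod>j\<in>{..<n} - {i}. W j 0 $$ (?D j a, ?D j b)) = (\<Prod>j\<in>{..<n} - {i}. if ?D j a = ?D j b then 1 else 0)"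
        by (intro prod.cong refl) (simp add: one)
      also have "\<dots> = (if \<forall>j\<in>{..<n} - {i}. ?D j a = ?D j b then 1 else 0)" by (rule prod_if) simp
      also have "(\<forall>j\<in>{..<n} - {i}. ?D j a = ?D j b) \<longleftrightarrow> ag i a b" by (auto simp: ag_def)
      finally show ?thesis .
    qed
    ultimately show ?thesis by (simp only: ent[OF ab])
  qed
  have "(?g has_vector_derivative (\<Sum>a<?A. \<Sum>b<?A. cnj (v a) *
      ((\<Sum>i<n. \<i> * T i $$ (?D i a, ?D i b) * (if ag i a b then 1 else 0)) * v b))) (at 0)"
    by (intro has_vector_derivative_sum has_vector_derivative_mult_right has_vector_derivative_mult_left dent) auto
  moreover have "(\<Sum>a<?A. \<Sum>b<?A. cnj (v a) *
      ((\<Sum>i<n. \<i> * T i $$ (?D i a, ?D i b) * (if ag i a b then 1 else 0)) * v b))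
    = \<i> * charge n d T v"
  proof -
    have "(\<Sum>a<?A. \<Sum>b<?A. cnj (v a) *
      ((\<Sum>i<n. \<i> * T i $$ (?D i a, ?D i b) * (if ag i a b then 1 else 0)) * v b))
     = (\<Sum>a<?A. \<Sum>b<?A. \<Sum>i<n. if ag i a b then \<i> * (T i $$ (?D i a, ?D i b) * cnj (v a) * v b) else 0)"
      unfolding sum_distrib_left sum_distrib_right by (intro sum.cong refl) simp
    also have "\<dots> = (\<Sum>a<?A. \<Sum>i<n. \<Sum>b<?A. if ag i a b then \<i> * (T i $$ (?D i a, ?D i b) * cnj (v a) * v b) else 0)"
      by (intro sum.cong refl sum.swap)
    also have "\<dots> = (\<Sum>a<?A. \<Sum>i<n. \<Sum>r<d i. \<i> * (T i $$ (?D i a, r) * cnj (v a) * v (set_digit n d i a r)))"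
    proof (rule sum.cong[OF refl], rule sum.cong[OF refl])
      fix a i assume "a \<in> {..<?A}" "i \<in> {..<n}"
      then have ai: "a < ?A" "i < n" by auto
      show "(\<Sum>b<?A. if ag i a b then \<i> * (T i $$ (?D i a, ?D i b) * cnj (v a) * v b) else 0)
        = (\<Sum>r<d i. \<i> * (T i $$ (?D i a, r) * cnj (v a) * v (set_digit n d i a r)))"
      proof -
        let ?f = "\<lambda>b. \<i> * (T i $$ (?D i a, ?D i b) * cnj (v a) * v b)"
        have "(\<Sum>b<?A. if ag i a b then ?f b else 0) = (\<Sum>r<d i. ?f (set_digit n d i a r))"
          unfolding ag_def by (rule sum_agree_off[of n d, OF pos ai(2,1)])
        also have "\<dots> = (\<Sum>r<d i. \<i> * (T i $$ (?D i a, r) * cnj (v a) * v (set_digit n d i a r)))"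
          by (intro sum.cong refl) (simp add: digit_set_digit_same[of n d, OF pos])
        finally show ?thesis .
      qed
    qed
    also have "\<dots> = \<i> * charge n d T v"
      unfolding charge_def sum_distrib_left by (rule sum.swap)
    finally show ?thesis .
  qed
  ultimately show "(?g has_vector_derivative \<i> * charge n d T v) (at 0)" by (simp only:)
  have "kron_all n (\<lambda>i. W i 0) $$ (a,b) = (if b = a then 1 else 0)" if ab: "a < ?A" "b < ?A" for a b
  proof -
    have "kron_all n (\<lambda>i. W i 0) $$ (a,b) = (\<Prod>i<n. if ?D i a = ?D i b then 1 else 0)"
      unfolding ent[OF ab] by (intro prod.cong refl) (simp add: one)
    also have "\<dots> = (if \<forall>i\<in>{..<n}. ?D i a = ?D i b then 1 else 0)" by (rule prod_if) simp
    also have "(\<forall>i\<in>{..<n}. ?D i a = ?D i b) \<longleftrightarrow> b = a"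
      using digits_inject[of n d, OF pos ab] by auto
    finally show ?thesis .
  qed
  then have "(\<Sum>a<?A. \<Sum>b<?A. cnj (v a) * (kron_all n (\<lambda>i. W i 0) $$ (a,b) * v b))
    = (\<Sum>a<?A. \<Sum>b<?A. if b = a then cnj (v a) * v a else 0)"
    by (intro sum.cong refl) simp
  then show "(\<Sum>a<?A. \<Sum>b<?A. cnj (v a) * (kron_all n (\<lambda>i. W i 0) $$ (a,b) * v b)) = (\<Sum>a<?A. cnj (v a) * v a)"
    by simp
qed

text \<open>Covariance applied to the matrix unit \<open>|0\<rangle>\<langle>d\<^sub>L - 1|\<close>, which the torus multiplies by a phase;
  its derivative compares the charges of the two codewords.\<close>
lemma charge_difference:
  assumes code: "transversal_covariant_code n d dL V Ur" and pos: "\<And>i. i < n \<Longrightarrow> 0 < d i" and dL: "2 \<le> dL"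
    and deriv: "\<And>i r s. i < n \<Longrightarrow> r < d i \<Longrightarrow> s < d i \<Longrightarrow>
      ((\<lambda>t. Ur i (torus dL (coroot 0 (dL - 1) t)) $$ (r,s)) has_vector_derivative \<i> * T i $$ (r,s)) (at 0)"
  shows "Re (charge n d T (\<lambda>a. V $$ (a,0))) - Re (charge n d T (\<lambda>a. V $$ (a,dL - 1))) = 2"
proof -
  let ?A = "dimA n d" and ?N = "dL - 1"
  have ab: "0 < dL" "?N < dL" "0 \<noteq> ?N" using dL by auto
  have V: "V \<in> carrier_mat ?A dL" "adj V * V = 1\<^sub>m dL" using code by (auto simp: transversal_covariant_code_def)
  have rep: "cont_unitary_rep dL (d i) (Ur i)" if "i < n" for i using code that by (simp add: transversal_covariant_code_def)
  define Dt where "Dt t = torus dL (coroot 0 ?N t)" for t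
  have SU: "Dt t \<in> SU dL" for t unfolding Dt_def by (rule torus_SU[OF sum_coroot_zero[OF ab]])
  have D0: "Dt 0 = 1\<^sub>m dL"
    unfolding Dt_def torus_zero[symmetric] by (rule torus_cong) (simp add: coroot_def)
  define W where "W i t = Ur i (Dt t)" for i t
  have W: "W i t \<in> carrier_mat (d i) (d i)" if "i < n" for i t
    using rep[OF that] SU unfolding W_def cont_unitary_rep_def by blast
  have W0: "W i 0 = 1\<^sub>m (d i)" if "i < n" for i unfolding W_def D0 by (rule rep_one[OF rep[OF that]])
  have dW: "((\<lambda>t. W i t $$ (r,s)) has_vector_derivative \<i> * T i $$ (r,s)) (at 0)" if "i < n" "r < d i" "s < d i" for i r s
    unfolding W_def Dt_def by (rule deriv[OF that])
  let ?U = "\<lambda>t. kron_all n (\<lambda>i. W i t)"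
  have U: "?U t \<in> carrier_mat ?A ?A" for t by (rule kron_all_entry(1)[OF pos W])
  define v where "v x a = V $$ (a,x)" for x a
  define g where "g x t = (\<Sum>a<?A. \<Sum>b<?A. cnj (v x a) * (?U t $$ (a,b) * v x b))" for x t
  have dg: "(g x has_vector_derivative \<i> * charge n d T (v x)) (at 0)" for x
    unfolding g_def by (rule expectation_derivative(1)[OF pos W W0 dW])
  have g0: "g x 0 = 1" if "x < dL" for x
  proof -
    have "g x 0 = (\<Sum>a<?A. cnj (v x a) * v x a)"
      unfolding g_def by (rule expectation_derivative(2)[OF pos W W0 dW])
    then show ?thesis using isometry_cols[OF V that that] by (simp add: v_def)
  qed
  define X where "X = mat dL dL (\<lambda>(p,q). if p = 0 \<and> q = ?N then 1 else (0::complex))"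
  have X: "X \<in> carrier_mat dL dL" by (simp add: X_def)
  have EX: "encoding V Y $$ (a,b) = (\<Sum>l<dL. \<Sum>l'<dL. V $$ (a,l) * Y $$ (l,l') * cnj (V $$ (b,l')))"
    if "Y \<in> carrier_mat dL dL" "a < ?A" "b < ?A" for Y a b
    unfolding encoding_def by (rule kraus_entry[OF V(1) that])
  have collapse: "(\<Sum>l<dL. \<Sum>l'<dL. f l * (z * X $$ (l,l')) * h l') = f 0 * z * h ?N" for f h :: "nat \<Rightarrow> complex" and z
  proof -
    have "(\<Sum>l<dL. \<Sum>l'<dL. f l * (z * X $$ (l,l')) * h l') = (\<Sum>l<dL. \<Sum>l'<dL. if l' = ?N then (if l = 0 then f 0 * z * h ?N else 0) else 0)"
      by (intro sum.cong refl) (simp add: X_def)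
    also have "\<dots> = f 0 * z * h ?N" using ab by simp
    finally show ?thesis .
  qed
  \<comment> \<open>The encoded matrix unit is sandwiched between the two codewords. The phase that
    covariance leaves open on the code enters both factors and cancels in this product.\<close>
  have "g 0 t * cnj (g ?N t) = cis (2 * t)" for t
  proof -
    have cX: "Dt t * X * adj (Dt t) \<in> carrier_mat dL dL"
      by (intro mult_carrier_mat[of _ dL dL]) (simp_all add: Dt_def X)
    have "(Dt t * X * adj (Dt t)) $$ (p,q) = cis (2 * t) * X $$ (p,q)" if pq: "p < dL" "q < dL" for p q
    proof -
      have "(cdiag dL f * X * cdiag dL h) $$ (p,q) = (f p * X $$ (p,q)) * h q" for f h
        by (simp only: mult_cdiag_entry[OF mult_carrier_mat[OF cdiag_carrier X] pq] cdiag_mult_entry[OF X pq])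
      then      have "(Dt t * X * adj (Dt t)) $$ (p,q) = (cis (coroot 0 ?N t p) * X $$ (p,q)) * cis (- coroot 0 ?N t q)"
        unfolding Dt_def adj_torus unfolding torus_def by this
      moreover have "cis (coroot 0 ?N t 0) * cis (- coroot 0 ?N t ?N) = cis (2 * t)"
        using ab by (simp add: coroot_def cis_mult)
      ultimately show ?thesis using pq by (auto simp: X_def)
    qed
    then have L: "encoding V (Dt t * X * adj (Dt t)) $$ (a,b) = v 0 a * cis (2 * t) * cnj (v ?N b)" if "a < ?A" "b < ?A" for a b
      unfolding EX[OF cX that] v_def collapse[of "\<lambda>l. V $$ (a,l)" "cis (2 * t)" "\<lambda>l. cnj (V $$ (b,l))", symmetric]
      by (intro sum.cong refl) simp
    have E1: "encoding V X $$ (a,b) = v 0 a * cnj (v ?N b)" if "a < ?A" "b < ?A" for a b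
      unfolding EX[OF X that] v_def using collapse[of "\<lambda>l. V $$ (a,l)" 1 "\<lambda>l. cnj (V $$ (b,l))"] by simp
    have EV: "encoding V X \<in> carrier_mat ?A ?A" unfolding encoding_def
      using V X by (intro mult_carrier_mat[of _ _ dL] mult_carrier_mat[of _ _ dL]) auto
    have "encoding V (Dt t * X * adj (Dt t)) = ?U t * encoding V X * adj (?U t)"
      using code SU X unfolding transversal_covariant_code_def W_def by blast
    then have R: "encoding V (Dt t * X * adj (Dt t)) $$ (a,b) = (\<Sum>c<?A. \<Sum>c'<?A. ?U t $$ (a,c) * (v 0 c * cnj (v ?N c')) * cnj (?U t $$ (b,c')))"
      if "a < ?A" "b < ?A" for a b
      using kraus_entry[OF U EV that, of t] by (simp add: E1)
    have LR: "v 0 a * cis (2 * t) * cnj (v ?N b) = (\<Sum>c<?A. \<Sum>c'<?A. ?U t $$ (a,c) * (v 0 c * cnj (v ?N c')) * cnj (?U t $$ (b,c')))"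
      if "a < ?A" "b < ?A" for a b
      by (simp only: L[OF that, symmetric] R[OF that])
    have cg: "cnj (g ?N t) = (\<Sum>b<?A. \<Sum>c'<?A. cnj (?U t $$ (b,c')) * cnj (v ?N c') * v ?N b)"
      by (simp add: g_def mult_ac)
    have norms: "(\<Sum>a<?A. cnj (v 0 a) * v 0 a) = 1" "(\<Sum>b<?A. cnj (v ?N b) * v ?N b) = 1"
      using isometry_cols[OF V ab(1,1)] isometry_cols[OF V ab(2,2)] by (simp_all add: v_def)
    have "cis (2 * t) = (\<Sum>a<?A. cnj (v 0 a) * v 0 a) * (\<Sum>b<?A. cis (2 * t) * (cnj (v ?N b) * v ?N b))"
      by (simp only: norms sum_distrib_left[symmetric] mult_1 mult_1_right)
    also have "\<dots> = (\<Sum>a<?A. \<Sum>b<?A. cnj (v 0 a) * (v 0 a * cis (2 * t) * cnj (v ?N b)) * v ?N b)"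
      unfolding sum_product by (intro sum.cong refl) (simp only: mult_ac)
    also have "\<dots> = (\<Sum>a<?A. \<Sum>b<?A. cnj (v 0 a) * (\<Sum>c<?A. \<Sum>c'<?A. ?U t $$ (a,c) * (v 0 c * cnj (v ?N c')) * cnj (?U t $$ (b,c'))) * v ?N b)"
      by (intro sum.cong refl) (simp only: lessThan_iff LR)
    also have "\<dots> = (\<Sum>a<?A. \<Sum>b<?A. (\<Sum>c<?A. cnj (v 0 a) * (?U t $$ (a,c) * v 0 c)) * (\<Sum>c'<?A. cnj (?U t $$ (b,c')) * cnj (v ?N c') * v ?N b))"
      unfolding sum_product unfolding sum_distrib_left sum_distrib_right by (intro sum.cong refl) (simp only: mult_ac)
    also have "\<dots> = g 0 t * cnj (g ?N t)"
      unfolding cg unfolding g_def by (rule sum_product[symmetric])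
    finally show ?thesis by simp
  qed
  then have eq: "(\<lambda>t. g 0 t * cnj (g ?N t)) = (\<lambda>t. cis (2 * t))" by (rule ext)
  have "((\<lambda>t. g 0 t * cnj (g ?N t)) has_vector_derivative
     g 0 0 * cnj (\<i> * charge n d T (v ?N)) + \<i> * charge n d T (v 0) * cnj (g ?N 0)) (at 0)"
    by (intro has_vector_derivative_mult dg has_vector_derivative_cnj)
  then have d1: "((\<lambda>t. cis (2 * t)) has_vector_derivative cnj (\<i> * charge n d T (v ?N)) + \<i> * charge n d T (v 0)) (at 0)"
    unfolding eq g0[OF ab(1)] g0[OF ab(2)] by simp
  have d2: "((\<lambda>t. cis (2 * t)) has_vector_derivative cis (2 * 0) * (\<i> * complex_of_real (2 * 1))) (at 0)"
    by (rule has_vector_derivative_cis[OF DERIV_ident])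
  have "cnj (\<i> * charge n d T (v ?N)) + \<i> * charge n d T (v 0) = cis (2 * 0) * (\<i> * complex_of_real (2 * 1))"
    by (rule has_vector_derivative_eventually_eq[OF _ d1 d2]) simp
  \<comment> \<open>In the imaginary part, conjugation reverses the sign of the second charge, and
    cis (2 t) contributes its slope 2.\<close>
  from arg_cong[OF this, of Im] show ?thesis by (simp add: v_def[abs_def])
qed

section \<open>Infidelity of covariant codes\<close>

lemma cauchy_schwarz_sum:
  fixes a b :: "'i \<Rightarrow> real"
  shows "(\<Sum>i\<in>I. a i * b i)\<^sup>2 \<le> (\<Sum>i\<in>I. (a i)\<^sup>2) * (\<Sum>i\<in>I. (b i)\<^sup>2)"
proof -
  have "0 \<le> (\<Sum>i\<in>I. \<Sum>j\<in>I. (a i * b j - a j * b i)\<^sup>2)" by (intro sum_nonneg) simp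
  also have "\<dots> = (\<Sum>i\<in>I. \<Sum>j\<in>I. (a i)\<^sup>2 * (b j)\<^sup>2) + (\<Sum>i\<in>I. \<Sum>j\<in>I. (b i)\<^sup>2 * (a j)\<^sup>2)
      - 2 * (\<Sum>i\<in>I. \<Sum>j\<in>I. (a i * b i) * (a j * b j))"
    unfolding sum_distrib_left sum.distrib[symmetric] sum_subtractf[symmetric]
    by (intro sum.cong refl) (simp add: power2_eq_square algebra_simps)
  also have "\<dots> = 2 * ((\<Sum>i\<in>I. (a i)\<^sup>2) * (\<Sum>i\<in>I. (b i)\<^sup>2)) - 2 * (\<Sum>i\<in>I. a i * b i)\<^sup>2"
    unfolding sum_product[symmetric] by (simp add: power2_eq_square)
  finally show ?thesis by simp
qed

lemma cauchy_schwarz_Re: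
  fixes f g :: "'i \<Rightarrow> complex"
  shows "Re (\<Sum>i\<in>I. cnj (f i) * g i) \<le> sqrt (\<Sum>i\<in>I. (cmod (f i))\<^sup>2) * sqrt (\<Sum>i\<in>I. (cmod (g i))\<^sup>2)"
proof -
  have "Re (\<Sum>i\<in>I. cnj (f i) * g i) \<le> (\<Sum>i\<in>I. cmod (f i) * cmod (g i))"
    unfolding Re_sum
  proof (rule sum_mono)
    fix i show "Re (cnj (f i) * g i) \<le> cmod (f i) * cmod (g i)"
      using complex_Re_le_cmod[of "cnj (f i) * g i"] by (simp add: norm_mult)
  qed
  also have "\<dots> \<le> sqrt ((\<Sum>i\<in>I. (cmod (f i))\<^sup>2) * (\<Sum>i\<in>I. (cmod (g i))\<^sup>2))"
    by (rule real_le_rsqrt[OF cauchy_schwarz_sum])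
  finally show ?thesis by (simp add: real_sqrt_mult)
qed

text \<open>Since \<open>X\<close> is self-adjoint, the expectation of \<open>X\<close> in \<open>\<Phi>\<close> is the real part of
  \<open>\<langle>\<Phi> - u | X (\<Phi> + u)\<rangle>\<close>, and \<open>\<parallel>\<Phi> - u\<parallel>\<^sup>2 = 1 - F2\<close>, \<open>\<parallel>\<Phi> + u\<parallel>\<^sup>2 = 1 + 3 F2 \<le> 4\<close>.\<close>
lemma expectation_perturbation:
  fixes X :: "('w \<Rightarrow> complex) \<Rightarrow> 'w \<Rightarrow> complex" and \<Phi> u :: "'w \<Rightarrow> complex"
  assumes norm: "(\<Sum>w\<in>\<Omega>. (cmod (\<Phi> w))\<^sup>2) = 1" and uu: "(\<Sum>w\<in>\<Omega>. (cmod (u w))\<^sup>2) = F2"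
    and u\<Phi>: "(\<Sum>w\<in>\<Omega>. cnj (u w) * \<Phi> w) = complex_of_real F2"
    and add: "X (\<lambda>w. \<Phi> w + u w) = (\<lambda>w. X \<Phi> w + X u w)"
    and herm: "(\<Sum>w\<in>\<Omega>. cnj (u w) * X \<Phi> w) = cnj (\<Sum>w\<in>\<Omega>. cnj (\<Phi> w) * X u w)"
    and zero: "(\<Sum>w\<in>\<Omega>. cnj (u w) * X u w) = 0" and C: "0 \<le> C"
    and bound: "\<And>f. (\<Sum>w\<in>\<Omega>. (cmod (X f w))\<^sup>2) \<le> C\<^sup>2 * (\<Sum>w\<in>\<Omega>. (cmod (f w))\<^sup>2)"
  shows "Re (\<Sum>w\<in>\<Omega>. cnj (\<Phi> w) * X \<Phi> w) \<le> 2 * C * sqrt (1 - F2)"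
proof -
  let ?m = "\<lambda>w. \<Phi> w - u w" and ?p = "\<lambda>w. \<Phi> w + u w"
  have cross: "(\<Sum>w\<in>\<Omega>. Re (cnj (u w) * \<Phi> w)) = F2" using u\<Phi> by (metis Re_complex_of_real Re_sum)
  have nm: "(cmod (\<Phi> w - u w))\<^sup>2 = (cmod (\<Phi> w))\<^sup>2 + (cmod (u w))\<^sup>2 - 2 * Re (cnj (u w) * \<Phi> w)"
    and np: "(cmod (\<Phi> w + u w))\<^sup>2 = (cmod (\<Phi> w))\<^sup>2 + (cmod (u w))\<^sup>2 + 2 * Re (cnj (u w) * \<Phi> w)" for w
    unfolding cmod_power2 by (simp_all add: power2_eq_square algebra_simps)
  have m: "(\<Sum>w\<in>\<Omega>. (cmod (?m w))\<^sup>2) = 1 - F2"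
    unfolding nm sum.distrib sum_subtractf sum_distrib_left[symmetric] norm uu cross by simp
  have p: "(\<Sum>w\<in>\<Omega>. (cmod (?p w))\<^sup>2) = 1 + 3 * F2"
    unfolding np sum.distrib sum_distrib_left[symmetric] norm uu cross by simp
  have F0: "0 \<le> F2" unfolding uu[symmetric] by (intro sum_nonneg) simp
  have F1: "0 \<le> 1 - F2" unfolding m[symmetric] by (intro sum_nonneg) simp
  then have F1': "F2 \<le> 1" by simp
  \<comment> \<open>By \<open>herm\<close> the two mixed terms are conjugate, so their difference is
    imaginary and drops out of the real part.\<close>
  have "(\<Sum>w\<in>\<Omega>. cnj (?m w) * X ?p w) = (\<Sum>w\<in>\<Omega>. cnj (\<Phi> w) * X \<Phi> w) + (\<Sum>w\<in>\<Omega>. cnj (\<Phi> w) * X u w)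
      - (\<Sum>w\<in>\<Omega>. cnj (u w) * X \<Phi> w) - (\<Sum>w\<in>\<Omega>. cnj (u w) * X u w)"
    unfolding add sum.distrib[symmetric] sum_subtractf[symmetric] by (intro sum.cong refl) (simp add: algebra_simps)
  then have "Re (\<Sum>w\<in>\<Omega>. cnj (\<Phi> w) * X \<Phi> w) = Re (\<Sum>w\<in>\<Omega>. cnj (?m w) * X ?p w)"
    unfolding herm zero by simp
  also have "\<dots> \<le> sqrt (\<Sum>w\<in>\<Omega>. (cmod (?m w))\<^sup>2) * sqrt (\<Sum>w\<in>\<Omega>. (cmod (X ?p w))\<^sup>2)"
    by (rule cauchy_schwarz_Re)
  also have "\<dots> \<le> sqrt (1 - F2) * sqrt (C\<^sup>2 * (1 + 3 * F2))"
    unfolding m using bound[of ?p] unfolding p by (intro mult_left_mono) (simp_all add: F1')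
  also have "\<dots> = C * sqrt (1 - F2) * sqrt (1 + 3 * F2)" using C by (simp add: real_sqrt_mult)
  also have "\<dots> \<le> C * sqrt (1 - F2) * sqrt (2\<^sup>2)"
  proof (rule mult_left_mono)
    show "sqrt (1 + 3 * F2) \<le> sqrt (2\<^sup>2)" by (rule real_sqrt_le_mono) (use F1' in simp)
  qed (use C F1 in simp)
  finally show ?thesis by simp
qed

text \<open>Kraus operators of the noisy code: subsystem \<open>i\<close> is erased and the environment finds it in the basis
  state \<open>r\<close>.\<close>
definition noise_kraus :: "nat \<Rightarrow> (nat \<Rightarrow> nat) \<Rightarrow> nat \<Rightarrow> complex mat \<Rightarrow> (nat \<Rightarrow> complex vec) \<Rightarrow> nat \<times> nat \<Rightarrow> complex mat" where
  "noise_kraus n d dL V \<phi> = (\<lambda>(i,r). mat (n * dimA n d) dL (\<lambda>(p,j). if p div dimA n d = i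
     then complex_of_real (1 / sqrt (real n)) * \<phi> i $ digit n d i (p mod dimA n d) * V $$ (set_digit n d i (p mod dimA n d) r, j)
     else 0))"

section \<open>Kraus form of the erased code and observables of the environment\<close>

lemma noise_kraus_carrier [simp]: "noise_kraus n d dL V \<phi> x \<in> carrier_mat (n * dimA n d) dL"
  by (simp add: noise_kraus_def case_prod_beta)

lemma noisy_code_carrier: "noisy_code n d V \<phi> X \<in> carrier_mat (n * dimA n d) (n * dimA n d)"
  by (simp add: noisy_code_def erasure_noise_def msum_def)

lemma dimA_pos: "(\<And>i. i < n \<Longrightarrow> 0 < d i) \<Longrightarrow> 0 < dimA n d"
  unfolding dimA_def by (intro prod_pos) auto

text \<open>The partial trace supplies the sum over \<open>r\<close>, the probability 1/n is shared
  evenly by the two Kraus factors, and blocks belonging to other locations vanish because of the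
  register.\<close>

lemma noisy_code_kraus:
  assumes pos: "\<And>i. i < n \<Longrightarrow> 0 < d i" and V: "V \<in> carrier_mat (dimA n d) dL" and X: "X \<in> carrier_mat dL dL"
    and pq: "p < n * dimA n d" "q < n * dimA n d"
  shows "noisy_code n d V \<phi> X $$ (p,q) = (\<Sum>i<n. \<Sum>r<d i. \<Sum>l<dL. \<Sum>l'<dL.
    noise_kraus n d dL V \<phi> (i,r) $$ (p,l) * X $$ (l,l') * cnj (noise_kraus n d dL V \<phi> (i,r) $$ (q,l')))"
proof -
  let ?A = "dimA n d" and ?e = "complex_of_real (1 / sqrt (real n))"
  let ?Y = "encoding V X"
  have A: "0 < ?A" by (rule dimA_pos[OF pos])
  have n: "0 < n" using pq by (cases n) auto
  have pm: "p mod ?A < ?A" "q mod ?A < ?A" using A by auto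
  have pd: "p div ?A < n" "q div ?A < n" using pq by (auto simp: less_mult_imp_div_less)
  have ee: "?e * ?e = complex_of_real (1 / real n)"
    unfolding of_real_mult[symmetric] using n by simp
  have "noisy_code n d V \<phi> X $$ (p,q) = (\<Sum>i<n. complex_of_real (1 / real n) * kron (ket_bra n i i) (replace_factor n d (\<phi> i) i ?Y) $$ (p,q))"
  proof -
    have "kron (ket_bra n i i) (replace_factor n d (\<phi> i) i ?Y) \<in> carrier_mat (n * ?A) (n * ?A)" for i
      by (auto simp: kron_def ket_bra_def replace_factor_def)
    note c = carrier_matD[OF this]
    show ?thesis using pq by (simp add: noisy_code_def erasure_noise_def msum_def c)
  qed
  also have "\<dots> = (\<Sum>i<n. \<Sum>r<d i. \<Sum>l<dL. \<Sum>l'<dL.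
    noise_kraus n d dL V \<phi> (i,r) $$ (p,l) * X $$ (l,l') * cnj (noise_kraus n d dL V \<phi> (i,r) $$ (q,l')))"
  proof (rule sum.cong[OF refl])
    fix i assume "i \<in> {..<n}"
    then have i: "i < n" by simp
    show "complex_of_real (1 / real n) * kron (ket_bra n i i) (replace_factor n d (\<phi> i) i ?Y) $$ (p,q)
      = (\<Sum>r<d i. \<Sum>l<dL. \<Sum>l'<dL.
          noise_kraus n d dL V \<phi> (i,r) $$ (p,l) * X $$ (l,l') * cnj (noise_kraus n d dL V \<phi> (i,r) $$ (q,l')))"
    proof (cases "p div ?A = i \<and> q div ?A = i")
      case True
      let ?a = "\<phi> i $ digit n d i (p mod ?A)" and ?b = "\<phi> i $ digit n d i (q mod ?A)"
      have "kron (ket_bra n i i) (replace_factor n d (\<phi> i) i ?Y) $$ (p,q) = replace_factor n d (\<phi> i) i ?Y $$ (p mod ?A, q mod ?A)"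
        using True pq pd i by (simp add: kron_def ket_bra_def replace_factor_def)
      also have "\<dots> = ?a * cnj ?b * (\<Sum>r<d i. ?Y $$ (set_digit n d i (p mod ?A) r, set_digit n d i (q mod ?A) r))"
        using pm by (simp add: replace_factor_def)
      finally have "complex_of_real (1 / real n) * kron (ket_bra n i i) (replace_factor n d (\<phi> i) i ?Y) $$ (p,q)
        = (\<Sum>r<d i. (?e * ?e) * (?a * cnj ?b * ?Y $$ (set_digit n d i (p mod ?A) r, set_digit n d i (q mod ?A) r)))"
        unfolding ee by (simp only: sum_distrib_left mult.assoc)
      also have "\<dots> = (\<Sum>r<d i. \<Sum>l<dL. \<Sum>l'<dL.
          noise_kraus n d dL V \<phi> (i,r) $$ (p,l) * X $$ (l,l') * cnj (noise_kraus n d dL V \<phi> (i,r) $$ (q,l')))"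
      proof (rule sum.cong[OF refl])
        fix r assume "r \<in> {..<d i}"
        then have r: "r < d i" by simp
        have sd: "set_digit n d i a r < ?A" if "a < ?A" for a by (rule set_digit_less[of n d, OF pos i that r])
        have nk: "noise_kraus n d dL V \<phi> (i,r) $$ (p,l) = ?e * ?a * V $$ (set_digit n d i (p mod ?A) r, l)"
          "noise_kraus n d dL V \<phi> (i,r) $$ (q,l) = ?e * ?b * V $$ (set_digit n d i (q mod ?A) r, l)" if "l < dL" for l
          using that pq True by (simp_all add: noise_kraus_def)
        have ce: "cnj ?e = ?e" by (rule complex_cnj_complex_of_real)
        have Ye: "?Y $$ (set_digit n d i (p mod ?A) r, set_digit n d i (q mod ?A) r) = (\<Sum>l<dL. \<Sum>l'<dL.
          V $$ (set_digit n d i (p mod ?A) r, l) * X $$ (l,l') * cnj (V $$ (set_digit n d i (q mod ?A) r, l')))"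
          unfolding encoding_def by (rule kraus_entry[OF V X sd[OF pm(1)] sd[OF pm(2)]])
        show "(?e * ?e) * (?a * cnj ?b * ?Y $$ (set_digit n d i (p mod ?A) r, set_digit n d i (q mod ?A) r))
          = (\<Sum>l<dL. \<Sum>l'<dL. noise_kraus n d dL V \<phi> (i,r) $$ (p,l) * X $$ (l,l') * cnj (noise_kraus n d dL V \<phi> (i,r) $$ (q,l')))"
          unfolding Ye sum_distrib_left
          by (intro sum.cong refl) (simp only: lessThan_iff nk complex_cnj_mult ce mult_ac)
      qed
      finally show ?thesis .
    next
      case False
      have "kron (ket_bra n i i) (replace_factor n d (\<phi> i) i ?Y) $$ (p,q) = 0"
        using False pq pd i by (auto simp: kron_def ket_bra_def replace_factor_def)
      moreover have z: "noise_kraus n d dL V \<phi> (i,r) $$ (p,l) * X $$ (l,l') * cnj (noise_kraus n d dL V \<phi> (i,r) $$ (q,l')) = 0"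
        if "l < dL" "l' < dL" for r l l'
        using that False pq by (auto simp: noise_kraus_def)
      have "(\<Sum>r<d i. \<Sum>l<dL. \<Sum>l'<dL.
          noise_kraus n d dL V \<phi> (i,r) $$ (p,l) * X $$ (l,l') * cnj (noise_kraus n d dL V \<phi> (i,r) $$ (q,l'))) = 0"
        by (intro sum.neutral ballI) (simp only: lessThan_iff z)
      ultimately show ?thesis by simp
    qed
  qed
  finally show ?thesis .
qed

text \<open>The environment of location \<open>i\<close> holds 1/n times the reduced state of
  subsystem \<open>i\<close>: overlaps of the Kraus operators, paired with \<open>T\<close>, return
  the local expectation in codeword \<open>j\<close>, since the replacement state has norm
  1.\<close>

lemma noise_kraus_form:
  assumes pos: "\<And>i. i < n \<Longrightarrow> 0 < d i" and i: "i < n" and j: "j < dL" and \<phi>: "unit_vec_in (d i) (\<phi> i)"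
  shows "(\<Sum>r<d i. \<Sum>r'<d i. T r r' * (\<Sum>q<n * dimA n d. cnj (noise_kraus n d dL V \<phi> (i,r) $$ (q,j)) * noise_kraus n d dL V \<phi> (i,r') $$ (q,j)))
    = complex_of_real (1 / real n) * (\<Sum>b<dimA n d. \<Sum>r<d i. T (digit n d i b) r * cnj (V $$ (b,j)) * V $$ (set_digit n d i b r, j))"
proof -
  let ?A = "dimA n d" and ?e = "complex_of_real (1 / sqrt (real n))"
  have n: "0 < n" using i by simp
  have A: "0 < ?A" by (rule dimA_pos[OF pos])
  have ee: "?e * ?e = complex_of_real (1 / real n)" unfolding of_real_mult[symmetric] using n by simp
  let ?f = "\<lambda>a. \<phi> i $ digit n d i a"
  have inner: "(\<Sum>q<n * ?A. cnj (noise_kraus n d dL V \<phi> (i,r) $$ (q,j)) * noise_kraus n d dL V \<phi> (i,r') $$ (q,j))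
    = (\<Sum>a<?A. (?e * ?e) * (cnj (?f a) * ?f a) * (cnj (V $$ (set_digit n d i a r, j)) * V $$ (set_digit n d i a r', j)))" (is "?L = ?R") for r r'
  proof -
    let ?h = "\<lambda>a. (?e * ?e) * (cnj (?f a) * ?f a) * (cnj (V $$ (set_digit n d i a r, j)) * V $$ (set_digit n d i a r', j))"
    have "?L = (\<Sum>q<n * ?A. if q div ?A = i then ?h (q mod ?A) else 0)"
      by (intro sum.cong refl) (use j in \<open>simp add: noise_kraus_def mult_ac\<close>)
    also have "\<dots> = (\<Sum>q\<in>{q. q < n * ?A \<and> q div ?A = i}. ?h (q mod ?A))"
      by (subst sum.inter_filter[symmetric]) (auto intro!: sum.cong)
    also have "\<dots> = (\<Sum>a<?A. ?h a)"
    proof (rule sum.reindex_bij_witness[where i = "\<lambda>a. i * ?A + a" and j = "\<lambda>q. q mod ?A"])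
      fix a assume "a \<in> {..<?A}"
      then have a: "a < ?A" by simp
      have "i * ?A + a < Suc i * ?A" using a by simp
      also have "\<dots> \<le> n * ?A" using i by (intro mult_le_mono1) simp
      finally show "i * ?A + a \<in> {q. q < n * ?A \<and> q div ?A = i}" using a by simp
      show "(i * ?A + a) mod ?A = a" using a by simp
    next
      fix q assume "q \<in> {q. q < n * ?A \<and> q div ?A = i}"
      then show "i * ?A + q mod ?A = q" using div_mult_mod_eq[of q ?A] by auto
    qed (use A in auto)
    finally show ?thesis .
  qed
  let ?G = "\<lambda>b x. \<Sum>r'<d i. (?e * ?e) * (cnj (\<phi> i $ x) * \<phi> i $ x) * (T (digit n d i b) r' * cnj (V $$ (b,j)) * V $$ (set_digit n d i b r', j))"
  have "(\<Sum>r<d i. \<Sum>r'<d i. T r r' * (\<Sum>q<n * ?A. cnj (noise_kraus n d dL V \<phi> (i,r) $$ (q,j)) * noise_kraus n d dL V \<phi> (i,r') $$ (q,j)))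
    = (\<Sum>r<d i. \<Sum>r'<d i. \<Sum>a<?A. T r r' * ((?e * ?e) * (cnj (?f a) * ?f a) * (cnj (V $$ (set_digit n d i a r, j)) * V $$ (set_digit n d i a r', j))))"
    unfolding inner sum_distrib_left ..
  also have "\<dots> = (\<Sum>r<d i. \<Sum>a<?A. \<Sum>r'<d i. T r r' * ((?e * ?e) * (cnj (?f a) * ?f a) * (cnj (V $$ (set_digit n d i a r, j)) * V $$ (set_digit n d i a r', j))))"
    by (intro sum.cong refl sum.swap)
  also have "\<dots> = (\<Sum>a<?A. \<Sum>r<d i. \<Sum>r'<d i. T r r' * ((?e * ?e) * (cnj (?f a) * ?f a) * (cnj (V $$ (set_digit n d i a r, j)) * V $$ (set_digit n d i a r', j))))"
    by (rule sum.swap)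
  \<comment> \<open>The digit kept in the output and the digit \<open>r\<close> held by the
    environment trade places, so that the lost digit becomes part of the codeword index and the sum
    over the replacement state splits off.\<close>
  also have "\<dots> = (\<Sum>a<?A. \<Sum>r<d i. ?G (set_digit n d i a r) (digit n d i a))"
  proof (rule sum.cong[OF refl], rule sum.cong[OF refl], rule sum.cong[OF refl])
    fix a r r' assume "r \<in> {..<d i}"
    then have r: "r < d i" by simp
    show "T r r' * ((?e * ?e) * (cnj (?f a) * ?f a) * (cnj (V $$ (set_digit n d i a r, j)) * V $$ (set_digit n d i a r', j)))
      = (?e * ?e) * (cnj (\<phi> i $ digit n d i a) * \<phi> i $ digit n d i a) * (T (digit n d i (set_digit n d i a r)) r' *
          cnj (V $$ (set_digit n d i a r, j)) * V $$ (set_digit n d i (set_digit n d i a r) r', j))"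
      by (simp only: digit_set_digit_same[of n d, OF pos r] set_digit_set_digit[of n d, OF pos r] mult_ac)
  qed
  also have "\<dots> = (\<Sum>b<?A. \<Sum>x<d i. ?G b x)" by (rule sum_exchange_digit[of n d, OF pos i])
  also have "\<dots> = (\<Sum>b<?A. (\<Sum>x<d i. cnj (\<phi> i $ x) * \<phi> i $ x) * (\<Sum>r'<d i. (?e * ?e) * (T (digit n d i b) r' * cnj (V $$ (b,j)) * V $$ (set_digit n d i b r', j))))"
    unfolding sum_product by (intro sum.cong refl) (simp only: mult_ac)
  also have "\<dots> = complex_of_real (1 / real n) * (\<Sum>b<?A. \<Sum>r<d i. T (digit n d i b) r * cnj (V $$ (b,j)) * V $$ (set_digit n d i b r, j))"
    unfolding unit_vec_in_sum[OF \<phi>] ee by (simp only: mult_1 sum_distrib_left)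
  finally show ?thesis .
qed

text \<open>An observable of the environment, which knows the location \<open>i\<close> and holds
  the state \<open>r\<close> of the lost subsystem, multiplied by a real weight of the remaining
  labels \<open>y\<close>. It acts on functions of the joint index, which keeps blocks of different
  size \<open>d i\<close> together.\<close>

definition block_op :: "(nat \<Rightarrow> nat) \<Rightarrow> (nat \<Rightarrow> complex mat) \<Rightarrow> ('y \<Rightarrow> real) \<Rightarrow>
    ('y \<times> nat \<times> nat \<Rightarrow> complex) \<Rightarrow> 'y \<times> nat \<times> nat \<Rightarrow> complex" where
  "block_op d T w f = (\<lambda>(y,i,r). complex_of_real (w y) * (\<Sum>r'<d i. T i $$ (r,r') * f (y,i,r')))"

abbreviation block_index :: "'y set \<Rightarrow> nat \<Rightarrow> (nat \<Rightarrow> nat) \<Rightarrow> ('y \<times> nat \<times> nat) set" where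
  "block_index Y n d \<equiv> Y \<times> (SIGMA i:{..<n}. {..<d i})"

lemma sum_block_index:
  assumes "finite Y"
  shows "(\<Sum>w\<in>block_index Y n d. f w) = (\<Sum>y\<in>Y. \<Sum>i<n. \<Sum>r<d i. f (y,i,r))"
proof -
  have "(\<Sum>w\<in>block_index Y n d. f w) = (\<Sum>y\<in>Y. \<Sum>z\<in>(SIGMA i:{..<n}. {..<d i}). f (y,z))"
    by (simp add: sum.cartesian_product)
  also have "\<dots> = (\<Sum>y\<in>Y. \<Sum>i<n. \<Sum>r<d i. f (y,i,r))"
    by (intro sum.cong refl) (simp add: sum.Sigma)
  finally show ?thesis .
qed

lemma block_op_add: "block_op d T w (\<lambda>x. f x + g x) = (\<lambda>x. block_op d T w f x + block_op d T w g x)"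
  by (simp add: block_op_def fun_eq_iff distrib_left sum.distrib)

lemma block_op_hermitian:
  assumes Y: "finite Y" and T: "\<And>i. i < n \<Longrightarrow> T i \<in> carrier_mat (d i) (d i)" "\<And>i. i < n \<Longrightarrow> adj (T i) = T i"
  shows "(\<Sum>x\<in>block_index Y n d. cnj (f x) * block_op d T w g x) = cnj (\<Sum>x\<in>block_index Y n d. cnj (g x) * block_op d T w f x)"
proof -
  have "(\<Sum>r<d i. cnj (f (y,i,r)) * block_op d T w g (y,i,r)) = (\<Sum>r<d i. g (y,i,r) * cnj (block_op d T w f (y,i,r)))"
    if i: "i < n" for y i
  proof -
    have Te: "cnj (T i $$ (r,r')) = T i $$ (r',r)" if "r < d i" "r' < d i" for r r'
      using adj_entry[OF T(1)[OF i] that(2,1)] T(2)[OF i] by simp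
    have "(\<Sum>r<d i. cnj (f (y,i,r)) * block_op d T w g (y,i,r))
      = (\<Sum>r<d i. \<Sum>r'<d i. complex_of_real (w y) * (T i $$ (r,r') * (cnj (f (y,i,r)) * g (y,i,r'))))"
      by (simp add: block_op_def sum_distrib_left mult_ac)
    also have "\<dots> = (\<Sum>r'<d i. \<Sum>r<d i. complex_of_real (w y) * (T i $$ (r,r') * (cnj (f (y,i,r)) * g (y,i,r'))))"
      by (rule sum.swap)
    also have "\<dots> = (\<Sum>r'<d i. \<Sum>r<d i. complex_of_real (w y) * (cnj (T i $$ (r',r)) * (cnj (f (y,i,r)) * g (y,i,r'))))"
      by (intro sum.cong refl) (simp only: lessThan_iff Te)
    also have "\<dots> = (\<Sum>r<d i. g (y,i,r) * cnj (block_op d T w f (y,i,r)))"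
      by (simp add: block_op_def sum_distrib_left mult_ac)
    finally show ?thesis .
  qed
  note eq = this
  show ?thesis unfolding sum_block_index[OF Y] cnj_sum complex_cnj_mult complex_cnj_cnj
    by (rule sum.cong[OF refl], rule sum.cong[OF refl]) (simp only: lessThan_iff eq)
qed

lemma block_op_bound:
  assumes Y: "finite Y" and w: "\<And>y. \<bar>w y\<bar> \<le> c" and M: "0 \<le> M"
    and T: "\<And>i x. i < n \<Longrightarrow> (\<Sum>r<d i. (cmod (\<Sum>s<d i. T i $$ (r,s) * x s))\<^sup>2) \<le> M\<^sup>2 * (\<Sum>s<d i. (cmod (x s))\<^sup>2)"
  shows "(\<Sum>x\<in>block_index Y n d. (cmod (block_op d T w f x))\<^sup>2) \<le> (c * M)\<^sup>2 * (\<Sum>x\<in>block_index Y n d. (cmod (f x))\<^sup>2)"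
proof -
  have "(\<Sum>r<d i. (cmod (block_op d T w f (y,i,r)))\<^sup>2) \<le> (c * M)\<^sup>2 * (\<Sum>r<d i. (cmod (f (y,i,r)))\<^sup>2)" if i: "i < n" for y i
  proof -
    have "(\<Sum>r<d i. (cmod (block_op d T w f (y,i,r)))\<^sup>2) = (w y)\<^sup>2 * (\<Sum>r<d i. (cmod (\<Sum>s<d i. T i $$ (r,s) * f (y,i,s)))\<^sup>2)"
      unfolding sum_distrib_left by (intro sum.cong refl) (simp add: block_op_def norm_mult power_mult_distrib)
    also have "\<dots> \<le> c\<^sup>2 * (M\<^sup>2 * (\<Sum>r<d i. (cmod (f (y,i,r)))\<^sup>2))"
    proof (rule mult_mono[OF _ T[OF i]])
      show "(w y)\<^sup>2 \<le> c\<^sup>2" using power_mono[OF w[of y], of 2] by simp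
    qed (simp_all add: sum_nonneg)
    finally show ?thesis by (simp add: power_mult_distrib mult.assoc)
  qed
  then have "(\<Sum>y\<in>Y. \<Sum>i<n. \<Sum>r<d i. (cmod (block_op d T w f (y,i,r)))\<^sup>2)
      \<le> (\<Sum>y\<in>Y. \<Sum>i<n. (c * M)\<^sup>2 * (\<Sum>r<d i. (cmod (f (y,i,r)))\<^sup>2))"
    by (intro sum_mono) simp
  then show ?thesis unfolding sum_block_index[OF Y] by (simp only: sum_distrib_left)
qed

lemma noise_channel_kraus:
  assumes pos: "\<And>i. i < n \<Longrightarrow> 0 < d i" and V: "V \<in> carrier_mat (dimA n d) dL"
    and K0: "\<And>l. l < m \<Longrightarrow> K0 l \<in> carrier_mat dL (n * dimA n d)"
    and RK: "\<And>X. X \<in> carrier_mat (n * dimA n d) (n * dimA n d) \<Longrightarrow> R X = msum dL dL {..<m} (\<lambda>l. K0 l * X * adj (K0 l))"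
    and K_def: "K = (\<lambda>(l,z). K0 l * noise_kraus n d dL V \<phi> z)"
    and X: "X \<in> carrier_mat dL dL"
  shows "(R \<circ> noisy_code n d V \<phi>) X = msum dL dL ({..<m} \<times> (SIGMA i:{..<n}. {..<d i})) (\<lambda>x. K x * X * adj (K x))"
proof -
  let ?A = "dimA n d" and ?I = "SIGMA i:{..<n}. {..<d i}" and ?NK = "noise_kraus n d dL V \<phi>" and ?J = "{..<m} \<times> (SIGMA i:{..<n}. {..<d i})"
  have sumI: "(\<Sum>z\<in>?I. f z) = (\<Sum>i<n. \<Sum>r<d i. f (i,r))" for f :: "nat \<times> nat \<Rightarrow> complex"
    by (simp add: sum.Sigma)
  show ?thesis
  proof (rule eq_matI)
    let ?RHS = "msum dL dL ?J (\<lambda>x. K x * X * adj (K x))"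
    have c: "noisy_code n d V \<phi> X \<in> carrier_mat (n * ?A) (n * ?A)" by (rule noisy_code_carrier)
    show "dim_row ((R \<circ> noisy_code n d V \<phi>) X) = dim_row ?RHS" "dim_col ((R \<circ> noisy_code n d V \<phi>) X) = dim_col ?RHS"
      by (simp_all add: RK[OF c] msum_def)
    fix p p' assume "p < dim_row ?RHS" "p' < dim_col ?RHS"
    then have pp: "p < dL" "p' < dL" by (auto simp: msum_def)
    have one: "(K0 l * noisy_code n d V \<phi> X * adj (K0 l)) $$ (p,p') = (\<Sum>z\<in>?I. (K (l,z) * X * adj (K (l,z))) $$ (p,p'))" if l: "l < m" for l
    proof -
      have NX: "?NK z * X * adj (?NK z) \<in> carrier_mat (n * ?A) (n * ?A)" for z
        by (intro mult_carrier_mat[of _ _ dL] adj_carrier noise_kraus_carrier X)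
      have "(K0 l * noisy_code n d V \<phi> X * adj (K0 l)) $$ (p,p')
        = (\<Sum>x<n * ?A. \<Sum>y<n * ?A. \<Sum>z\<in>?I. K0 l $$ (p,x) * (?NK z * X * adj (?NK z)) $$ (x,y) * cnj (K0 l $$ (p',y)))"
        unfolding kraus_entry[OF K0[OF l] c pp]
      proof (rule sum.cong[OF refl], rule sum.cong[OF refl])
        fix x y assume "x \<in> {..<n * ?A}" "y \<in> {..<n * ?A}"
        then have xy: "x < n * ?A" "y < n * ?A" by auto
        have nk: "noisy_code n d V \<phi> X $$ (x,y) = (\<Sum>i<n. \<Sum>r<d i. \<Sum>l<dL. \<Sum>l'<dL.
            ?NK (i,r) $$ (x,l) * X $$ (l,l') * cnj (?NK (i,r) $$ (y,l')))"
          by (rule noisy_code_kraus[OF _ V X xy]) (rule pos)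
        have "noisy_code n d V \<phi> X $$ (x,y) = (\<Sum>z\<in>?I. (?NK z * X * adj (?NK z)) $$ (x,y))"
          unfolding nk kraus_entry[OF noise_kraus_carrier X xy]
          by (simp only: sumI)
        then show "K0 l $$ (p,x) * noisy_code n d V \<phi> X $$ (x,y) * cnj (K0 l $$ (p',y))
          = (\<Sum>z\<in>?I. K0 l $$ (p,x) * (?NK z * X * adj (?NK z)) $$ (x,y) * cnj (K0 l $$ (p',y)))"
          by (simp only: sum_distrib_left sum_distrib_right)
      qed
      also have "\<dots> = (\<Sum>z\<in>?I. \<Sum>x<n * ?A. \<Sum>y<n * ?A. K0 l $$ (p,x) * (?NK z * X * adj (?NK z)) $$ (x,y) * cnj (K0 l $$ (p',y)))"
        by (rule trans[OF sum.cong[OF refl sum.swap] sum.swap])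
      also have "\<dots> = (\<Sum>z\<in>?I. (K (l,z) * X * adj (K (l,z))) $$ (p,p'))"
      proof (rule sum.cong[OF refl])
        fix z
        have aK: "adj (K0 l) \<in> carrier_mat (n * ?A) dL" and aN: "adj (?NK z) \<in> carrier_mat dL (n * ?A)"
          using K0[OF l] by simp_all
        have cs: "X * adj (?NK z) \<in> carrier_mat dL (n * ?A)" "X * (adj (?NK z) * adj (K0 l)) \<in> carrier_mat dL dL"
          by (rule mult_carrier_mat[OF X aN], rule mult_carrier_mat[OF X mult_carrier_mat[OF aN aK]])
        have "K (l,z) * X * adj (K (l,z)) = (K0 l * ?NK z) * X * (adj (?NK z) * adj (K0 l))"
          unfolding K_def by (simp add: adj_mult[OF K0[OF l] noise_kraus_carrier])
        also have "\<dots> = (K0 l * ?NK z) * (X * (adj (?NK z) * adj (K0 l)))"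
          by (rule assoc_mult_mat[OF mult_carrier_mat[OF K0[OF l] noise_kraus_carrier] X mult_carrier_mat[OF aN aK]])
        also have "\<dots> = K0 l * (?NK z * (X * (adj (?NK z) * adj (K0 l))))"
          by (rule assoc_mult_mat[OF K0[OF l] noise_kraus_carrier cs(2)])
        also have "X * (adj (?NK z) * adj (K0 l)) = (X * adj (?NK z)) * adj (K0 l)"
          by (rule assoc_mult_mat[OF X aN aK, symmetric])
        also have "?NK z * ((X * adj (?NK z)) * adj (K0 l)) = (?NK z * (X * adj (?NK z))) * adj (K0 l)"
          by (rule assoc_mult_mat[OF noise_kraus_carrier cs(1) aK, symmetric])
        also have "?NK z * (X * adj (?NK z)) = ?NK z * X * adj (?NK z)"
          by (rule assoc_mult_mat[OF noise_kraus_carrier X aN, symmetric])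
        also have "K0 l * ((?NK z * X * adj (?NK z)) * adj (K0 l)) = K0 l * (?NK z * X * adj (?NK z)) * adj (K0 l)"
          by (rule assoc_mult_mat[OF K0[OF l] NX aK, symmetric])
        finally show "(\<Sum>x<n * ?A. \<Sum>y<n * ?A. K0 l $$ (p,x) * (?NK z * X * adj (?NK z)) $$ (x,y) * cnj (K0 l $$ (p',y)))
          = (K (l,z) * X * adj (K (l,z))) $$ (p,p')"
          by (simp only: kraus_entry[OF K0[OF l] NX pp])
      qed
      finally show ?thesis .
    qed
    have "(R \<circ> noisy_code n d V \<phi>) X $$ (p,p') = (\<Sum>l<m. (K0 l * noisy_code n d V \<phi> X * adj (K0 l)) $$ (p,p'))"
      using pp by (simp add: RK[OF c] msum_def del: index_mult_mat)
    also have "\<dots> = (\<Sum>l<m. \<Sum>z\<in>?I. (K (l,z) * X * adj (K (l,z))) $$ (p,p'))"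
      by (intro sum.cong refl) (simp only: lessThan_iff one)
    also have "\<dots> = ?RHS $$ (p,p')" using pp by (simp add: msum_def sum.cartesian_product case_prod_beta del: index_mult_mat)
    finally show "(R \<circ> noisy_code n d V \<phi>) X $$ (p,p') = ?RHS $$ (p,p')" .
  qed
qed

text \<open>Suprema and infima of fidelities are squared later on, which calls for their
  sign.\<close>

lemma F_phi_noise_nonneg:
  assumes pos: "\<And>i. i < n \<Longrightarrow> 0 < d i" and V: "V \<in> carrier_mat (dimA n d) dL"
    and R: "is_channel (n * dimA n d) dL R" and \<psi>: "unit_vec_in (dL * dR) \<psi>"
  shows "0 \<le> F_phi dL dR dL \<psi> (R \<circ> noisy_code n d V \<phi>) id"
proof -
  from R obtain K0 :: "nat \<Rightarrow> complex mat" and m where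
    K0: "\<And>l. l < m \<Longrightarrow> K0 l \<in> carrier_mat dL (n * dimA n d)" and
    RK: "\<And>X. X \<in> carrier_mat (n * dimA n d) (n * dimA n d) \<Longrightarrow> R X = msum dL dL {..<m} (\<lambda>l. K0 l * X * adj (K0 l))"
    unfolding is_channel_def by blast
  define K where "K = (\<lambda>(l,z). K0 l * noise_kraus n d dL V \<phi> z)"
  have "K x \<in> carrier_mat dL dL" if "x \<in> {..<m} \<times> (SIGMA i:{..<n}. {..<d i})" for x
    using that K0 by (auto simp: K_def intro!: mult_carrier_mat[of _ dL "n * dimA n d"])
  moreover have "(R \<circ> noisy_code n d V \<phi>) X = msum dL dL ({..<m} \<times> (SIGMA i:{..<n}. {..<d i})) (\<lambda>x. K x * X * adj (K x))"
    if X: "X \<in> carrier_mat dL dL" for X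
    by (rule noise_channel_kraus[OF _ V _ _ K_def X]) (rule pos, assumption, rule K0, assumption, rule RK, assumption)
  ultimately show ?thesis
    by (subst F_phi_kraus[OF \<psi>, where I = "{..<m} \<times> (SIGMA i:{..<n}. {..<d i})" and K = K]) (auto intro!: sum_nonneg)
qed

text \<open>\<open>\<Phi>\<close> is the purified output of \<open>R \<circ> \<N> \<circ> \<E>\<close> and \<open>u\<close> its projection onto the tensor products of the
  input state with a state of the environment. The observable is the charge of the lost subsystem
  times the sign \<open>\<omega>\<close> of the reference system; it has expectation \<open>2 q\<close> in \<open>\<Phi>\<close> and \<open>0\<close> in \<open>u\<close>.\<close>
lemma infidelity_bound:
  assumes setting: "setting n d dL V Ur \<phi>" and R: "is_channel (n * dimA n d) dL R"
    and T: "\<And>i. i < n \<Longrightarrow> T i \<in> carrier_mat (d i) (d i)" "\<And>i. i < n \<Longrightarrow> adj (T i) = T i"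
    and deriv: "\<And>i r s. i < n \<Longrightarrow> r < d i \<Longrightarrow> s < d i \<Longrightarrow>
      ((\<lambda>t. Ur i (torus dL (coroot 0 (dL - 1) t)) $$ (r,s)) has_vector_derivative \<i> * T i $$ (r,s)) (at 0)"
    and bound: "\<And>i x. i < n \<Longrightarrow> (\<Sum>r<d i. (cmod (\<Sum>s<d i. T i $$ (r,s) * x s))\<^sup>2) \<le> M\<^sup>2 * (\<Sum>s<d i. (cmod (x s))\<^sup>2)"
    and M: "0 \<le> M"
    and s: "(\<Sum>j<dL. (s j)\<^sup>2) = 1" "(s 0)\<^sup>2 = q" "(s (dL - 1))\<^sup>2 = q"
  shows "q \<le> real n * M * sqrt (1 - (F_phi dL dL dL (schmidt_vec dL s) (R \<circ> noisy_code n d V \<phi>) id)\<^sup>2)"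
proof -
  let ?A = "dimA n d" and ?N = "dL - 1" and ?I = "SIGMA i:{..<n}. {..<d i}"
  have n: "0 < n" and dL: "2 \<le> dL" and pos: "\<And>i. i < n \<Longrightarrow> 0 < d i" and code: "transversal_covariant_code n d dL V Ur"
    and \<phi>: "\<And>i. i < n \<Longrightarrow> unit_vec_in (d i) (\<phi> i)"
    using setting by (auto simp: setting_def)
  have V: "V \<in> carrier_mat ?A dL" "adj V * V = 1\<^sub>m dL" using code by (auto simp: transversal_covariant_code_def)
  from R obtain K0 :: "nat \<Rightarrow> complex mat" and m where
    K0: "\<And>l. l < m \<Longrightarrow> K0 l \<in> carrier_mat dL (n * ?A)" and
    tp: "msum (n * ?A) (n * ?A) {..<m} (\<lambda>l. adj (K0 l) * K0 l) = 1\<^sub>m (n * ?A)" and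
    RK: "\<And>X. X \<in> carrier_mat (n * ?A) (n * ?A) \<Longrightarrow> R X = msum dL dL {..<m} (\<lambda>l. K0 l * X * adj (K0 l))"
    unfolding is_channel_def by blast
  let ?NK = "noise_kraus n d dL V \<phi>"
  define K where "K = (\<lambda>(l,z). K0 l * ?NK z)"
  let ?J = "{..<m} \<times> ?I"
  have finI: "finite ?I" by auto
  have sumI: "(\<Sum>z\<in>?I. f z) = (\<Sum>i<n. \<Sum>r<d i. f (i,r))" for f :: "nat \<times> nat \<Rightarrow> complex"
    by (simp add: sum.Sigma)
  have K: "K x \<in> carrier_mat dL dL" if "x \<in> ?J" for x
    using that K0 by (auto simp: K_def intro!: mult_carrier_mat[of _ dL "n * ?A"])
  have kraus: "(R \<circ> noisy_code n d V \<phi>) X = msum dL dL ?J (\<lambda>x. K x * X * adj (K x))" if X: "X \<in> carrier_mat dL dL" for X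
    by (rule noise_channel_kraus[OF _ V(1) _ _ K_def X]) (rule pos, assumption, rule K0, assumption, rule RK, assumption)
  \<comment> \<open>Trace preservation of \<open>R\<close> eliminates the recovery: overlaps summed
    over its Kraus label and over the output depend on the noise alone.\<close>
  have merge: "(\<Sum>l<m. \<Sum>p<dL. cnj (K (l,z) $$ (p,j)) * K (l,z') $$ (p,j)) = (\<Sum>x<n * ?A. cnj (?NK z $$ (x,j)) * ?NK z' $$ (x,j))"
    if j: "j < dL" for z z' j
  proof -
    have ent: "K (l,z) $$ (p,j) = (\<Sum>x<n * ?A. K0 l $$ (p,x) * ?NK z $$ (x,j))" if "l < m" "p < dL" for l p z
      unfolding K_def by (simp add: mat_mult_entry[OF K0[OF that(1)] noise_kraus_carrier that(2) j] del: index_mult_mat)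
    have del: "(\<Sum>l<m. \<Sum>p<dL. cnj (K0 l $$ (p,x)) * K0 l $$ (p,y)) = (if y = x then 1 else 0)" if "x < n * ?A" "y < n * ?A" for x y
    proof -
      have "1\<^sub>m (n * ?A) $$ (x,y) = (\<Sum>l<m. (adj (K0 l) * K0 l) $$ (x,y))"
        unfolding tp[symmetric] msum_def using that by (simp del: index_mult_mat)
      also have "\<dots> = (\<Sum>l<m. \<Sum>p<dL. cnj (K0 l $$ (p,x)) * K0 l $$ (p,y))"
      proof (rule sum.cong[OF refl])
        fix l assume "l \<in> {..<m}"
        then have l: "l < m" by simp
        show "(adj (K0 l) * K0 l) $$ (x,y) = (\<Sum>p<dL. cnj (K0 l $$ (p,x)) * K0 l $$ (p,y))"
          unfolding mat_mult_entry[OF adj_carrier[OF K0[OF l]] K0[OF l] that]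
          by (intro sum.cong refl) (use that in \<open>simp add: adj_entry[OF K0[OF l]]\<close>)
      qed
      finally show ?thesis using that by auto
    qed
    let ?t = "\<lambda>l p x y. (cnj (?NK z $$ (x,j)) * ?NK z' $$ (y,j)) * (cnj (K0 l $$ (p,x)) * K0 l $$ (p,y))"
    have "(\<Sum>l<m. \<Sum>p<dL. cnj (K (l,z) $$ (p,j)) * K (l,z') $$ (p,j)) = (\<Sum>l<m. \<Sum>p<dL. \<Sum>x<n * ?A. \<Sum>y<n * ?A. ?t l p x y)"
    proof (rule sum.cong[OF refl], rule sum.cong[OF refl])
      fix l p assume "l \<in> {..<m}" "p \<in> {..<dL}"
      then have lp: "l < m" "p < dL" by auto
      show "cnj (K (l,z) $$ (p,j)) * K (l,z') $$ (p,j) = (\<Sum>x<n * ?A. \<Sum>y<n * ?A. ?t l p x y)"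
        unfolding ent[OF lp] cnj_sum sum_product by (intro sum.cong refl) (simp only: complex_cnj_mult mult_ac)
    qed
    also have "\<dots> = (\<Sum>l<m. \<Sum>x<n * ?A. \<Sum>y<n * ?A. \<Sum>p<dL. ?t l p x y)"
      by (rule sum.cong[OF refl]) (rule trans[OF sum.swap sum.cong[OF refl sum.swap]])
    also have "\<dots> = (\<Sum>x<n * ?A. \<Sum>y<n * ?A. \<Sum>l<m. \<Sum>p<dL. ?t l p x y)"
      by (rule trans[OF sum.swap sum.cong[OF refl sum.swap]])
    also have "\<dots> = (\<Sum>x<n * ?A. \<Sum>y<n * ?A. if y = x then cnj (?NK z $$ (x,j)) * ?NK z' $$ (x,j) else 0)"
      by (intro sum.cong refl) (simp add: sum_distrib_left[symmetric] del)
    also have "\<dots> = (\<Sum>x<n * ?A. cnj (?NK z $$ (x,j)) * ?NK z' $$ (x,j))" by simp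
    finally show ?thesis .
  qed
  define Y where "Y = {..<m} \<times> {..<dL} \<times> {..<dL}"
  have Y: "finite Y" by (simp add: Y_def)
  have sumY: "(\<Sum>y\<in>Y. f y) = (\<Sum>l<m. \<Sum>p<dL. \<Sum>j<dL. f (l,p,j))" for f :: "nat \<times> nat \<times> nat \<Rightarrow> complex"
    unfolding Y_def by (simp add: sum.cartesian_product case_prod_beta)
  \<comment> \<open>The labels are \<open>l\<close> for the Kraus operator of \<open>R\<close>,
    \<open>p\<close> for the output, \<open>j\<close> for the reference and \<open>z\<close> for the
    environment of the noise. \<open>c x\<close> below is the expectation of \<open>K x\<close> in
    the input state, so \<open>F2\<close> is the squared fidelity.\<close>
  define \<Phi> where "\<Phi> = (\<lambda>((l,p,j),z). complex_of_real (s j) * K (l,z) $$ (p,j))"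
  define c where "c x = (\<Sum>j<dL. complex_of_real ((s j)\<^sup>2) * K x $$ (j,j))" for x
  define u where "u = (\<lambda>((l,p,j),z). if p = j then complex_of_real (s j) * c (l,z) else 0)"
  define F2 where "F2 = (\<Sum>x\<in>?J. (cmod (c x))\<^sup>2)"
  have F: "(F_phi dL dL dL (schmidt_vec dL s) (R \<circ> noisy_code n d V \<phi>) id)\<^sup>2 = F2"
  proof -
    have "F_phi dL dL dL (schmidt_vec dL s) (R \<circ> noisy_code n d V \<phi>) id = sqrt F2"
      unfolding F2_def c_def by (rule F_phi_schmidt[OF s(1) _ K kraus]) (use finI in simp_all)
    moreover have "0 \<le> F2" unfolding F2_def by (intro sum_nonneg) simp
    ultimately show ?thesis by simp
  qed
  \<comment> \<open>A weight depending on the reference alone allows \<open>merge\<close> to be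
    applied: the expectation in \<open>\<Phi>\<close> is a combination of codeword charges, damped
    by the erasure probability 1/n.\<close>
  have form: "(\<Sum>x\<in>block_index Y n d. cnj (\<Phi> x) * block_op d S w \<Phi> x)
      = (\<Sum>j<dL. complex_of_real ((s j)\<^sup>2 * w' j / real n) * charge n d S (\<lambda>a. V $$ (a,j)))"
    if w: "\<And>l p j. w (l,p,j) = w' j" for S w w'
  proof -
    let ?t = "\<lambda>l p j i r r'. complex_of_real ((s j)\<^sup>2 * w' j) * (S i $$ (r,r') * (cnj (K (l,i,r) $$ (p,j)) * K (l,i,r') $$ (p,j)))"
    have "(\<Sum>x\<in>block_index Y n d. cnj (\<Phi> x) * block_op d S w \<Phi> x)
      = (\<Sum>l<m. \<Sum>p<dL. \<Sum>j<dL. \<Sum>i<n. \<Sum>r<d i. \<Sum>r'<d i. ?t l p j i r r')"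
      unfolding sum_block_index[OF Y] sumY
      by (simp add: \<Phi>_def block_op_def w sum_distrib_left power2_eq_square mult_ac)
    also have "\<dots> = (\<Sum>l<m. \<Sum>j<dL. \<Sum>p<dL. \<Sum>i<n. \<Sum>r<d i. \<Sum>r'<d i. ?t l p j i r r')"
      by (rule sum.cong[OF refl]) (rule sum.swap)
    also have "\<dots> = (\<Sum>j<dL. \<Sum>l<m. \<Sum>p<dL. \<Sum>i<n. \<Sum>r<d i. \<Sum>r'<d i. ?t l p j i r r')"
      by (rule sum.swap)
    also have "\<dots> = (\<Sum>j<dL. complex_of_real ((s j)\<^sup>2 * w' j / real n) * charge n d S (\<lambda>a. V $$ (a,j)))"
    proof (rule sum.cong[OF refl])
      fix j assume "j \<in> {..<dL}"
      then have j: "j < dL" by simp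
      have "(\<Sum>l<m. \<Sum>p<dL. \<Sum>i<n. \<Sum>r<d i. \<Sum>r'<d i. ?t l p j i r r')
        = (\<Sum>l<m. \<Sum>i<n. \<Sum>p<dL. \<Sum>r<d i. \<Sum>r'<d i. ?t l p j i r r')"
        by (rule sum.cong[OF refl]) (rule sum.swap)
      also have "\<dots> = (\<Sum>i<n. \<Sum>l<m. \<Sum>p<dL. \<Sum>r<d i. \<Sum>r'<d i. ?t l p j i r r')"
        by (rule sum.swap)
      also have "\<dots> = (\<Sum>i<n. complex_of_real ((s j)\<^sup>2 * w' j) * (\<Sum>r<d i. \<Sum>r'<d i. S i $$ (r,r') *
           (\<Sum>l<m. \<Sum>p<dL. cnj (K (l,i,r) $$ (p,j)) * K (l,i,r') $$ (p,j))))"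
      proof (rule sum.cong[OF refl])
        fix i
        have "(\<Sum>l<m. \<Sum>p<dL. \<Sum>r<d i. \<Sum>r'<d i. ?t l p j i r r') = (\<Sum>l<m. \<Sum>r<d i. \<Sum>r'<d i. \<Sum>p<dL. ?t l p j i r r')"
          by (rule sum.cong[OF refl]) (rule trans[OF sum.swap sum.cong[OF refl sum.swap]])
        also have "\<dots> = (\<Sum>r<d i. \<Sum>r'<d i. \<Sum>l<m. \<Sum>p<dL. ?t l p j i r r')"
          by (rule trans[OF sum.swap sum.cong[OF refl sum.swap]])
        finally show "(\<Sum>l<m. \<Sum>p<dL. \<Sum>r<d i. \<Sum>r'<d i. ?t l p j i r r') = complex_of_real ((s j)\<^sup>2 * w' j) * (\<Sum>r<d i. \<Sum>r'<d i. S i $$ (r,r') *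
           (\<Sum>l<m. \<Sum>p<dL. cnj (K (l,i,r) $$ (p,j)) * K (l,i,r') $$ (p,j)))"
          by (simp only: sum_distrib_left)
      qed
      also have "\<dots> = (\<Sum>i<n. complex_of_real ((s j)\<^sup>2 * w' j) * (complex_of_real (1 / real n) *
          (\<Sum>b<?A. \<Sum>r<d i. S i $$ (digit n d i b, r) * cnj (V $$ (b,j)) * V $$ (set_digit n d i b r, j))))"
      proof (rule sum.cong[OF refl])
        fix i assume "i \<in> {..<n}"
        then have i: "i < n" by simp
        show "complex_of_real ((s j)\<^sup>2 * w' j) * (\<Sum>r<d i. \<Sum>r'<d i. S i $$ (r,r') *
           (\<Sum>l<m. \<Sum>p<dL. cnj (K (l,i,r) $$ (p,j)) * K (l,i,r') $$ (p,j)))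
          = complex_of_real ((s j)\<^sup>2 * w' j) * (complex_of_real (1 / real n) *
          (\<Sum>b<?A. \<Sum>r<d i. S i $$ (digit n d i b, r) * cnj (V $$ (b,j)) * V $$ (set_digit n d i b r, j)))"
          unfolding merge[OF j]
          by (rule arg_cong[of _ _ "(*) (complex_of_real ((s j)\<^sup>2 * w' j))"], rule noise_kraus_form) (use pos i j \<phi> in auto)
      qed
      also have "\<dots> = complex_of_real ((s j)\<^sup>2 * w' j / real n) * charge n d S (\<lambda>a. V $$ (a,j))"
        unfolding charge_def sum_distrib_left[symmetric] by (simp add: mult.assoc)
      finally show "(\<Sum>l<m. \<Sum>p<dL. \<Sum>i<n. \<Sum>r<d i. \<Sum>r'<d i. ?t l p j i r r')
        = complex_of_real ((s j)\<^sup>2 * w' j / real n) * charge n d S (\<lambda>a. V $$ (a,j))" .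
    qed
    finally show ?thesis .
  qed
  have diag: "(\<Sum>x\<in>block_index Y n d. (case x of ((l,p,j),z) \<Rightarrow> if p = j then g l j z else 0))
    = (\<Sum>l<m. \<Sum>i<n. \<Sum>r<d i. \<Sum>j<dL. g l j (i,r))" for g :: "nat \<Rightarrow> nat \<Rightarrow> nat \<times> nat \<Rightarrow> complex"
  proof -
    have "(\<Sum>x\<in>block_index Y n d. (case x of ((l,p,j),z) \<Rightarrow> if p = j then g l j z else 0))
      = (\<Sum>l<m. \<Sum>p<dL. \<Sum>j<dL. if j = p then (\<Sum>i<n. \<Sum>r<d i. g l p (i,r)) else 0)"
      unfolding sum_block_index[OF Y] sumY by (intro sum.cong refl) simp
    also have "\<dots> = (\<Sum>l<m. \<Sum>p<dL. \<Sum>i<n. \<Sum>r<d i. g l p (i,r))" by simp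
    also have "\<dots> = (\<Sum>l<m. \<Sum>i<n. \<Sum>r<d i. \<Sum>p<dL. g l p (i,r))"
      by (rule sum.cong[OF refl]) (rule trans[OF sum.swap sum.cong[OF refl sum.swap]])
    finally show ?thesis .
  qed
  have F2c: "complex_of_real F2 = (\<Sum>l<m. \<Sum>i<n. \<Sum>r<d i. cnj (c (l,i,r)) * c (l,i,r))"
  proof -
    have "complex_of_real F2 = (\<Sum>x\<in>?J. cnj (c x) * c x)"
      unfolding F2_def of_real_sum mult_cnj_cmod[symmetric] by (simp only: mult.commute)
    also have "\<dots> = (\<Sum>l<m. \<Sum>z\<in>?I. cnj (c (l,z)) * c (l,z))"
      by (simp add: sum.cartesian_product case_prod_beta)
    finally show ?thesis by (simp only: sumI)
  qed
  have s1: "(\<Sum>j<dL. complex_of_real ((s j)\<^sup>2)) = 1"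
    unfolding of_real_sum[symmetric] s(1) by simp
  have uu: "(\<Sum>x\<in>block_index Y n d. (cmod (u x))\<^sup>2) = F2"
  proof -
    have "complex_of_real (\<Sum>x\<in>block_index Y n d. (cmod (u x))\<^sup>2)
      = (\<Sum>x\<in>block_index Y n d. (case x of ((l,p,j),z) \<Rightarrow> if p = j then cnj (c (l,z)) * c (l,z) * complex_of_real ((s j)\<^sup>2) else 0))"
      unfolding of_real_sum mult_cnj_cmod[symmetric]
      by (intro sum.cong refl) (simp add: u_def power2_eq_square mult_ac split: prod.split)
    also have "\<dots> = complex_of_real F2"
      unfolding diag F2c sum_distrib_left[symmetric] s1 by simp
    finally show ?thesis by (simp only: of_real_eq_iff)
  qed
  have u\<Phi>: "(\<Sum>x\<in>block_index Y n d. cnj (u x) * \<Phi> x) = complex_of_real F2"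
  proof -
    have "(\<Sum>x\<in>block_index Y n d. cnj (u x) * \<Phi> x)
      = (\<Sum>x\<in>block_index Y n d. (case x of ((l,p,j),z) \<Rightarrow> if p = j then cnj (c (l,z)) * (complex_of_real ((s j)\<^sup>2) * K (l,z) $$ (j,j)) else 0))"
      by (intro sum.cong refl) (simp add: u_def \<Phi>_def power2_eq_square mult_ac split: prod.split)
    also have "\<dots> = complex_of_real F2"
      unfolding diag F2c sum_distrib_left[symmetric] c_def[symmetric] ..
    finally show ?thesis .
  qed
  have norm: "(\<Sum>x\<in>block_index Y n d. (cmod (\<Phi> x))\<^sup>2) = 1"
  proof -
    \<comment> \<open>The norm is read off from \<open>form\<close> with identity matrices, for
      which every codeword has charge n.\<close>
    let ?E = "\<lambda>i. 1\<^sub>m (d i)"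
    have delta: "(\<Sum>r'<d i. ?E i $$ (r,r') * h r') = h r" if "r < d i" for i r and h :: "nat \<Rightarrow> complex"
    proof -
      have "(\<Sum>r'<d i. ?E i $$ (r,r') * h r') = (\<Sum>r'<d i. if r' = r then h r else 0)"
        by (intro sum.cong refl) (use that in auto)
      then show ?thesis using that by simp
    qed
    have "complex_of_real (\<Sum>x\<in>block_index Y n d. (cmod (\<Phi> x))\<^sup>2)
      = (\<Sum>x\<in>block_index Y n d. cnj (\<Phi> x) * block_op d ?E (\<lambda>_. 1) \<Phi> x)"
      unfolding of_real_sum mult_cnj_cmod[symmetric]
    proof (rule sum.cong[OF refl])
      fix x assume "x \<in> block_index Y n d"
      then obtain y i r where x: "x = (y,i,r)" "r < d i" by auto
      show "\<Phi> x * cnj (\<Phi> x) = cnj (\<Phi> x) * block_op d ?E (\<lambda>_. 1) \<Phi> x"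
        by (simp only: x(1) block_op_def case_prod_conv delta[OF x(2)] of_real_1 mult_1) (rule mult.commute)
    qed
    also have "\<dots> = (\<Sum>j<dL. complex_of_real ((s j)\<^sup>2 * 1 / real n) * charge n d ?E (\<lambda>a. V $$ (a,j)))"
      by (rule form) simp
    also have "\<dots> = (\<Sum>j<dL. complex_of_real ((s j)\<^sup>2))"
    proof (rule sum.cong[OF refl])
      fix j assume "j \<in> {..<dL}"
      then have j: "j < dL" by simp
      have "charge n d ?E (\<lambda>a. V $$ (a,j)) = (\<Sum>i<n. \<Sum>b<?A. cnj (V $$ (b,j)) * V $$ (b,j))"
        unfolding charge_def
      proof (rule sum.cong[OF refl], rule sum.cong[OF refl])
        fix i b assume "i \<in> {..<n}"
        then have i: "i < n" by simp
        have "digit n d i b < d i" using digit_less[of n d i b] pos i by simp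
        from delta[OF this, of "\<lambda>r. cnj (V $$ (b,j)) * V $$ (set_digit n d i b r, j)"]
        show "(\<Sum>r<d i. ?E i $$ (digit n d i b, r) * cnj (V $$ (b,j)) * V $$ (set_digit n d i b r, j)) = cnj (V $$ (b,j)) * V $$ (b,j)"
          using set_digit_digit[of n d i b] pos by (simp add: mult.assoc)
      qed
      also have "\<dots> = of_nat n" using isometry_cols[OF V j j] by simp
      finally show "complex_of_real ((s j)\<^sup>2 * 1 / real n) * charge n d ?E (\<lambda>a. V $$ (a,j)) = complex_of_real ((s j)\<^sup>2)"
        using n by simp
    qed
    finally show ?thesis unfolding s1 by (simp only: of_real_eq_1_iff)
  qed
  \<comment> \<open>Opposite signs on the two distinguished reference states turn the charges into
    their difference; the factor \<open>real n\<close> in \<open>w\<close> cancels the erasure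
    probability.\<close>
  define \<omega> where "\<omega> j = (if j = 0 then 1 else if j = ?N then -1 else (0::real))" for j
  define w where "w = (\<lambda>(l::nat,p::nat,j). real n * \<omega> j)"
  have N0: "0 < dL" "?N < dL" "0 \<noteq> ?N" using dL by auto
  have \<omega>0: "\<omega> 0 = 1" "\<omega> ?N = -1" using N0 by (simp_all add: \<omega>_def)
  have sum\<omega>: "(\<Sum>j<dL. (s j)\<^sup>2 * \<omega> j * h j) = q * (h 0 - h ?N)" for h :: "nat \<Rightarrow> real"
  proof -
    have z: "(\<Sum>j\<in>{..<dL} - {0,?N}. (s j)\<^sup>2 * \<omega> j * h j) = 0" by (intro sum.neutral) (simp add: \<omega>_def)
    show ?thesis unfolding sum_split_pair[OF N0] z \<omega>0 s(2,3) by (simp add: algebra_simps)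
  qed
  \<comment> \<open>In \<open>u\<close> the environment factorises from the input state, where the
    sign has mean q - q = 0.\<close>
  have zero: "(\<Sum>x\<in>block_index Y n d. cnj (u x) * block_op d T w u x) = 0"
  proof -
    have "(\<Sum>x\<in>block_index Y n d. cnj (u x) * block_op d T w u x)
      = (\<Sum>x\<in>block_index Y n d. (case x of ((l,p,j),z) \<Rightarrow> if p = j then
          cnj (c (l,z)) * (\<Sum>r'<d (fst z). T (fst z) $$ (snd z,r') * c (l,fst z,r')) * complex_of_real (real n * ((s j)\<^sup>2 * \<omega> j * 1)) else 0))"
      by (intro sum.cong refl)
        (simp add: u_def block_op_def w_def power2_eq_square sum_distrib_left mult_ac split: prod.split)
    also have "\<dots> = 0"
      unfolding diag sum_distrib_left[symmetric] of_real_sum[symmetric] sum\<omega> by simp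
    finally show ?thesis .
  qed
  have "Re (\<Sum>x\<in>block_index Y n d. cnj (\<Phi> x) * block_op d T w \<Phi> x) \<le> 2 * (real n * M) * sqrt (1 - F2)"
  proof (rule expectation_perturbation[OF norm uu u\<Phi> block_op_add block_op_hermitian[OF Y T] zero])
    show "0 \<le> real n * M" using M by simp
    show "(\<Sum>x\<in>block_index Y n d. (cmod (block_op d T w f x))\<^sup>2) \<le> (real n * M)\<^sup>2 * (\<Sum>x\<in>block_index Y n d. (cmod (f x))\<^sup>2)" for f
      by (rule block_op_bound[OF Y _ M bound]) (auto simp: w_def \<omega>_def)
  qed
  moreover have "Re (\<Sum>x\<in>block_index Y n d. cnj (\<Phi> x) * block_op d T w \<Phi> x) = 2 * q"
  proof -
    have "(\<Sum>x\<in>block_index Y n d. cnj (\<Phi> x) * block_op d T w \<Phi> x)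
      = (\<Sum>j<dL. complex_of_real ((s j)\<^sup>2 * (real n * \<omega> j) / real n) * charge n d T (\<lambda>a. V $$ (a,j)))"
      by (rule form) (simp add: w_def)
    then have "Re (\<Sum>x\<in>block_index Y n d. cnj (\<Phi> x) * block_op d T w \<Phi> x)
      = (\<Sum>j<dL. (s j)\<^sup>2 * \<omega> j * Re (charge n d T (\<lambda>a. V $$ (a,j))))"
      using n by simp
    also have "\<dots> = q * 2"
    proof -
      have "Re (charge n d T (\<lambda>a. V $$ (a,0))) - Re (charge n d T (\<lambda>a. V $$ (a,?N))) = 2"
        by (rule charge_difference[OF code _ dL]) (rule pos, assumption, rule deriv)
      then show ?thesis by (simp only: sum\<omega>)
    qed
    finally show ?thesis by simp
  qed
  ultimately show ?thesis unfolding F by simp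
qed

text \<open>Discarding the input and preparing |0> is a channel, so the suprema over recoveries run
  over nonempty sets.\<close>

lemma channel_exists:
  assumes "0 < dL"
  shows "\<exists>R. is_channel dB dL R"
proof -
  define K where "K k = mat dL dB (\<lambda>(i,j). if i = 0 \<and> j = k then 1 else (0::complex))" for k
  have K: "K k \<in> carrier_mat dL dB" for k by (simp add: K_def)
  have "msum dB dB {..<dB} (\<lambda>k. adj (K k) * K k) = 1\<^sub>m dB"
  proof (rule eq_matI)
    fix x y assume "x < dim_row (1\<^sub>m dB)" "y < dim_col (1\<^sub>m dB)"
    then have xy: "x < dB" "y < dB" by auto
    have "(adj (K k) * K k) $$ (x,y) = (if k = x then (if x = y then 1 else 0) else 0)" if "k < dB" for k
    proof -
      have "(adj (K k) * K k) $$ (x,y) = (\<Sum>p<dL. if p = 0 then (if k = x \<and> x = y then 1 else 0) else 0)"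
        unfolding mat_mult_entry[OF adj_carrier[OF K] K xy]
      proof (rule sum.cong[OF refl])
        fix p assume "p \<in> {..<dL}"
        then have p: "p < dL" by simp
        show "adj (K k) $$ (x,p) * K k $$ (p,y) = (if p = 0 then (if k = x \<and> x = y then 1 else 0) else 0)"
          unfolding adj_entry[OF K xy(1) p] using p xy by (cases "x = k"; cases "y = k") (simp_all add: K_def)
      qed
      then show ?thesis using assms by auto
    qed
    then have "(\<Sum>k<dB. (adj (K k) * K k) $$ (x,y)) = (\<Sum>k<dB. if k = x then (if x = y then 1 else 0) else 0)"
      by (intro sum.cong refl) simp
    then show "msum dB dB {..<dB} (\<lambda>k. adj (K k) * K k) $$ (x,y) = 1\<^sub>m dB $$ (x,y)"
      using xy by (simp add: msum_def del: index_mult_mat)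
  qed (auto simp: msum_def)
  then have "is_channel dB dL (\<lambda>X. msum dL dL {..<dB} (\<lambda>k. K k * X * adj (K k)))"
    unfolding is_channel_def using K by blast
  then show ?thesis by blast
qed

text \<open>The assumption amounts to an upper bound 1 - (q/c)^2 on all squares, a closed condition
  that passes to the supremum whether or not an optimal recovery exists.\<close>

lemma infidelity_Sup:
  fixes S :: "real set"
  assumes "S \<noteq> {}" and S: "\<And>x. x \<in> S \<Longrightarrow> 0 \<le> x \<and> q \<le> c * sqrt (1 - x\<^sup>2)" and q: "0 < q" and c: "0 \<le> c"
  shows "q \<le> c * sqrt (1 - (Sup S)\<^sup>2)"
proof -
  obtain x0 where x0: "x0 \<in> S" using assms by blast
  have c0: "0 < c" using S[OF x0] q c by (cases "c = 0") auto
  define b where "b = 1 - (q / c)\<^sup>2"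
  have le: "x\<^sup>2 \<le> b" if "x \<in> S" for x
  proof -
    have "q / c \<le> sqrt (1 - x\<^sup>2)" using S[OF that] c0 by (simp add: pos_divide_le_eq mult.commute)
    moreover have "0 < q / c" using q c0 by simp
    ultimately have "0 < sqrt (1 - x\<^sup>2)" "(q / c)\<^sup>2 \<le> (sqrt (1 - x\<^sup>2))\<^sup>2" by (linarith, intro power_mono) auto
    then show ?thesis by (simp add: b_def)
  qed
  have "x \<le> sqrt b" if "x \<in> S" for x using le[OF that] by (rule real_le_rsqrt)
  then have "Sup S \<le> sqrt b" "x0 \<le> Sup S" using x0 by (auto intro!: cSup_least cSup_upper bdd_aboveI)
  moreover have "0 \<le> x0" using S[OF x0] by simp
  moreover have "0 \<le> b" using le[OF x0] zero_le_power2[of x0] by linarith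
  ultimately have "(Sup S)\<^sup>2 \<le> (sqrt b)\<^sup>2" by (intro power_mono) auto
  then have "(Sup S)\<^sup>2 \<le> b" using \<open>0 \<le> b\<close> by simp
  then have "(q / c)\<^sup>2 \<le> 1 - (Sup S)\<^sup>2" by (simp add: b_def)
  then have "q / c \<le> sqrt (1 - (Sup S)\<^sup>2)" by (rule real_le_rsqrt)
  then show ?thesis using c0 by (simp add: pos_divide_le_eq mult.commute)
qed

text \<open>The largest local number \<open>m i\<close> bounds the norms of all local charges, and
  the subsystem attaining it supplies the dimension bound. The two error parameters come from
  \<open>infidelity_bound\<close> with different Schmidt coefficients.\<close>

theorem eps_lower_bounds:
  assumes setting: "setting n d dL V Ur \<phi>"
  shows "\<exists>m::nat. 1 \<le> 2 * real n * real m * eps_worst dL (n * dimA n d) (noisy_code n d V \<phi>) \<and>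
    1 \<le> 2 * real n * real m * (real dL * eps_e dL (n * dimA n d) (noisy_code n d V \<phi>) / 2) \<and>
    ln (real ((dL - 1 + m) choose m)) \<le> maxlog n d"
proof -
  let ?M = "noisy_code n d V \<phi>" and ?B = "n * dimA n d"
  have n: "0 < n" and dL: "2 \<le> dL" and pos: "\<And>i. i < n \<Longrightarrow> 0 < d i" and code: "transversal_covariant_code n d dL V Ur"
    using setting by (auto simp: setting_def)
  have V: "V \<in> carrier_mat (dimA n d) dL" using code by (simp add: transversal_covariant_code_def)
  have rep: "cont_unitary_rep dL (d i) (Ur i)" if "i < n" for i using code that by (simp add: transversal_covariant_code_def)
  let ?P = "\<lambda>i T m. T \<in> carrier_mat (d i) (d i) \<and> adj T = T \<and>
    (\<forall>r<d i. \<forall>s<d i. ((\<lambda>t. Ur i (torus dL (coroot 0 (dL - 1) t)) $$ (r,s)) has_vector_derivative \<i> * T $$ (r,s)) (at 0)) \<and>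
    (\<forall>x. (\<Sum>r<d i. (cmod (\<Sum>s<d i. T $$ (r,s) * x s))\<^sup>2) \<le> (real m)\<^sup>2 * (\<Sum>s<d i. (cmod (x s))\<^sup>2)) \<and>
    (dL - 1 + m) choose m \<le> d i"
  have "\<forall>i. \<exists>T m. i < n \<longrightarrow> ?P i T m"
    using representation_generator[OF rep dL pos] by blast
  from choice[OF this] obtain T where "\<forall>i. \<exists>m. i < n \<longrightarrow> ?P i (T i) m" ..
  from choice[OF this] obtain m where "\<forall>i. i < n \<longrightarrow> ?P i (T i) (m i)" ..
  then have Tm: "?P i (T i) (m i)" if "i < n" for i using that by blast
  define N where "N = Max (m ` {..<n})"
  have "N \<in> m ` {..<n}" unfolding N_def using n by (intro Max_in) auto
  then obtain i0 where i0: "i0 < n" "N = m i0" by auto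
  have mN: "m i \<le> N" if "i < n" for i unfolding N_def using that by (intro Max_ge) auto
  have bnd: "(\<Sum>r<d i. (cmod (\<Sum>s<d i. T i $$ (r,s) * x s))\<^sup>2) \<le> (real N)\<^sup>2 * (\<Sum>s<d i. (cmod (x s))\<^sup>2)" if i: "i < n" for i x
  proof -
    have "(real (m i))\<^sup>2 * (\<Sum>s<d i. (cmod (x s))\<^sup>2) \<le> (real N)\<^sup>2 * (\<Sum>s<d i. (cmod (x s))\<^sup>2)"
      using mN[OF i] by (intro mult_right_mono power_mono sum_nonneg) auto
    then show ?thesis using Tm[OF i] order_trans by blast
  qed
  have key: "q \<le> real n * real N * sqrt (1 - (F_phi dL dL dL (schmidt_vec dL s) (R \<circ> ?M) id)\<^sup>2)"
    if R: "is_channel ?B dL R" and s: "(\<Sum>j<dL. (s j)\<^sup>2) = 1" "(s 0)\<^sup>2 = q" "(s (dL - 1))\<^sup>2 = q" for R s q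
    using Tm bnd by (intro infidelity_bound[OF setting R _ _ _ _ _ s, of T]) auto
  have ab: "0 < dL" "dL - 1 < dL" "0 \<noteq> dL - 1" using dL by auto
  obtain R0 where R0: "is_channel ?B dL R0" using channel_exists[OF ab(1)] by blast
  have Fnn: "0 \<le> F_phi dL dR dL \<psi> (R \<circ> ?M) id" if "is_channel ?B dL R" "unit_vec_in (dL * dR) \<psi>" for R dR \<psi>
    using F_phi_noise_nonneg[OF _ V that] pos by blast
  have e: "1 / real dL \<le> real n * real N * eps_e dL ?B ?M"
  proof -
    \<comment> \<open>The maximally entangled probe, with q = 1/dL.\<close>
    let ?s = "\<lambda>_::nat. 1 / sqrt (real dL)"
    have s: "(\<Sum>j<dL. (?s j)\<^sup>2) = 1" "(?s 0)\<^sup>2 = 1 / real dL" "(?s (dL - 1))\<^sup>2 = 1 / real dL"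
      using dL by (simp_all add: power_divide)
    show ?thesis
      unfolding eps_e_def f_e_def max_ent_schmidt
    proof (rule infidelity_Sup)
      fix x assume "x \<in> {F_phi dL dL dL (schmidt_vec dL ?s) (R \<circ> ?M) id | R. is_channel ?B dL R}"
      then obtain R where R: "is_channel ?B dL R" "x = F_phi dL dL dL (schmidt_vec dL ?s) (R \<circ> ?M) id" by blast
      show "0 \<le> x \<and> 1 / real dL \<le> real n * real N * sqrt (1 - x\<^sup>2)"
        unfolding R(2) using Fnn[OF R(1) unit_schmidt_vec[OF s(1)]] key[OF R(1) s] by blast
    qed (use R0 dL in auto)
  qed
  have w: "1 / 2 \<le> real n * real N * eps_worst dL ?B ?M"
  proof -
    \<comment> \<open>All weight is put on the two extreme states: q = 1/2 is the largest value that
      normalisation allows.\<close>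
    define s where "s j = (if j = 0 \<or> j = dL - 1 then 1 / sqrt 2 else (0::real))" for j
    have "(\<Sum>j\<in>{..<dL} - {0,dL - 1}. (s j)\<^sup>2) = 0" by (intro sum.neutral) (simp add: s_def)
    then have s: "(\<Sum>j<dL. (s j)\<^sup>2) = 1" "(s 0)\<^sup>2 = 1 / 2" "(s (dL - 1))\<^sup>2 = 1 / 2"
      unfolding sum_split_pair[OF ab] by (simp_all add: s_def power_divide)
    show ?thesis
      unfolding eps_worst_def f_worst_def
    proof (rule infidelity_Sup)
      fix x assume "x \<in> {Inf {F_phi dL dR dL \<psi> (R \<circ> ?M) id | dR \<psi>. 0 < dR \<and> unit_vec_in (dL * dR) \<psi>} | R. is_channel ?B dL R}"
      then obtain R where R: "is_channel ?B dL R"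
        and x: "x = Inf {F_phi dL dR dL \<psi> (R \<circ> ?M) id | dR \<psi>. 0 < dR \<and> unit_vec_in (dL * dR) \<psi>}" by blast
      let ?I = "{F_phi dL dR dL \<psi> (R \<circ> ?M) id | dR \<psi>. 0 < dR \<and> unit_vec_in (dL * dR) \<psi>}"
      let ?F = "F_phi dL dL dL (schmidt_vec dL s) (R \<circ> ?M) id"
      have mem: "?F \<in> ?I" using unit_schmidt_vec[OF s(1)] ab(1) by blast
      have nn: "0 \<le> y" if "y \<in> ?I" for y using that Fnn[OF R] by blast
      have "0 \<le> x" unfolding x using mem nn by (intro cInf_greatest) auto
      moreover have "x \<le> ?F" unfolding x by (rule cInf_lower[OF mem]) (use nn in \<open>auto intro!: bdd_belowI\<close>)
      ultimately have "x\<^sup>2 \<le> ?F\<^sup>2" by (intro power_mono)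
      then have "sqrt (1 - ?F\<^sup>2) \<le> sqrt (1 - x\<^sup>2)" by simp
      then have "real n * real N * sqrt (1 - ?F\<^sup>2) \<le> real n * real N * sqrt (1 - x\<^sup>2)" by (intro mult_left_mono) simp_all
      then show "0 \<le> x \<and> 1 / 2 \<le> real n * real N * sqrt (1 - x\<^sup>2)"
        using key[OF R s] \<open>0 \<le> x\<close> by linarith
    qed (use R0 in auto)
  qed
  have choose: "(dL - 1 + N) choose N \<le> d i0" using Tm[OF i0(1)] i0(2) by simp
  have "ln (real ((dL - 1 + N) choose N)) \<le> ln (real (d i0))" using choose by (intro ln_mono) auto
  also have "\<dots> \<le> maxlog n d" unfolding maxlog_def using i0(1) by (intro Max_ge) auto
  finally have "ln (real ((dL - 1 + N) choose N)) \<le> maxlog n d" .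
  moreover have "1 \<le> 2 * real n * real N * eps_worst dL ?B ?M" using w by simp
  moreover have "1 \<le> 2 * real n * real N * (real dL * eps_e dL ?B ?M / 2)"
    using e dL by (simp add: divide_le_eq mult_ac)
  ultimately show ?thesis by blast
qed

section \<open>Lower bounds on the local dimension\<close>

lemma error_parameter_pos:
  fixes e :: real
  assumes "1 \<le> 2 * real n * real m * e"
  shows "0 < n" "0 < m" "0 < e"
proof -
  show "0 < n" "0 < m" using assms by (cases n; simp) (use assms in \<open>cases m; simp\<close>)
  have "0 < e * (2 * real n * real m)" using assms by (simp add: mult_ac)
  then show "0 < e" by (rule zero_less_mult_pos2) (use \<open>0 < n\<close> \<open>0 < m\<close> in simp)
qed

text \<open>In the next three lemmas \<open>D\<close> is \<open>maxlog\<close>, \<open>e\<close> is one of the two error parameters and \<open>a = d\<^sub>L - 1\<close>;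
  the hypothesis says that \<open>x = 1 / (2 n e)\<close> is at most \<open>m\<close>.\<close>
lemma dimension_bound_polynomial:
  fixes D e :: real
  assumes e: "1 \<le> 2 * real n * real m * e" and D: "ln (real ((a + m) choose m)) \<le> D" and a: "1 \<le> a"
  shows "ln (real a) / (2 * real n * e) - ln (1 + 1 / (2 * real n * e)) / (2 * real n * e) \<le> D"
proof -
  define x where "x = 1 / (2 * real n * e)"
  have ne: "0 < 2 * real n * e" using error_parameter_pos[OF e] by simp
  have x0: "0 < x" using ne by (simp add: x_def)
  have xm: "x \<le> real m" unfolding x_def using e ne by (simp add: divide_le_eq mult_ac)
  have C1: "1 \<le> real ((a + m) choose m)" by (simp add: Suc_le_eq zero_less_binomial)
  then have D0: "0 \<le> D" using D ln_ge_zero[OF C1] by linarith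
  have "x * ln (real a / (1 + x)) \<le> D"
  proof (cases "real a / (1 + x) \<le> 1")
    case True
    then have "ln (real a / (1 + x)) \<le> 0" using x0 a by (intro ln_le_zero_iff[THEN iffD2]) simp_all
    then have "x * ln (real a / (1 + x)) \<le> 0" using x0 by (simp add: mult_nonneg_nonpos)
    then show ?thesis using D0 by linarith
  next
    case False
    \<comment> \<open>\<open>k\<close> is x rounded up. It is still at most the integer
      \<open>m\<close>, and at most x + 1, so the base (a + k) / k of the binomial estimate is at
      least a / (1 + x).\<close>
    define k where "k = nat \<lceil>x\<rceil>"
    have k: "x \<le> real k" "real k \<le> x + 1" "0 < k" unfolding k_def using x0 by linarith+
    have km: "k \<le> m" unfolding k_def using xm by (simp add: ceiling_le_iff nat_le_iff)
    let ?b = "real a / (1 + x)"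
    have "?b \<le> real (a + k) / real k"
      using k x0 by (intro frac_le) simp_all
    then have "?b ^ k \<le> (real (a + k) / real k) ^ k" using x0 by (intro power_mono) simp_all
    also have "\<dots> \<le> real ((a + k) choose k)" using binomial_ge_n_over_k_pow_k[of k "a + k", where 'a = real] by simp
    also have "\<dots> \<le> real ((a + m) choose m)" using choose_add_mono[OF km] by simp
    finally have "ln (?b ^ k) \<le> ln (real ((a + m) choose m))" using x0 a by (intro ln_mono) simp_all
    then have "real k * ln ?b \<le> D" using D x0 a by (simp add: ln_realpow)
    moreover have "0 \<le> ln ?b" using False x0 by simp
    then have "x * ln ?b \<le> real k * ln ?b" using k by (intro mult_right_mono)
    ultimately show ?thesis by linarith
  qed
  moreover have "x * ln (real a / (1 + x)) = ln (real a) / (2 * real n * e) - ln (1 + 1 / (2 * real n * e)) / (2 * real n * e)"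
  proof -
    have "ln (real a / (1 + x)) = ln (real a) - ln (1 + x)" using x0 a by (intro ln_divide_pos) simp_all
    moreover have "y / (2 * real n * e) = x * y" for y by (simp add: x_def)
    ultimately show ?thesis by (simp only: mult_1_right right_diff_distrib)
  qed
  ultimately show ?thesis by simp
qed

text \<open>By symmetry the binomial is ((a + m) choose a), hence at least ((a + m) / a)^a, and the
  base is at least x / (a + 1) because x <= m.\<close>

lemma dimension_bound_exponential:
  fixes D e :: real
  assumes e: "1 \<le> 2 * real n * real m * e" and D: "ln (real ((a + m) choose m)) \<le> D" and a: "1 \<le> a"
  shows "real a * ln (1 / (2 * e * real n * real (Suc a))) \<le> D"
proof -
  define x where "x = 1 / (2 * real n * e)"
  have ne: "0 < 2 * real n * e" using error_parameter_pos[OF e] by simp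
  have x0: "0 < x" using ne by (simp add: x_def)
  have xm: "x \<le> real m" unfolding x_def using e ne by (simp add: divide_le_eq mult_ac)
  let ?b = "x / real (Suc a)"
  have b: "1 / (2 * e * real n * real (Suc a)) = ?b" by (simp add: x_def mult_ac)
  have "?b \<le> real (a + m) / real a" using x0 xm a by (intro frac_le) simp_all
  then have "?b ^ a \<le> (real (a + m) / real a) ^ a" using x0 by (intro power_mono) simp_all
  also have "\<dots> \<le> real ((a + m) choose a)" using binomial_ge_n_over_k_pow_k[of a "a + m", where 'a = real] by simp
  also have "(a + m) choose a = (a + m) choose m" using binomial_symmetric[of a "a + m"] by simp
  finally have "ln (?b ^ a) \<le> ln (real ((a + m) choose m))" using x0 by (intro ln_mono) simp_all
  then have "real a * ln ?b \<le> D" using D x0 by (simp add: ln_realpow)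
  then show ?thesis unfolding b .
qed

text \<open>If \<open>2 m \<le> a\<close> then the binomial coefficient is at least \<open>3\<^sup>m\<close>, so \<open>D \<ge> m\<close>;
  otherwise it is at least \<open>(3/2)\<^sup>a\<close>, so \<open>1 / D\<close> is absorbed by the error term.\<close>
lemma error_bound_asymptotic:
  fixes D e :: real
  assumes e: "1 \<le> 2 * real n * real m * e" and D: "ln (real ((a + m) choose m)) \<le> D" and a: "1 \<le> a" and n: "0 < n"
  shows "1 / (2 * real n) * (1 / D) - 3 / (real n * real (Suc a)) \<le> e"
proof -
  have m: "0 < m" and e0: "0 < e" using error_parameter_pos[OF e] by auto
  show ?thesis
  proof (cases "2 * m \<le> a")
    case True
    have "3 \<le> real (a + m) / real m" using True m by (simp add: le_divide_eq)
    then have "3 ^ m \<le> (real (a + m) / real m) ^ m" by (intro power_mono) simp_all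
    also have "\<dots> \<le> real ((a + m) choose m)" using binomial_ge_n_over_k_pow_k[of m "a + m", where 'a = real] by simp
    finally have "ln (3 ^ m) \<le> ln (real ((a + m) choose m))" by (intro ln_mono) simp_all
    then have "real m * ln 3 \<le> D" using D by (simp add: ln_realpow)
    moreover have "1 \<le> ln (3::real)" using exp_le by (simp add: ln_ge_iff)
    then have "real m * 1 \<le> real m * ln 3" by (intro mult_left_mono) simp_all
    ultimately have mD: "real m \<le> D" by simp
    have "1 / (2 * real n) * (1 / D) \<le> 1 / (2 * real n) * (1 / real m)"
      using mD m by (intro mult_left_mono divide_left_mono) simp_all
    also have "\<dots> \<le> e" using e n m by (simp add: divide_le_eq mult_ac)
    finally have "1 / (2 * real n) * (1 / D) \<le> e" .
    moreover have "0 \<le> 3 / (real n * real (Suc a))" by simp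
    ultimately show ?thesis by linarith
  next
    case False
    have "3 / 2 \<le> real (a + m) / real a" using False a by (simp add: le_divide_eq)
    then have "(3 / 2) ^ a \<le> (real (a + m) / real a) ^ a" by (intro power_mono) simp_all
    also have "\<dots> \<le> real ((a + m) choose a)" using binomial_ge_n_over_k_pow_k[of a "a + m", where 'a = real] by simp
    also have "(a + m) choose a = (a + m) choose m" using binomial_symmetric[of a "a + m"] by simp
    finally have "ln ((3 / 2) ^ a) \<le> ln (real ((a + m) choose m))" by (intro ln_mono) simp_all
    then have "real a * ln (3 / 2) \<le> D" using D by (simp add: ln_realpow)
    \<comment> \<open>With a >= 1 this gives D >= a/3 >= (a + 1)/6, so 1 / (2 n D) is at most 3 / (n
      (a + 1)): the origin of the constant 3.\<close>
    moreover have "1 / 3 \<le> ln (3 / 2 :: real)" 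
      using ln_le_minus_one[of "2 / 3 :: real"] by (simp add: ln_div)
    then have "real a * (1 / 3) \<le> real a * ln (3 / 2)" by (intro mult_left_mono) simp_all
    ultimately have "real a * (1 / 3) \<le> D" by (meson order_trans)
    then have "real (Suc a) / 6 \<le> D" using a by simp
    then have "1 / D \<le> 1 / (real (Suc a) / 6)" by (intro divide_left_mono) simp_all
    then have "1 / (2 * real n) * (1 / D) \<le> 1 / (2 * real n) * (1 / (real (Suc a) / 6))" by (intro mult_left_mono) simp_all
    also have "\<dots> = 3 / (real n * real (Suc a))" by simp
    finally show ?thesis using e0 by linarith
  qed
qed

theorem theorem4:
  shows
  "(\<exists>c::real. \<forall>n d dL V Ur \<phi>. setting n d dL V Ur \<phi> \<longrightarrow>
      (let ew = eps_worst dL (n * dimA n d) (noisy_code n d V \<phi>);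
           ee = real dL * eps_e dL (n * dimA n d) (noisy_code n d V \<phi>) / 2
       in ew \<ge> 1 / (2 * real n) * (1 / maxlog n d) - c / (real n * real dL) \<and>
          ee \<ge> 1 / (2 * real n) * (1 / maxlog n d) - c / (real n * real dL))) \<and>
   (\<forall>n d dL V Ur \<phi>. setting n d dL V Ur \<phi> \<longrightarrow>
      (let ew = eps_worst dL (n * dimA n d) (noisy_code n d V \<phi>);
           ee = real dL * eps_e dL (n * dimA n d) (noisy_code n d V \<phi>) / 2
       in maxlog n d \<ge> ln (real dL - 1) / (2 * real n * ew)
                        - ln (1 + 1 / (2 * real n * ew)) / (2 * real n * ew) \<and>
          maxlog n d \<ge> (real dL - 1) * ln (1 / (2 * ew * real n * real dL)) \<and>
          maxlog n d \<ge> (real dL - 1) * ln (1 / (2 * ee * real n * real dL))))"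
proof -
  have bounds: "1 / (2 * real n) * (1 / maxlog n d) - 3 / (real n * real dL) \<le> ew \<and>
      1 / (2 * real n) * (1 / maxlog n d) - 3 / (real n * real dL) \<le> ee \<and>
      ln (real dL - 1) / (2 * real n * ew) - ln (1 + 1 / (2 * real n * ew)) / (2 * real n * ew) \<le> maxlog n d \<and>
      (real dL - 1) * ln (1 / (2 * ew * real n * real dL)) \<le> maxlog n d \<and>
      (real dL - 1) * ln (1 / (2 * ee * real n * real dL)) \<le> maxlog n d"
    if S: "setting n d dL V Ur \<phi>" and ew: "ew = eps_worst dL (n * dimA n d) (noisy_code n d V \<phi>)"
      and ee: "ee = real dL * eps_e dL (n * dimA n d) (noisy_code n d V \<phi>) / 2" for n d dL V Ur \<phi> ew ee
  proof -
    have n: "0 < n" and dL: "2 \<le> dL" using S by (auto simp: setting_def)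
    then have a: "1 \<le> dL - 1" "Suc (dL - 1) = dL" "real (dL - 1) = real dL - 1" by auto
    obtain m where m: "1 \<le> 2 * real n * real m * ew" "1 \<le> 2 * real n * real m * ee"
      "ln (real ((dL - 1 + m) choose m)) \<le> maxlog n d"
      using eps_lower_bounds[OF S] unfolding ew ee by blast
    show ?thesis
      using error_bound_asymptotic[OF m(1,3) a(1) n] error_bound_asymptotic[OF m(2,3) a(1) n]
        dimension_bound_polynomial[OF m(1,3) a(1)]
        dimension_bound_exponential[OF m(1,3) a(1)] dimension_bound_exponential[OF m(2,3) a(1)]
      unfolding a(2,3) by (intro conjI)
  qed
  show ?thesis
    unfolding Let_def
    by (intro conjI exI[of _ 3] allI impI; use bounds[OF _ refl refl] in simp)
qed

end
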